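(* Let $G$ be a very well-covered graph on $2d$ vertices, $d\ge1$, with no isolated vertices. Then $\operatorname{Ind}(G)$ is a pseudomanifold if and only if $I(G)$ is Cohen–Macaulay. Furthermore, if $\operatorname{Ind}(G)$ is a pseudomanifold, then $\operatorname{Ind}(G)$ has a boundary if and only if $G\neq dK_2$, i.e., $G$ is not the graph consisting of $d$ disjoint edges.
   Context: A graph is very well-covered if every maximal independent set has cardinality $|V|/2$. $I(G)$ is the edge ideal; $\operatorname{Ind}(G)$ is the simplicial complex of independent sets of $G$. A pure $(d-1)$-dimensional complex is a pseudomanifold if every $(d-2)$-dimensional face lies in at most two facets and it is strongly connected (any two facets are linked by a chain of facets, consecutive ones sharing a $(d-2)$-face). A pseudomanifold has a boundary if some $(d-2)$-dimensional face lies in exactly one facet. *)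

theory Defs
  imports
    "HOL-Algebra.QuotRing"
    "HOL-Library.Poly_Mapping"
    "HOL-Library.Extended_Nat"
begin

section \<open>Graphs\<close>

definition simple_graph :: "'v set \<Rightarrow> 'v set set \<Rightarrow> bool" where
  "simple_graph V E \<longleftrightarrow> finite V \<and> (\<forall>e\<in>E. e \<subseteq> V \<and> card e = 2)"

definition independent_set :: "'v set \<Rightarrow> 'v set set \<Rightarrow> 'v set \<Rightarrow> bool" where
  "independent_set V E S \<longleftrightarrow> S \<subseteq> V \<and> (\<forall>e\<in>E. \<not> e \<subseteq> S)"

definition maximal_independent_set :: "'v set \<Rightarrow> 'v set set \<Rightarrow> 'v set \<Rightarrow> bool" where
  "maximal_independent_set V E S \<longleftrightarrow>
     independent_set V E S \<and> (\<forall>T. independent_set V E T \<longrightarrow> S \<subseteq> T \<longrightarrow> T = S)"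

definition very_well_covered :: "'v set \<Rightarrow> 'v set set \<Rightarrow> bool" where
  "very_well_covered V E \<longleftrightarrow> (\<forall>S. maximal_independent_set V E S \<longrightarrow> 2 * card S = card V)"

definition no_isolated_vertices :: "'v set \<Rightarrow> 'v set set \<Rightarrow> bool" where
  "no_isolated_vertices V E \<longleftrightarrow> (\<forall>v\<in>V. \<exists>e\<in>E. v \<in> e)"

definition is_dK2 :: "nat \<Rightarrow> 'v set \<Rightarrow> 'v set set \<Rightarrow> bool" where
  "is_dK2 d V E \<longleftrightarrow>
     simple_graph V E \<and> card E = d \<and> (\<forall>e\<in>E. \<forall>e'\<in>E. e \<noteq> e' \<longrightarrow> e \<inter> e' = {}) \<and> \<Union>E = V"


section \<open>Simplicial complexes\<close>

text \<open>A complex is given by the set of its faces, the empty face included.\<close>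

definition simplicial_complex :: "'v set set \<Rightarrow> bool" where
  "simplicial_complex \<Delta> \<longleftrightarrow>
     finite \<Delta> \<and> (\<forall>F\<in>\<Delta>. finite F) \<and> {} \<in> \<Delta> \<and> (\<forall>F\<in>\<Delta>. \<forall>F'. F' \<subseteq> F \<longrightarrow> F' \<in> \<Delta>)"

text \<open>Dimensions are integers, so that the empty face has dimension \<open>-1\<close>.\<close>

definition face_dim :: "'v set \<Rightarrow> int" where
  "face_dim F = int (card F) - 1"

definition complex_dim :: "'v set set \<Rightarrow> int" where
  "complex_dim \<Delta> = Max (face_dim ` \<Delta>)"

definition facets :: "'v set set \<Rightarrow> 'v set set" where
  "facets \<Delta> = {F \<in> \<Delta>. \<forall>F'\<in>\<Delta>. F \<subseteq> F' \<longrightarrow> F' = F}"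

definition pure_complex :: "'v set set \<Rightarrow> bool" where
  "pure_complex \<Delta> \<longleftrightarrow> (\<forall>F\<in>facets \<Delta>. face_dim F = complex_dim \<Delta>)"

definition ridges :: "'v set set \<Rightarrow> 'v set set" where
  "ridges \<Delta> = {R \<in> \<Delta>. face_dim R = complex_dim \<Delta> - 1}"

definition facets_containing :: "'v set set \<Rightarrow> 'v set \<Rightarrow> 'v set set" where
  "facets_containing \<Delta> R = {F \<in> facets \<Delta>. R \<subseteq> F}"

definition strongly_connected :: "'v set set \<Rightarrow> bool" where
  "strongly_connected \<Delta> \<longleftrightarrow>
     (\<forall>F\<in>facets \<Delta>. \<forall>F'\<in>facets \<Delta>.
        (F, F') \<in> {(A, B). A \<in> facets \<Delta> \<and> B \<in> facets \<Delta> \<and> (\<exists>R\<in>ridges \<Delta>. R \<subseteq> A \<and> R \<subseteq> B)}\<^sup>*)"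

definition pseudomanifold :: "'v set set \<Rightarrow> bool" where
  "pseudomanifold \<Delta> \<longleftrightarrow>
     simplicial_complex \<Delta> \<and> pure_complex \<Delta> \<and>
     (\<forall>R\<in>ridges \<Delta>. card (facets_containing \<Delta> R) \<le> 2) \<and>
     strongly_connected \<Delta>"

definition has_boundary :: "'v set set \<Rightarrow> bool" where
  "has_boundary \<Delta> \<longleftrightarrow> (\<exists>R\<in>ridges \<Delta>. card (facets_containing \<Delta> R) = 1)"

definition Ind :: "'v set \<Rightarrow> 'v set set \<Rightarrow> 'v set set" where
  "Ind V E = {S. independent_set V E S}"


section \<open>Polynomial rings and edge ideals\<close>

text \<open>Monomials are exponent vectors of finite support; with the convolution product,
  \<open>('v \<Rightarrow>\<^sub>0 nat) \<Rightarrow>\<^sub>0 'k\<close> is the ring of polynomials over \<open>'k\<close> in variables indexed by \<open>'v\<close>.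
  The carrier below restricts to the variables in \<open>V\<close>.\<close>

type_synonym ('v, 'k) mpoly = "('v \<Rightarrow>\<^sub>0 nat) \<Rightarrow>\<^sub>0 'k"

definition poly_ring :: "'v set \<Rightarrow> ('v, 'k::field) mpoly ring" where
  "poly_ring V =
     \<lparr> carrier = {p. \<forall>m\<in>Poly_Mapping.keys p. Poly_Mapping.keys m \<subseteq> V},
       mult = (*), one = 1, zero = 0, add = (+) \<rparr>"

definition Var :: "'v \<Rightarrow> ('v, 'k::field) mpoly" where
  "Var v = Poly_Mapping.single (Poly_Mapping.single v 1) 1"

definition edge_ideal :: "'v set \<Rightarrow> 'v set set \<Rightarrow> ('v, 'k::field) mpoly set" where
  "edge_ideal V E = genideal (poly_ring V) {Var u * Var v | u v. {u, v} \<in> E}"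

text \<open>The zero polynomial is homogeneous of every degree.\<close>

definition homogeneous :: "nat \<Rightarrow> ('v, 'k::field) mpoly \<Rightarrow> bool" where
  "homogeneous n p \<longleftrightarrow> (\<forall>m\<in>Poly_Mapping.keys p. (\<Sum>v\<in>Poly_Mapping.keys m. Poly_Mapping.lookup m v) = n)"


section \<open>Krull dimension, depth, and the Cohen-Macaulay property\<close>

definition prime_chain :: "('a, 'b) ring_scheme \<Rightarrow> nat \<Rightarrow> (nat \<Rightarrow> 'a set) \<Rightarrow> bool" where
  "prime_chain A n P \<longleftrightarrow> (\<forall>i\<le>n. primeideal (P i) A) \<and> (\<forall>i<n. P i \<subset> P (Suc i))"

definition krull_dim :: "('a, 'b) ring_scheme \<Rightarrow> enat" where
  "krull_dim A = (SUP n\<in>{n. \<exists>P. prime_chain A n P}. enat n)"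

definition regular_sequence :: "('a, 'b) ring_scheme \<Rightarrow> 'a list \<Rightarrow> bool" where
  "regular_sequence A xs \<longleftrightarrow>
     set xs \<subseteq> carrier A \<and>
     (\<forall>i<length xs. \<forall>a\<in>carrier A.
        (xs ! i) \<otimes>\<^bsub>A\<^esub> a \<in> genideal A (set (take i xs)) \<longrightarrow> a \<in> genideal A (set (take i xs))) \<and>
     genideal A (set xs) \<noteq> carrier A"

text \<open>For an ideal \<open>I\<close> generated by homogeneous polynomials, the quotient of the polynomial ring
  by \<open>I\<close> inherits the standard grading.  The following set consists of its homogeneous elements
  of positive degree (with \<open>0\<close>).\<close>

definition pos_homogeneous_elements ::
    "'v set \<Rightarrow> ('v, 'k::field) mpoly set \<Rightarrow> ('v, 'k) mpoly set set" where
  "pos_homogeneous_elements V I =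
     {I +>\<^bsub>poly_ring V\<^esub> f | f n. f \<in> carrier (poly_ring V) \<and> 0 < n \<and> homogeneous n f}"

text \<open>As usual for standard graded algebras, depth is taken with respect to the graded maximal
  ideal: it is the largest length of a regular sequence of homogeneous elements of positive degree,
  and the algebra is Cohen-Macaulay if its depth equals its Krull dimension.\<close>

definition graded_depth :: "'v set \<Rightarrow> ('v, 'k::field) mpoly set \<Rightarrow> enat" where
  "graded_depth V I =
     (SUP xs\<in>{xs. regular_sequence (poly_ring V Quot I) xs \<and> set xs \<subseteq> pos_homogeneous_elements V I}.
        enat (length xs))"

text \<open>An ideal \<open>I\<close> is called Cohen-Macaulay if the quotient ring by \<open>I\<close> is.\<close>

definition cohen_macaulay_ideal :: "'v set \<Rightarrow> ('v, 'k::field) mpoly set \<Rightarrow> bool" where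
  "cohen_macaulay_ideal V I \<longleftrightarrow> graded_depth V I = krull_dim (poly_ring V Quot I)"

end

theory Submission
  imports Defs
begin

text \<open>A very well-covered graph without isolated vertices has a perfect matching \<open>m\<close>; every
  facet of the independence complex contains exactly one vertex of each matching edge, so moving
  across a ridge replaces a vertex \<open>v\<close> by \<open>m v\<close>.  Both the pseudomanifold property and
  Cohen-Macaulayness amount to the absence of parallel edges \<open>{u, v}\<close>, \<open>{m u, m v}\<close> with
  \<open>v \<noteq> m u\<close>.  Such a pair forces every facet to contain both or none of \<open>u\<close> and \<open>m v\<close>, which
  separates the facets into two classes that no flip connects; without such a pair the obstructions
  to flipping the vertices of one facet towards another form a strict order, and a minimal
  vertex can be flipped.

  On the algebraic side, a regular sequence of homogeneous elements, like a strict chain of primes, admits no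
  polynomial relation: the lexicographically lowest term of a relation would be a unit in a proper ideal.
  Counting monomials modulo the edge ideal thus bounds depth and dimension by \<open>d\<close>, and
  monomial primes show that the dimension is \<open>d\<close>.  Without parallel edges, the elements
  \<open>x - m x\<close>, for \<open>x\<close> in a facet, form a regular sequence: identifying \<open>m x\<close> with \<open>x\<close> leaves
  a monomial ideal, for which regularity is read off from the monomials.
  With parallel edges, \<open>u / (u - m u)\<close> is a
  fraction outside the quotient ring whose denominators contain \<open>u\<close>, \<open>m u\<close>, \<open>v\<close> and \<open>m v\<close>, so
  they cut out dimension at most \<open>d - 2\<close>.  If \<open>t\<^sub>1, \<dots>, t\<^sub>d\<close> were a regular sequence, then for every \<open>i\<close> the
  denominators would contain a non-zero polynomial in the \<open>t\<^sub>j\<close> with \<open>j \<noteq> i\<close>.  These have no common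
  factor, and the fraction would lie in the ring (Hartshorne's connectedness theorem in this case).\<close>

section \<open>Matchings and flips in very well-covered graphs\<close>

text \<open>Two combinatorial facts carry the proof. The matching comes from Hall's condition, which
  holds because \<open>A\<close> can be exchanged for part of a maximal independent set, and such an
  exchange never gains when all maximal independent sets have the same size. And every neighbour of
  \<open>v\<close> is joined to every neighbour of \<open>m v\<close> (\<open>edge_across\<close>):
  this makes obstructions to flips transitive, and it merges a generator through \<open>x\<close>
  with one through \<open>m x\<close> into one avoiding both, which gives regularity of
  \<open>x - m x\<close>.

  In place of Hilbert functions and transcendence degree there is one pigeonhole count: among
  products of more than \<open>k\<close> given polynomials some combination has no monomial
  supported on a complex whose faces have at most \<open>k\<close> elements. With
  \<open>k = d\<close> it bounds both depth and dimension. With \<open>k = d - 2\<close> it leaves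
  room to omit any one of \<open>d\<close> elements, so the connectedness argument has a denominator
  for each omitted index. Homogeneity of positive degree enters as descent on the degree, where a
  local ring would use Krull's intersection theorem.\<close>

text \<open>Rado's argument: while some \<open>A i\<close> has two elements, one of them can be
  deleted without violating Hall's condition. If both deletions failed, with families
  \<open>J\<close> and \<open>K\<close>, counting union and intersection of the two deficient unions
  would give a contradiction. When no set has more than one element, the condition says that they
  are distinct singletons.\<close>

lemma hall_marriage:
  fixes A :: "'i \<Rightarrow> 'b set"
  assumes "finite I" and "\<And>i. i \<in> I \<Longrightarrow> finite (A i)"
    and "\<And>J. J \<subseteq> I \<Longrightarrow> card J \<le> card (\<Union>(A ` J))"
  shows "\<exists>f. inj_on f I \<and> (\<forall>i\<in>I. f i \<in> A i)"
  using assms(2,3)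
proof (induction "\<Sum>i\<in>I. card (A i)" arbitrary: A rule: less_induct)
  case less
  note fin = less.prems(1) and hall = less.prems(2)
  show ?case
  proof (cases "\<forall>i\<in>I. card (A i) \<le> 1")
    case True
    have "\<exists>x. A i = {x}" if "i \<in> I" for i
    proof -
      have "card (A i) = 1" using hall[of "{i}"] True that by (simp add: le_antisym)
      then show ?thesis by (rule card_1_singletonE) blast
    qed
    then obtain f where f: "\<And>i. i \<in> I \<Longrightarrow> A i = {f i}" by metis
    have "inj_on f I"
    proof (rule inj_onI, rule ccontr)
      fix i j assume "i \<in> I" "j \<in> I" "f i = f j" "i \<noteq> j"
      then show False using hall[of "{i, j}"] f by simp
    qed
    then show ?thesis using f by blast
  next
    case False
    then obtain i where i: "i \<in> I" "\<not> card (A i) \<le> 1" by blast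
    then obtain x y where xy: "x \<in> A i" "y \<in> A i" "x \<noteq> y"
      using card_le_Suc0_iff_eq[OF fin[OF i(1)]] by auto
    have *: "\<exists>J. J \<subseteq> I - {i} \<and> card ((A i - {z}) \<union> \<Union>(A ` J)) \<le> card J"
      if z: "z \<in> A i" and no: "\<not> (\<exists>f. inj_on f I \<and> (\<forall>i\<in>I. f i \<in> A i))" for z
    proof (rule ccontr)
      assume neg: "\<not> ?thesis"
      let ?B = "A(i := A i - {z})"
      have "card (A i - {z}) < card (A i)" using fin[OF i(1)] z by (rule card_Diff1_less)
      then have "(\<Sum>j\<in>I. card (?B j)) < (\<Sum>j\<in>I. card (A j))"
        using i(1) assms(1) by (intro sum_strict_mono_ex1) (auto simp: less_imp_le)
      moreover have "card J \<le> card (\<Union>(?B ` J))" if J: "J \<subseteq> I" for J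
      proof (cases "i \<in> J")
        case True
        have eq: "\<Union>(?B ` J) = (A i - {z}) \<union> \<Union>(A ` (J - {i}))" using True by (auto split: if_splits)
        have "J - {i} \<subseteq> I - {i}" using J by blast
        then have "card (J - {i}) < card (\<Union>(?B ` J))" using neg eq by (metis not_le)
        then show ?thesis using True finite_subset[OF J assms(1)] by (simp add: card_Diff_singleton)
      next
        case False
        then have "\<Union>(?B ` J) = \<Union>(A ` J)" by auto
        then show ?thesis using hall[OF J] by simp
      qed
      moreover have "finite (?B j)" if "j \<in> I" for j using fin that by auto
      ultimately obtain f where "inj_on f I" "\<forall>j\<in>I. f j \<in> ?B j" using less.hyps[of ?B] by blast
      then have "inj_on f I \<and> (\<forall>i\<in>I. f i \<in> A i)" by (auto split: if_splits)
      then show False using no by blast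
    qed
    show ?thesis
    proof (rule ccontr)
      assume no: "\<not> ?thesis"
      obtain J K where J: "J \<subseteq> I - {i}" "card ((A i - {x}) \<union> \<Union>(A ` J)) \<le> card J"
        and K: "K \<subseteq> I - {i}" "card ((A i - {y}) \<union> \<Union>(A ` K)) \<le> card K"
        using *[OF xy(1) no] *[OF xy(2) no] by blast
      let ?B = "(A i - {x}) \<union> \<Union>(A ` J)" and ?C = "(A i - {y}) \<union> \<Union>(A ` K)"
      have fJK: "finite J" "finite K" using J(1) K(1) assms(1) finite_subset by blast+
      have fBC: "finite ?B" "finite ?C" using fin i(1) J(1) K(1) fJK by blast+
      \<comment> \<open>As \<open>x \<noteq> y\<close>, the two deletions together still cover
        \<open>A i\<close>, so the union serves \<open>J\<close>, \<open>K\<close> and also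
        \<open>i\<close>: this extra index is the contradiction.\<close>
      have eq: "?B \<union> ?C = \<Union>(A ` insert i (J \<union> K))" using xy by auto
      have "card (insert i (J \<union> K)) \<le> card (\<Union>(A ` insert i (J \<union> K)))"
        using J(1) K(1) i(1) by (intro hall) blast
      moreover have "card (insert i (J \<union> K)) = card (J \<union> K) + 1"
        using J(1) K(1) fJK by (subst card_insert_disjoint) auto
      ultimately have "card (J \<union> K) + 1 \<le> card (?B \<union> ?C)" using eq by simp
      moreover have "card (J \<inter> K) \<le> card (\<Union>(A ` (J \<inter> K)))" using J(1) by (intro hall) blast
      moreover have "card (\<Union>(A ` (J \<inter> K))) \<le> card (?B \<inter> ?C)"
        using fBC by (intro card_mono) auto
      ultimately show False
        using J(2) K(2) card_Un_Int[OF fBC] card_Un_Int[OF fJK] by linarith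
    qed
  qed
qed

section \<open>Independent sets and the perfect matching\<close>

lemma simple_graph_edgeD:
  assumes "simple_graph V E" "{u, v} \<in> E"
  shows "u \<in> V" "v \<in> V" "u \<noteq> v"
proof -
  have "{u, v} \<subseteq> V" "card {u, v} = 2" using assms by (auto simp: simple_graph_def)
  then show "u \<in> V" "v \<in> V" "u \<noteq> v" by (auto simp: card_insert_if split: if_splits)
qed

lemma simple_graph_edgeE:
  assumes "simple_graph V E" "e \<in> E"
  obtains u v where "e = {u, v}" "u \<noteq> v"
  using assms by (auto simp: simple_graph_def card_2_iff)

lemma independent_set_iff:
  assumes "simple_graph V E"
  shows "independent_set V E S \<longleftrightarrow> S \<subseteq> V \<and> (\<forall>u\<in>S. \<forall>v\<in>S. {u, v} \<notin> E)"
proof -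
  have "(\<forall>e\<in>E. \<not> e \<subseteq> S) \<longleftrightarrow> (\<forall>u\<in>S. \<forall>v\<in>S. {u, v} \<notin> E)"
  proof (intro iffI ballI notI)
    fix e assume *: "\<forall>u\<in>S. \<forall>v\<in>S. {u, v} \<notin> E" and e: "e \<in> E" "e \<subseteq> S"
    from e(1) obtain u v where "e = {u, v}" by (rule simple_graph_edgeE[OF assms])
    then show False using * e by simp
  qed auto
  then show ?thesis by (simp add: independent_set_def)
qed

lemma extend_to_maximal_independent_set:
  assumes "simple_graph V E" "independent_set V E S"
  obtains T where "maximal_independent_set V E T" "S \<subseteq> T"
proof -
  let ?X = "{T. independent_set V E T \<and> S \<subseteq> T}"
  have "finite V" using assms(1) by (simp add: simple_graph_def)
  then have "finite ?X" by (rule_tac finite_subset[of _ "Pow V"]) (auto simp: independent_set_def)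
  moreover have "?X \<noteq> {}" using assms(2) by blast
  ultimately obtain T where "T \<in> ?X" "\<forall>T'\<in>?X. T \<subseteq> T' \<longrightarrow> T = T'"
    using finite_has_maximal[of ?X] by blast
  then show thesis using that[of T] unfolding maximal_independent_set_def by blast
qed

definition neighbours :: "'v set set \<Rightarrow> 'v set \<Rightarrow> 'v set" where
  "neighbours E A = {u. \<exists>a\<in>A. {a, u} \<in> E}"

text \<open>A violator \<open>A\<close> yields a smaller one. Take a maximal independent set
  \<open>D\<close> through a neighbour of some \<open>a \<in> A\<close>. Replacing \<open>X\<close>,
  the part of \<open>D\<close> adjacent to \<open>A\<close>, by \<open>A\<close> leaves an
  independent set, which is no larger than \<open>D\<close>. Hence the part \<open>A1\<close> of
  \<open>A\<close> adjacent to \<open>X\<close> has at most \<open>card X\<close> elements, while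
  \<open>A - A1\<close> loses all of \<open>X\<close> as neighbours.\<close>

lemma card_le_card_neighbours:
  assumes G: "simple_graph V E" and wc: "very_well_covered V E" and iso: "no_isolated_vertices V E"
    and "independent_set V E A"
  shows "card A \<le> card (neighbours E A)"
  using assms(4)
proof (induction "card A" arbitrary: A rule: less_induct)
  case less
  have A: "A \<subseteq> V" and Aind: "\<forall>u\<in>A. \<forall>v\<in>A. {u, v} \<notin> E"
    using less.prems independent_set_iff[OF G] by auto
  have finV: "finite V" using G by (simp add: simple_graph_def)
  have finA: "finite A" using A finV finite_subset by blast
  have finN: "finite (neighbours E B)" for B
    by (rule finite_subset[OF _ finV]) (auto simp: neighbours_def simple_graph_edgeD[OF G])
  show ?case
  proof (rule ccontr)
    assume neg: "\<not> ?thesis"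
    then obtain a where a: "a \<in> A" using finA by fastforce
    then obtain e where e: "e \<in> E" "a \<in> e" using iso A unfolding no_isolated_vertices_def by blast
    from e(1) obtain p q where "e = {p, q}" by (rule simple_graph_edgeE[OF G])
    then obtain v where v: "{a, v} \<in> E" using e by (auto simp: insert_commute)
    have "independent_set V E {v}"
      using v simple_graph_edgeD[OF G v] simple_graph_edgeD(3)[OF G, of v v] by (auto simp: independent_set_iff[OF G])
    then obtain D where D: "maximal_independent_set V E D" "v \<in> D"
      by (metis G extend_to_maximal_independent_set insert_subset)
    have Dind: "D \<subseteq> V" "\<forall>u\<in>D. \<forall>v\<in>D. {u, v} \<notin> E"
      using D(1) independent_set_iff[OF G] by (auto simp: maximal_independent_set_def)
    have finD: "finite D" using Dind(1) finV finite_subset by blast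
    define X where "X = D \<inter> neighbours E A"
    define A1 where "A1 = A \<inter> neighbours E X"
    have sym: "{p, q} \<in> E \<Longrightarrow> {q, p} \<in> E" for p q by (simp add: insert_commute)
    have "independent_set V E ((D - X) \<union> A)"
      unfolding independent_set_iff[OF G] X_def neighbours_def using Dind A Aind sym by blast
    then obtain T where T: "maximal_independent_set V E T" "(D - X) \<union> A \<subseteq> T"
      using G extend_to_maximal_independent_set by blast
    have "card ((D - X) \<union> A) \<le> card T"
      using T finV by (intro card_mono) (auto simp: maximal_independent_set_def independent_set_def intro: finite_subset)
    moreover have "card T = card D"
      using T(1) D(1) wc unfolding very_well_covered_def by (metis mult_cancel1 zero_neq_numeral)
    moreover have "A1 \<inter> D = {}" using Dind unfolding A1_def X_def neighbours_def by blast
    then have "card (D - X) + card A1 \<le> card ((D - X) \<union> A)"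
      using finD finA card_mono[of "(D - X) \<union> A" "(D - X) \<union> A1"] unfolding A1_def
      by (subst card_Un_disjoint[symmetric]) auto
    moreover have "card (D - X) = card D - card X" "card X \<le> card D"
      using finD by (auto simp: X_def card_Diff_subset card_mono)
    ultimately have le: "card A1 \<le> card X" by linarith
    \<comment> \<open>The descent is strict: \<open>D\<close> was taken through the neighbour
      \<open>v\<close> of \<open>a\<close> so that \<open>A1\<close> is not empty.\<close>
    have aA1: "a \<in> A1" using a v D(2) sym unfolding A1_def X_def neighbours_def by blast
    have cA: "card (A - A1) = card A - card A1" "card A1 \<le> card A"
      using finA by (auto simp: A1_def card_Diff_subset card_mono)
    have cN: "card (neighbours E A - X) = card (neighbours E A) - card X" "card X \<le> card (neighbours E A)"
      using finN finD by (auto simp: X_def card_Diff_subset card_mono)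
    have "neighbours E (A - A1) \<subseteq> neighbours E A - X"
      using sym unfolding A1_def neighbours_def by blast
    then have "card (neighbours E (A - A1)) \<le> card (neighbours E A) - card X"
      by (metis cN(1) card_mono finN finite_Diff)
    moreover have "card (A - A1) < card A" using aA1 finA a by (intro psubset_card_mono) auto
    moreover have "independent_set V E (A - A1)" using less.prems by (auto simp: independent_set_def)
    ultimately show False using less.hyps[of "A - A1"] neg le cA cN by linarith
  qed
qed

lemma very_well_covered_perfect_matching:
  assumes G: "simple_graph V E" and wc: "very_well_covered V E" and iso: "no_isolated_vertices V E"
  obtains m where "\<And>v. v \<in> V \<Longrightarrow> {v, m v} \<in> E" "\<And>v. v \<in> V \<Longrightarrow> m (m v) = v"
proof -
  have finV: "finite V" using G by (simp add: simple_graph_def)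
  have "independent_set V E {}" using G by (simp add: independent_set_iff)
  then obtain S where S: "maximal_independent_set V E S" using G extend_to_maximal_independent_set by blast
  have Sind: "S \<subseteq> V" "\<forall>u\<in>S. \<forall>v\<in>S. {u, v} \<notin> E"
    using S independent_set_iff[OF G] by (auto simp: maximal_independent_set_def)
  have finS: "finite S" using Sind finV finite_subset by blast
  have "card J \<le> card (\<Union>((\<lambda>v. neighbours E {v}) ` J))" if "J \<subseteq> S" for J
  proof -
    have "independent_set V E J" using that Sind by (auto simp: independent_set_iff[OF G])
    moreover have "\<Union>((\<lambda>v. neighbours E {v}) ` J) = neighbours E J" by (auto simp: neighbours_def)
    ultimately show ?thesis using card_le_card_neighbours[OF G wc iso] by simp
  qed
  moreover have "finite (neighbours E {v})" for v
    by (rule finite_subset[OF _ finV]) (auto simp: neighbours_def simple_graph_edgeD[OF G])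
  ultimately have "\<exists>h. inj_on h S \<and> (\<forall>v\<in>S. h v \<in> neighbours E {v})"
    by (intro hall_marriage[OF finS])
  then obtain h where h: "inj_on h S" "\<And>v. v \<in> S \<Longrightarrow> h v \<in> neighbours E {v}" by blast
  have hE: "{v, h v} \<in> E" if "v \<in> S" for v using h(2)[OF that] by (simp add: neighbours_def)
  have sub: "h ` S \<subseteq> V - S" using hE Sind(2) simple_graph_edgeD[OF G] by blast
  \<comment> \<open>The value \<open>card V / 2\<close>, and not just equality of all sizes, makes
    the injection \<open>h\<close> a bijection onto \<open>V - S\<close>.\<close>
  have "2 * card S = card V" using S wc by (simp add: very_well_covered_def)
  then have "card (V - S) = card (h ` S)"
    using Sind(1) finV finS h(1) by (simp add: card_Diff_subset card_image)
  then have im: "h ` S = V - S" using sub finV by (metis card_subset_eq finite_Diff)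
  define m where "m v = (if v \<in> S then h v else inv_into S h v)" for v
  have inv: "inv_into S h v \<in> S" "h (inv_into S h v) = v" if "v \<in> V" "v \<notin> S" for v
    using that im inv_into_into[of v h S] f_inv_into_f[of v h S] by auto
  show thesis
  proof (rule that[of m])
    fix v assume v: "v \<in> V"
    show "{v, m v} \<in> E"
    proof (cases "v \<in> S")
      case True
      then show ?thesis using hE by (simp add: m_def)
    next
      case False
      then show ?thesis using hE[OF inv(1)[OF v]] inv(2)[OF v] by (simp add: m_def insert_commute)
    qed
    show "m (m v) = v"
    proof (cases "v \<in> S")
      case True
      then have "h v \<notin> S" using sub by blast
      then show ?thesis using True inv_into_f_f[OF h(1) True] by (simp add: m_def)
    next
      case False
      then show ?thesis using inv[OF v] by (simp add: m_def)
    qed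
  qed
qed

section \<open>Facets in the presence of a fixed perfect matching\<close>

text \<open>The matching encodes the absence of isolated vertices. It is an involution on
  \<open>V\<close> with arbitrary values elsewhere, so that cancelling \<open>m (m v)\<close> always
  calls for \<open>v \<in> V\<close>.\<close>

locale matched_graph =
  fixes V :: "'v set" and E :: "'v set set" and m :: "'v \<Rightarrow> 'v" and d :: nat
  assumes G: "simple_graph V E" and wc: "very_well_covered V E" and cardV: "card V = 2 * d"
    and matching: "v \<in> V \<Longrightarrow> {v, m v} \<in> E" "v \<in> V \<Longrightarrow> m (m v) = v"
begin

lemma finV: "finite V"
  using G by (simp add: simple_graph_def)

lemma edgeD: "{u, v} \<in> E \<Longrightarrow> u \<in> V" "{u, v} \<in> E \<Longrightarrow> v \<in> V" "{u, v} \<in> E \<Longrightarrow> u \<noteq> v"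
  using simple_graph_edgeD[OF G] by blast+

lemma matching_in [simp]: "v \<in> V \<Longrightarrow> m v \<in> V"
  and matching_neq [simp]: "v \<in> V \<Longrightarrow> m v \<noteq> v"
  using matching(1) edgeD by metis+

lemma inj_matching: "inj_on m V"
  by (metis inj_onI matching(2))

lemma Ind_iff: "S \<in> Ind V E \<longleftrightarrow> S \<subseteq> V \<and> (\<forall>u\<in>S. \<forall>v\<in>S. {u, v} \<notin> E)"
  by (simp add: Ind_def independent_set_iff[OF G])

lemma facets_Ind: "facets (Ind V E) = {F. maximal_independent_set V E F}"
  unfolding facets_def Ind_def maximal_independent_set_def by blast

lemma facet_Ind: "F \<in> facets (Ind V E) \<Longrightarrow> F \<in> Ind V E"
  by (simp add: facets_def)

lemma card_facet: "F \<in> facets (Ind V E) \<Longrightarrow> card F = d"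
  using wc cardV by (auto simp: facets_Ind very_well_covered_def)

lemma Ind_extend:
  assumes "S \<in> Ind V E" obtains F where "F \<in> facets (Ind V E)" "S \<subseteq> F"
proof -
  have "independent_set V E S" using assms by (simp add: Ind_def)
  then obtain T where "maximal_independent_set V E T" "S \<subseteq> T"
    by (rule extend_to_maximal_independent_set[OF G])
  then show thesis using that by (simp add: facets_Ind)
qed

lemma card_le: "S \<in> Ind V E \<Longrightarrow> card S \<le> d"
proof -
  assume "S \<in> Ind V E"
  then obtain F where F: "F \<in> facets (Ind V E)" "S \<subseteq> F" by (rule Ind_extend)
  then have "finite F" using facet_Ind Ind_iff finV finite_subset by metis
  then show ?thesis using F card_facet card_mono by metis
qed

lemma facetI: "F \<in> Ind V E \<Longrightarrow> card F = d \<Longrightarrow> F \<in> facets (Ind V E)"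
proof -
  assume F: "F \<in> Ind V E" "card F = d"
  then obtain T where T: "T \<in> facets (Ind V E)" "F \<subseteq> T" by (elim Ind_extend)
  then have "finite T" using facet_Ind Ind_iff finV finite_subset by metis
  then have "F = T" using card_subset_eq T card_facet F(2) by metis
  then show ?thesis using T by simp
qed

lemma facet_matching:
  assumes F: "F \<in> facets (Ind V E)" and v: "v \<in> V"
  shows "m v \<in> F \<longleftrightarrow> v \<notin> F"
proof -
  have FV: "F \<subseteq> V" and Find: "\<forall>u\<in>F. \<forall>w\<in>F. {u, w} \<notin> E"
    using facet_Ind[OF F] by (auto simp: Ind_iff)
  have disj: "F \<inter> m ` F = {}" using Find matching(1) FV by blast
  have "card (m ` F) = d" using inj_on_subset[OF inj_matching FV] card_facet[OF F] by (simp add: card_image)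
  moreover have "finite F" using FV finV finite_subset by blast
  ultimately have "card (F \<union> m ` F) = card V"
    using disj card_facet[OF F] cardV by (simp add: card_Un_disjoint)
  moreover have "F \<union> m ` F \<subseteq> V" using FV by auto
  ultimately have "F \<union> m ` F = V" using finV card_subset_eq by metis
  then have "v \<in> F \<or> (\<exists>w\<in>F. v = m w)" using v by blast
  then have "v \<in> F \<or> m v \<in> F" using matching(2) FV by auto
  moreover have "\<not> (v \<in> F \<and> m v \<in> F)" using Find matching(1)[OF v] by blast
  ultimately show ?thesis by blast
qed

text \<open>Otherwise a facet through \<open>z\<close> and \<open>w\<close> would contain neither
  \<open>v\<close> nor \<open>m v\<close>. The case \<open>z = w\<close> is included: as there are
  no loops, it shows that the two ends of a matching edge have no common neighbour.\<close>

lemma edge_across: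
  assumes "{z, v} \<in> E" "{w, m v} \<in> E"
  shows "{z, w} \<in> E"
proof (rule ccontr)
  assume neg: "{z, w} \<notin> E"
  have V: "z \<in> V" "w \<in> V" "v \<in> V" using assms edgeD by blast+
  have loops: "{u} \<notin> E" for u using edgeD(3)[of u u] by auto
  have "{w, z} \<notin> E" using neg by (simp add: insert_commute)
  then have "{z, w} \<in> Ind V E" using V neg loops by (auto simp: Ind_iff)
  then obtain F where F: "F \<in> facets (Ind V E)" "{z, w} \<subseteq> F" by (rule Ind_extend)
  then have "v \<notin> F" "m v \<notin> F" using assms facet_Ind[OF F(1)] unfolding Ind_iff by blast+
  then show False using facet_matching[OF F(1) V(3)] by blast
qed

text \<open>The exception \<open>v = m u\<close> is a matching edge, which \<open>m\<close> maps to
  itself.\<close>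

definition no_parallel_edges :: bool where
  "no_parallel_edges \<longleftrightarrow> (\<forall>u v. {u, v} \<in> E \<longrightarrow> {m u, m v} \<in> E \<longrightarrow> v = m u)"

text \<open>If \<open>u\<close> is in \<open>F\<close>, then \<open>v\<close> is not, so
  \<open>m v\<close> is; if \<open>m v\<close> is in \<open>F\<close>, then \<open>m u\<close> is
  not, so \<open>u\<close> is.\<close>

lemma facet_parallel:
  assumes "{u, v} \<in> E" "{m u, m v} \<in> E" "F \<in> facets (Ind V E)"
  shows "u \<in> F \<longleftrightarrow> m v \<in> F"
proof -
  have V: "u \<in> V" "v \<in> V" using assms(1) edgeD by blast+
  have Find: "\<forall>p\<in>F. \<forall>q\<in>F. {p, q} \<notin> E" using facet_Ind[OF assms(3)] by (simp add: Ind_iff)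
  show ?thesis
    using Find assms(1,2) facet_matching[OF assms(3) V(1)] facet_matching[OF assms(3) V(2)] by blast
qed

lemma finite_Ind: "finite (Ind V E)"
  by (rule finite_subset[of _ "Pow V"]) (auto simp: Ind_iff finV)

lemma Ind_finite: "S \<in> Ind V E \<Longrightarrow> finite S"
  using finV finite_subset by (auto simp: Ind_iff)

lemma Ind_subset: "S \<in> Ind V E \<Longrightarrow> T \<subseteq> S \<Longrightarrow> T \<in> Ind V E"
  unfolding Ind_iff by blast

lemma empty_Ind: "{} \<in> Ind V E"
  by (simp add: Ind_iff)

lemma complex_dim_Ind: "complex_dim (Ind V E) = int d - 1"
  unfolding complex_dim_def
proof (rule Max_eqI)
  obtain F where "F \<in> facets (Ind V E)" using empty_Ind by (rule Ind_extend)
  then show "int d - 1 \<in> face_dim ` Ind V E"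
    using card_facet facet_Ind by (force simp: face_dim_def)
next
  fix y assume "y \<in> face_dim ` Ind V E"
  then obtain S where "S \<in> Ind V E" "y = face_dim S" by blast
  then show "y \<le> int d - 1" using card_le[of S] by (simp add: face_dim_def)
qed (use finite_Ind in simp)

lemma ridges_Ind: "ridges (Ind V E) = {R \<in> Ind V E. Suc (card R) = d}"
  unfolding ridges_def face_dim_def complex_dim_Ind by auto

lemma facet_minus_ridge:
  assumes "F \<in> facets (Ind V E)" "v \<in> F"
  shows "F - {v} \<in> ridges (Ind V E)"
proof -
  have "finite F" using facet_Ind[OF assms(1)] finV finite_subset by (auto simp: Ind_iff)
  then have "Suc (card (F - {v})) = d" using assms card_facet by (metis card_Suc_Diff1)
  then show ?thesis using facet_Ind[OF assms(1)] by (auto simp: ridges_Ind Ind_iff)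
qed

text \<open>A facet above this ridge contains \<open>v\<close> or \<open>m v\<close>, and its size
  leaves no room for anything else.\<close>

lemma facets_containing_minus:
  assumes F: "F \<in> facets (Ind V E)" "v \<in> F"
  shows "facets_containing (Ind V E) (F - {v}) =
    insert F (if insert (m v) (F - {v}) \<in> Ind V E then {insert (m v) (F - {v})} else {})"
proof -
  have FV: "F \<subseteq> V" using facet_Ind[OF F(1)] by (simp add: Ind_iff)
  then have finF: "finite F" using finV finite_subset by blast
  have v: "v \<in> V" using F FV by blast
  have T: "T = F \<or> T = insert (m v) (F - {v})" if T: "T \<in> facets (Ind V E)" "F - {v} \<subseteq> T" for T
  proof -
    have finT: "finite T" using T facet_Ind Ind_iff finV finite_subset by metis
    have c: "card T = card F" using T F card_facet by simp
    show ?thesis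
    proof (cases "v \<in> T")
      case True
      then have "F \<subseteq> T" using T by blast
      then show ?thesis using c finT card_subset_eq by metis
    next
      case False
      then have "m v \<in> T" using facet_matching[OF T(1) v] by blast
      then have "insert (m v) (F - {v}) \<subseteq> T" using T by blast
      moreover have "m v \<notin> F" using facet_matching[OF F(1) v] F(2) by blast
      then have "card (insert (m v) (F - {v})) = card F" using F(2) finF by (simp add: card_Suc_Diff1 del: card_Diff_insert)
      ultimately show ?thesis using c finT card_subset_eq by metis
    qed
  qed
  have "m v \<notin> F" using facet_matching[OF F(1) v] F(2) by blast
  then have "card (insert (m v) (F - {v})) = d" using F finF card_facet[OF F(1)] by (simp add: card_Suc_Diff1 del: card_Diff_insert)
  then have "insert (m v) (F - {v}) \<in> facets (Ind V E)" if "insert (m v) (F - {v}) \<in> Ind V E"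
    using that facetI by blast
  then show ?thesis using T F facet_Ind unfolding facets_containing_def by auto
qed

lemma ridge_obtain:
  assumes R: "R \<in> ridges (Ind V E)"
  obtains F v where "F \<in> facets (Ind V E)" "v \<in> F" "R = F - {v}"
proof -
  have "R \<in> Ind V E" and c: "Suc (card R) = d" using R by (auto simp: ridges_Ind)
  then obtain F where F: "F \<in> facets (Ind V E)" "R \<subseteq> F" by (elim Ind_extend)
  have finF: "finite F" using F facet_Ind Ind_iff finV finite_subset by metis
  then have "card (F - R) = 1"
    using F c card_facet[OF F(1)] finite_subset[OF F(2) finF] by (simp add: card_Diff_subset)
  then obtain v where "F - R = {v}" by (rule card_1_singletonE)
  then have "v \<in> F" "R = F - {v}" using F by blast+
  then show thesis using that F by blast
qed

section \<open>Flips, strong connectedness and the boundary\<close>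

lemma pseudomanifold_iff_strongly_connected:
  "pseudomanifold (Ind V E) \<longleftrightarrow> strongly_connected (Ind V E)"
proof -
  have "simplicial_complex (Ind V E)"
    using finite_Ind empty_Ind Ind_finite Ind_subset unfolding simplicial_complex_def by blast
  moreover have "pure_complex (Ind V E)"
    using card_facet by (auto simp: pure_complex_def complex_dim_Ind face_dim_def)
  moreover have "card (facets_containing (Ind V E) R) \<le> 2" if "R \<in> ridges (Ind V E)" for R
    using that by (rule ridge_obtain) (auto simp: facets_containing_minus card_insert_if)
  ultimately show ?thesis by (simp add: pseudomanifold_def)
qed

abbreviation adjacent_facets :: "('v set \<times> 'v set) set" where
  "adjacent_facets \<equiv> {(A, B). A \<in> facets (Ind V E) \<and> B \<in> facets (Ind V E) \<and>
     (\<exists>R\<in>ridges (Ind V E). R \<subseteq> A \<and> R \<subseteq> B)}"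

text \<open>Transitivity of the obstructions is \<open>edge_across\<close>; the absence of parallel
  edges forbids mutual obstruction. Only vertices of \<open>F - F'\<close> can obstruct, because
  \<open>m v\<close> lies in the independent set \<open>F'\<close>.\<close>

lemma flip_towards:
  assumes good: no_parallel_edges and F: "F \<in> facets (Ind V E)" and F': "F' \<in> facets (Ind V E)"
    and neq: "F \<noteq> F'"
  obtains v where "v \<in> F - F'" "insert (m v) (F - {v}) \<in> facets (Ind V E)"
proof -
  have FV: "F \<subseteq> V" "F' \<subseteq> V" using facet_Ind F F' by (auto simp: Ind_iff)
  have finF: "finite F" "finite F'" using FV finV finite_subset by blast+
  have Find: "\<forall>p\<in>F. \<forall>q\<in>F. {p, q} \<notin> E" "\<forall>p\<in>F'. \<forall>q\<in>F'. {p, q} \<notin> E"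
    using facet_Ind F F' by (auto simp: Ind_iff)
  define D where "D = F - F'"
  \<comment> \<open>The pair \<open>(w, v)\<close> says that \<open>w\<close> obstructs the flip of
    \<open>v\<close>. The vertex \<open>v\<close> itself is excluded: it is adjacent to
    \<open>m v\<close>, but leaves when \<open>m v\<close> enters.\<close>
  define rel where "rel = {(w, v). v \<in> D \<and> w \<in> D \<and> w \<noteq> v \<and> {m v, w} \<in> E}"
  have "D \<noteq> {}" using neq card_subset_eq[OF finF(2), of F] card_facet F F' unfolding D_def by fastforce
  have DV: "D \<subseteq> V" using FV by (auto simp: D_def)
  have noback: "{m w, v} \<notin> E" if "(w, v) \<in> rel" for w v
  proof
    assume a: "{m w, v} \<in> E"
    have wv: "v \<in> V" "w \<in> V" "w \<noteq> v" "{m v, w} \<in> E" using that DV by (auto simp: rel_def)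
    have "{v, m w} \<in> E" using a by (simp add: insert_commute)
    moreover have "{m v, m (m w)} \<in> E" using wv matching(2) by simp
    ultimately have "m w = m v" using good unfolding no_parallel_edges_def by blast
    then show False using wv inj_matching by (meson inj_onD)
  qed
  have tr: "(u, v) \<in> rel" if "(u, w) \<in> rel" "(w, v) \<in> rel" for u v w
  proof -
    have 1: "{m v, w} \<in> E" "{m w, u} \<in> E" "u \<in> D" "v \<in> D" using that by (auto simp: rel_def)
    then have "{m v, u} \<in> E" using edge_across[of "m v" w u] by (simp add: insert_commute)
    moreover have "u \<noteq> v" using noback[OF that(2)] 1(2) by blast
    ultimately show ?thesis using 1 by (auto simp: rel_def)
  qed
  then have "trans rel" by (rule transI)
  then have "rel\<^sup>+ = rel" by (rule trancl_id)
  then have "acyclic rel" by (auto simp: acyclic_def rel_def)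
  moreover have "finite rel" by (rule finite_subset[of _ "D \<times> D"]) (auto simp: rel_def D_def finF)
  ultimately have "wf rel" by (simp add: finite_acyclic_wf)
  then obtain v where v: "v \<in> D" "\<And>w. (w, v) \<in> rel \<Longrightarrow> w \<notin> D" using \<open>D \<noteq> {}\<close> by (meson all_not_in_conv wfE_min)
  have vV: "v \<in> V" using v DV by blast
  have mv: "m v \<in> F'" "m v \<notin> F" using v facet_matching[OF F vV] facet_matching[OF F' vV] by (auto simp: D_def)
  have free: "{m v, w} \<notin> E" if "w \<in> F" "w \<noteq> v" for w
  proof
    assume e: "{m v, w} \<in> E"
    then have "w \<notin> F'" using mv Find by blast
    then have r: "(w, v) \<in> rel" using that v(1) e by (simp add: rel_def D_def)
    then have "w \<in> D" by (simp add: rel_def)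
    then show False using v(2)[OF r] by simp
  qed
  have "{m v} \<notin> E" using edgeD(3)[of "m v" "m v"] by auto
  then have "insert (m v) (F - {v}) \<in> Ind V E"
    using FV(1) vV Find(1) free by (auto simp: Ind_iff insert_commute)
  moreover have "card (insert (m v) (F - {v})) = d"
    using v mv finF card_facet[OF F] by (simp add: card_Suc_Diff1 D_def del: card_Diff_insert)
  ultimately show thesis using that[of v] v(1) facetI by (simp add: D_def)
qed

lemma pseudomanifold_iff: "pseudomanifold (Ind V E) \<longleftrightarrow> no_parallel_edges"
  unfolding pseudomanifold_iff_strongly_connected
proof
  assume good: no_parallel_edges
  have "(F, F') \<in> adjacent_facets\<^sup>*" if F: "F \<in> facets (Ind V E)" and F': "F' \<in> facets (Ind V E)" for F F'
    using F
  proof (induction "card (F - F')" arbitrary: F rule: less_induct)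
    case less
    show ?case
    proof (cases "F = F'")
      case False
      obtain v where v: "v \<in> F - F'" "insert (m v) (F - {v}) \<in> facets (Ind V E)"
        using flip_towards[OF good less.prems F' False] by blast
      let ?F = "insert (m v) (F - {v})"
      have FV: "F \<subseteq> V" using less.prems facet_Ind by (auto simp: Ind_iff)
      then have "finite F" using finV finite_subset by blast
      moreover have "m v \<in> F'" using v FV facet_matching[OF F', of v] by blast
      then have "?F - F' = (F - F') - {v}" by auto
      ultimately have "card (?F - F') < card (F - F')" using v(1) by (metis card_Diff1_less finite_Diff)
      then have "(?F, F') \<in> adjacent_facets\<^sup>*" using less.hyps v(2) by blast
      moreover have "(F, ?F) \<in> adjacent_facets"
      proof -
        have "F - {v} \<in> ridges (Ind V E)" using facet_minus_ridge[OF less.prems] v(1) by simp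
        moreover have "F - {v} \<subseteq> F" "F - {v} \<subseteq> ?F" by blast+
        ultimately show ?thesis using less.prems v(2) by blast
      qed
      ultimately show ?thesis by (rule converse_rtrancl_into_rtrancl[rotated])
    qed simp
  qed
  then show "strongly_connected (Ind V E)" by (simp add: strongly_connected_def)
next
  assume sc: "strongly_connected (Ind V E)"
  show no_parallel_edges
  proof (rule ccontr)
    assume "\<not> no_parallel_edges"
    then obtain u v where uv: "{u, v} \<in> E" "{m u, m v} \<in> E" "v \<noteq> m u" unfolding no_parallel_edges_def by blast
    have V: "u \<in> V" "v \<in> V" "u \<noteq> v" using uv(1) edgeD by blast+
    have loops: "{p} \<notin> E" for p using edgeD(3)[of p p] by auto
    have "{u} \<in> Ind V E" "{m u} \<in> Ind V E" using V loops by (auto simp: Ind_iff)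
    then obtain F F' where F: "F \<in> facets (Ind V E)" "u \<in> F" and F': "F' \<in> facets (Ind V E)" "m u \<in> F'"
      by (metis Ind_extend insert_subset)
    have "(F, F') \<in> adjacent_facets\<^sup>*" using sc F F' by (auto simp: strongly_connected_def)
    then have "u \<in> F'"
    proof (induction rule: rtrancl_induct)
      case base show ?case using F by simp
    next
      case (step A B)
      then have AB: "A \<in> facets (Ind V E)" "B \<in> facets (Ind V E)" by auto
      obtain R where R: "R \<in> ridges (Ind V E)" "R \<subseteq> A" "R \<subseteq> B" using step.hyps by auto
      have mvA: "m v \<in> A" using step.IH facet_parallel[OF uv(1,2) AB(1)] by blast
      have finA: "finite A" using AB facet_Ind Ind_iff finV finite_subset by metis
      \<comment> \<open>A ridge omits a single vertex of \<open>A\<close>, whereas \<open>u\<close>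
        and \<open>m v\<close> are two. The one that stays in \<open>R\<close> lies in
        \<open>B\<close> and brings the other along.\<close>
      have "u \<in> R \<or> m v \<in> R"
      proof (rule ccontr)
        assume "\<not> ?thesis"
        then have "R \<subseteq> A - {u, m v}" using R by blast
        then have "card R \<le> card (A - {u, m v})" using finA by (simp add: card_mono)
        moreover have "u \<noteq> m v" using uv(3) V matching(2) by metis
        then have "card {u, m v} = 2" by simp
        then have "card (A - {u, m v}) = card A - 2" using mvA step.IH by (simp add: card_Diff_subset)
        moreover have "card {u, m v} \<le> card A" using finA mvA step.IH by (intro card_mono) auto
        moreover have "Suc (card R) = card A" using card_facet[OF AB(1)] R(1) by (simp add: ridges_Ind)
        ultimately show False using \<open>card {u, m v} = 2\<close> by linarith
      qed
      then show ?case using R facet_parallel[OF uv(1,2) AB(2)] by blast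
    qed
    then show False using facet_matching[OF F'(1) V(1)] F'(2) by blast
  qed
qed

lemma is_dK2_iff: "is_dK2 d V E \<longleftrightarrow> (\<forall>u v. {u, v} \<in> E \<longrightarrow> v = m u)"
proof
  assume k: "is_dK2 d V E"
  show "\<forall>u v. {u, v} \<in> E \<longrightarrow> v = m u"
  proof (intro allI impI)
    fix u v assume e: "{u, v} \<in> E"
    then have "u \<in> V" using edgeD by blast
    then have "{u, m u} \<in> E" using matching by blast
    moreover have disj: "\<forall>e\<in>E. \<forall>e'\<in>E. e \<noteq> e' \<longrightarrow> e \<inter> e' = {}" using k by (simp add: is_dK2_def)
    ultimately have "{u, v} = {u, m u}" using bspec[OF bspec[OF disj e], of "{u, m u}"] by auto
    then show "v = m u" by (auto simp: doubleton_eq_iff)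
  qed
next
  assume *: "\<forall>u v. {u, v} \<in> E \<longrightarrow> v = m u"
  have disj: "\<forall>e\<in>E. \<forall>e'\<in>E. e \<noteq> e' \<longrightarrow> e \<inter> e' = {}"
  proof (intro ballI impI, rule ccontr)
    fix e e' assume e: "e \<in> E" "e' \<in> E" "e \<noteq> e'" "e \<inter> e' \<noteq> {}"
    then obtain x where x: "x \<in> e" "x \<in> e'" by blast
    have "f = {x, m x}" if "f \<in> E" "x \<in> f" for f
    proof -
      from that(1) obtain p q where "f = {p, q}" by (auto elim: simple_graph_edgeE[OF G])
      then have "\<exists>y. f = {x, y}" using that(2) by auto
      then show ?thesis using * that(1) by blast
    qed
    then show False using e x by metis
  qed
  have U: "\<Union>E = V"
  proof
    show "\<Union>E \<subseteq> V" using G by (auto simp: simple_graph_def)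
    show "V \<subseteq> \<Union>E" using matching(1) by blast
  qed
  have "finite E" using G finV by (auto simp: simple_graph_def intro: finite_subset[of _ "Pow V"])
  then have "2 * card E = card (\<Union>E)" using disj G by (intro card_partition) (auto simp: simple_graph_def U finV)
  then show "is_dK2 d V E" using U disj G cardV by (simp add: is_dK2_def)
qed

text \<open>The ridge \<open>F - {v}\<close> lies in one facet exactly when the flip of
  \<open>v\<close> is blocked, which takes an edge at \<open>m v\<close> outside the matching.
  Conversely, an edge \<open>{a, b}\<close> outside the matching blocks the flip of
  \<open>m b\<close> in every facet through \<open>a\<close>.\<close>

lemma has_boundary_iff: "has_boundary (Ind V E) \<longleftrightarrow> \<not> is_dK2 d V E"
  unfolding is_dK2_iff
proof
  assume "has_boundary (Ind V E)"
  then obtain R where "R \<in> ridges (Ind V E)" "card (facets_containing (Ind V E) R) = 1"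
    by (auto simp: has_boundary_def)
  then obtain F v where F: "F \<in> facets (Ind V E)" "v \<in> F"
    and c: "card (facets_containing (Ind V E) (F - {v})) = 1" by (metis ridge_obtain)
  have FV: "F \<subseteq> V" "\<forall>p\<in>F. \<forall>q\<in>F. {p, q} \<notin> E" using facet_Ind[OF F(1)] by (auto simp: Ind_iff)
  have vV: "v \<in> V" using F FV by blast
  have mv: "m v \<notin> F" using facet_matching[OF F(1) vV] F(2) by blast
  have "insert (m v) (F - {v}) \<notin> Ind V E"
  proof
    assume "insert (m v) (F - {v}) \<in> Ind V E"
    then have "facets_containing (Ind V E) (F - {v}) = {F, insert (m v) (F - {v})}"
      using facets_containing_minus[OF F] by simp
    moreover have "F \<noteq> insert (m v) (F - {v})" using mv by blast
    ultimately show False using c by simp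
  qed
  moreover have "insert (m v) (F - {v}) \<subseteq> V" using FV(1) vV by auto
  ultimately obtain p q where pq: "p \<in> insert (m v) (F - {v})" "q \<in> insert (m v) (F - {v})" "{p, q} \<in> E"
    unfolding Ind_iff by blast
  have "p \<noteq> q" using pq edgeD by blast
  moreover have "p = m v \<or> q = m v" using pq FV(2) by blast
  ultimately obtain q where q: "q \<in> F - {v}" "{m v, q} \<in> E"
    using pq by (auto simp: insert_commute)
  then have "q \<noteq> m (m v)" using vV matching(2) by auto
  then show "\<not> (\<forall>u v. {u, v} \<in> E \<longrightarrow> v = m u)" using q(2) by blast
next
  assume "\<not> (\<forall>u v. {u, v} \<in> E \<longrightarrow> v = m u)"
  then obtain a b where ab: "{a, b} \<in> E" "b \<noteq> m a" by blast
  have V: "a \<in> V" "b \<in> V" using ab edgeD by blast+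
  have "{a} \<notin> E" using edgeD(3)[of a a] by auto
  then have "{a} \<in> Ind V E" using V by (auto simp: Ind_iff)
  then obtain F where F: "F \<in> facets (Ind V E)" "a \<in> F" by (metis Ind_extend insert_subset)
  then have "b \<notin> F" using facet_Ind[OF F(1)] ab(1) by (auto simp: Ind_iff)
  then have mb: "m b \<in> F" using facet_matching[OF F(1) V(2)] by blast
  have "a \<noteq> m b" using ab(2) V matching(2) by metis
  then have "insert (m (m b)) (F - {m b}) \<notin> Ind V E" using ab(1) F(2) V matching(2) by (auto simp: Ind_iff)
  then have "card (facets_containing (Ind V E) (F - {m b})) = 1" using facets_containing_minus[OF F(1) mb] by simp
  then show "has_boundary (Ind V E)" using facet_minus_ridge[OF F(1) mb] by (auto simp: has_boundary_def)
qed

end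

section \<open>Graded ideals and regular sequences of polynomials\<close>

abbreviation lookup :: "('a \<Rightarrow>\<^sub>0 'b::zero) \<Rightarrow> 'a \<Rightarrow> 'b" where "lookup \<equiv> Poly_Mapping.lookup"
abbreviation keys :: "('a \<Rightarrow>\<^sub>0 'b::zero) \<Rightarrow> 'a set" where "keys \<equiv> Poly_Mapping.keys"

lemma lookup_single_mult:
  fixes p :: "('v \<Rightarrow>\<^sub>0 nat) \<Rightarrow>\<^sub>0 'k::comm_ring_1"
  shows "lookup (Poly_Mapping.single s c * p) (s + m) = c * lookup p m"
  by (simp add: lookup_mult lookup_single when_mult)

lemma lookup_single_mult_0:
  fixes p :: "('v \<Rightarrow>\<^sub>0 nat) \<Rightarrow>\<^sub>0 'k::comm_ring_1"
  assumes "\<And>m. k \<noteq> s + m"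
  shows "lookup (Poly_Mapping.single s c * p) k = 0"
  using assms by (simp add: lookup_mult lookup_single when_mult)

lemma poly_mapping_sum_single:
  fixes p :: "'a \<Rightarrow>\<^sub>0 'b::comm_monoid_add"
  shows "p = (\<Sum>m\<in>keys p. Poly_Mapping.single m (lookup p m))"
proof (rule poly_mapping_eqI)
  fix k
  have "(\<Sum>m\<in>keys p. lookup (Poly_Mapping.single m (lookup p m)) k) =
        (\<Sum>m\<in>keys p. if m = k then lookup p k else 0)"
    by (intro sum.cong) (auto simp: lookup_single when_def)
  also have "\<dots> = lookup p k" by (simp add: in_keys_iff)
  finally show "lookup p k = lookup (\<Sum>m\<in>keys p. Poly_Mapping.single m (lookup p m)) k"
    by (simp add: lookup_sum)
qed

definition restrict_keys :: "('a \<Rightarrow> bool) \<Rightarrow> ('a \<Rightarrow>\<^sub>0 'b::zero) \<Rightarrow> 'a \<Rightarrow>\<^sub>0 'b" where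
  "restrict_keys P p = Poly_Mapping.mapp (\<lambda>k v. v when P k) p"

lemma lookup_restrict_keys [simp]: "lookup (restrict_keys P p) k = (lookup p k when P k)"
  by (auto simp: restrict_keys_def lookup_mapp when_def in_keys_iff)

lemma keys_restrict_keys [simp]: "keys (restrict_keys P p) = {k \<in> keys p. P k}"
  by (auto simp: in_keys_iff when_def split: if_splits)

lemma restrict_keys_add: "restrict_keys P (p + q) = restrict_keys P p + restrict_keys P q"
  for p :: "'a \<Rightarrow>\<^sub>0 'b::monoid_add"
  by (rule poly_mapping_eqI) (simp add: lookup_add when_def)

lemma restrict_keys_diff: "restrict_keys P (p - q) = restrict_keys P p - restrict_keys P q"
  for p :: "'a \<Rightarrow>\<^sub>0 'b::ab_group_add"
  by (rule poly_mapping_eqI) (simp add: lookup_minus when_def)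

lemma restrict_keys_id: "(\<And>k. k \<in> keys p \<Longrightarrow> P k) \<Longrightarrow> restrict_keys P p = p"
  by (rule poly_mapping_eqI) (auto simp: when_def in_keys_iff)

lemma restrict_keys_none: "(\<And>k. k \<in> keys p \<Longrightarrow> \<not> P k) \<Longrightarrow> restrict_keys P p = 0"
  by (rule poly_mapping_eqI) (auto simp: when_def in_keys_iff)

lemma restrict_keys_split: "p = restrict_keys P p + restrict_keys (\<lambda>k. \<not> P k) p"
  for p :: "'a \<Rightarrow>\<^sub>0 'b::monoid_add"
  by (rule poly_mapping_eqI) (simp add: lookup_add when_def)

definition monom_deg :: "('v \<Rightarrow>\<^sub>0 nat) \<Rightarrow> nat" where
  "monom_deg m = (\<Sum>v\<in>keys m. lookup m v)"

lemma monom_deg_add: "monom_deg (m + n) = monom_deg m + monom_deg n"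
  unfolding monom_deg_def by (rule setsum_keys_plus_distrib) simp_all

lemma keys_add_nat: "keys (m + n) = keys m \<union> keys n"
  for m n :: "'v \<Rightarrow>\<^sub>0 nat"
  by (auto simp: in_keys_iff lookup_add)

lemma keys_multE:
  assumes "m \<in> keys (p * q)"
  obtains a b where "a \<in> keys p" "b \<in> keys q" "m = a + b"
  using assms keys_mult[of p q] by blast

text \<open>This is the carrier of \<open>poly_ring V\<close>. Working with it, and with
  \<open>poly_ideal\<close> for its ideals, keeps all computations in the type class ring of
  polynomials.\<close>

definition polys :: "'v set \<Rightarrow> ('v, 'k::field) mpoly set" where
  "polys V = {p. \<forall>m\<in>keys p. keys m \<subseteq> V}"

abbreviation const :: "'k \<Rightarrow> ('v, 'k::field) mpoly" where
  "const c \<equiv> Poly_Mapping.single 0 c"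

lemma polys_0 [simp]: "0 \<in> polys V"
  and polys_const [simp]: "const c \<in> polys V"
  and polys_1 [simp]: "1 \<in> polys V"
  by (auto simp: polys_def split: if_splits)

lemma polys_add [simp]: "p \<in> polys V \<Longrightarrow> q \<in> polys V \<Longrightarrow> p + q \<in> polys V"
  unfolding polys_def using keys_add[of p q] by blast

lemma polys_uminus [simp]: "p \<in> polys V \<Longrightarrow> - p \<in> polys V"
  by (auto simp: polys_def in_keys_iff)

lemma polys_diff [simp]: "p \<in> polys V \<Longrightarrow> q \<in> polys V \<Longrightarrow> p - q \<in> polys V"
  using polys_add[of p V "- q"] by simp

lemma polys_mult [simp]:
  assumes "p \<in> polys V" "q \<in> polys V" shows "p * q \<in> polys V"
proof -
  have "keys m \<subseteq> V" if "m \<in> keys (p * q)" for m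
  proof -
    from that obtain a b where "a \<in> keys p" "b \<in> keys q" "m = a + b" by (rule keys_multE)
    then show ?thesis using assms by (auto simp: polys_def keys_add_nat)
  qed
  then show ?thesis by (simp add: polys_def)
qed

lemma polys_power [simp]: "p \<in> polys V \<Longrightarrow> p ^ n \<in> polys V"
  by (induction n) simp_all

lemma polys_sum [simp]: "(\<And>i. i \<in> I \<Longrightarrow> f i \<in> polys V) \<Longrightarrow> sum f I \<in> polys V"
  by (induction I rule: infinite_finite_induct) simp_all

lemma polys_Var [simp]: "v \<in> V \<Longrightarrow> Var v \<in> polys V"
  by (simp add: polys_def Var_def)

lemma polys_restrict_keys [simp]: "p \<in> polys V \<Longrightarrow> restrict_keys P p \<in> polys V"
  by (simp add: polys_def)

definition hom_polys :: "'v set \<Rightarrow> nat \<Rightarrow> ('v, 'k::field) mpoly set" where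
  "hom_polys V n = {p \<in> polys V. homogeneous n p}"

definition hom_comp :: "nat \<Rightarrow> ('v, 'k::field) mpoly \<Rightarrow> ('v, 'k) mpoly" where
  "hom_comp n = restrict_keys (\<lambda>m. monom_deg m = n)"

lemma hom_polys_iff: "p \<in> hom_polys V n \<longleftrightarrow> p \<in> polys V \<and> (\<forall>m\<in>keys p. monom_deg m = n)"
  by (simp add: hom_polys_def homogeneous_def monom_deg_def)

lemma hom_polys_polys [simp]: "p \<in> hom_polys V n \<Longrightarrow> p \<in> polys V"
  by (simp add: hom_polys_def)

lemma hom_polys_0 [simp]: "0 \<in> hom_polys V n"
  by (simp add: hom_polys_iff)

lemma hom_polys_const [simp]: "const c \<in> hom_polys V 0"
  by (simp add: hom_polys_iff monom_deg_def)

lemma hom_polys_add: "p \<in> hom_polys V n \<Longrightarrow> q \<in> hom_polys V n \<Longrightarrow> p + q \<in> hom_polys V n"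
  unfolding hom_polys_iff using keys_add[of p q] by (metis UnE polys_add subsetD)

lemma hom_polys_diff: "p \<in> hom_polys V n \<Longrightarrow> q \<in> hom_polys V n \<Longrightarrow> p - q \<in> hom_polys V n"
  unfolding hom_polys_iff using keys_diff[of p q] by (metis UnE polys_diff subsetD)

lemma hom_polys_mult:
  assumes "p \<in> hom_polys V a" "q \<in> hom_polys V b" shows "p * q \<in> hom_polys V (a + b)"
proof -
  have "monom_deg m = a + b" if "m \<in> keys (p * q)" for m
  proof -
    from that obtain k l where "k \<in> keys p" "l \<in> keys q" "m = k + l" by (rule keys_multE)
    then show ?thesis using assms by (simp add: hom_polys_iff monom_deg_add)
  qed
  then show ?thesis using assms by (simp add: hom_polys_iff)
qed

lemma hom_polys_power: "p \<in> hom_polys V a \<Longrightarrow> p ^ n \<in> hom_polys V (n * a)"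
proof (induction n)
  case 0
  show ?case using hom_polys_const[of 1] by simp
next
  case (Suc n)
  then show ?case using hom_polys_mult[of p V a "p ^ n" "n * a"] by simp
qed

lemma hom_comp_add: "hom_comp n (p + q) = hom_comp n p + hom_comp n q"
  by (simp add: hom_comp_def restrict_keys_add)

lemma hom_comp_diff: "hom_comp n (p - q) = hom_comp n p - hom_comp n q"
  by (simp add: hom_comp_def restrict_keys_diff)

lemma hom_comp_hom_polys [simp]: "p \<in> polys V \<Longrightarrow> hom_comp n p \<in> hom_polys V n"
  by (simp add: hom_comp_def hom_polys_iff)

lemma hom_comp_polys [simp]: "p \<in> polys V \<Longrightarrow> hom_comp n p \<in> polys V"
  by (simp add: hom_comp_def)

lemma hom_comp_id: "p \<in> hom_polys V n \<Longrightarrow> hom_comp n p = p"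
  unfolding hom_comp_def by (rule restrict_keys_id) (simp add: hom_polys_iff)

lemma hom_comp_none: "p \<in> hom_polys V n \<Longrightarrow> n \<noteq> k \<Longrightarrow> hom_comp k p = 0"
  unfolding hom_comp_def by (rule restrict_keys_none) (simp add: hom_polys_iff)

text \<open>Multiplication by \<open>t\<close> shifts degrees by \<open>e\<close>. The case
  distinction guards against \<open>n - e\<close> being truncated to 0.\<close>

lemma hom_comp_mult:
  fixes t p :: "('v, 'k::field) mpoly"
  assumes "t \<in> hom_polys V e"
  shows "hom_comp n (t * p) = (if e \<le> n then t * hom_comp (n - e) p else 0)"
proof -
  have *: "\<exists>l\<in>keys q. monom_deg k = e + monom_deg l"
    if "k \<in> keys (t * q)" for k and q :: "('v, 'k) mpoly"
  proof -
    from that obtain a l where "a \<in> keys t" "l \<in> keys q" "k = a + l" by (rule keys_multE)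
    then show ?thesis using assms by (auto simp: hom_polys_iff monom_deg_add)
  qed
  show ?thesis
  proof (cases "e \<le> n")
    case False
    have "hom_comp n (t * p) = 0"
      unfolding hom_comp_def
    proof (rule restrict_keys_none)
      fix k assume "k \<in> keys (t * p)"
      then obtain l :: "'v \<Rightarrow>\<^sub>0 nat" where "monom_deg k = e + monom_deg l" using * by blast
      then show "monom_deg k \<noteq> n" using False by simp
    qed
    then show ?thesis using False by simp
  next
    case True
    let ?P = "\<lambda>m. monom_deg m = n - e"
    have "t * p = t * restrict_keys ?P p + t * restrict_keys (\<lambda>m. \<not> ?P m) p"
      using restrict_keys_split[of p ?P] by (metis distrib_left)
    moreover have "hom_comp n (t * restrict_keys ?P p) = t * restrict_keys ?P p"
      unfolding hom_comp_def
    proof (rule restrict_keys_id)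
      fix k assume "k \<in> keys (t * restrict_keys ?P p)"
      then obtain l where "l \<in> keys (restrict_keys ?P p)" "monom_deg k = e + monom_deg l" using * by blast
      then show "monom_deg k = n" using True by simp
    qed
    moreover have "hom_comp n (t * restrict_keys (\<lambda>m. \<not> ?P m) p) = 0"
      unfolding hom_comp_def
    proof (rule restrict_keys_none)
      fix k assume "k \<in> keys (t * restrict_keys (\<lambda>m. \<not> ?P m) p)"
      then obtain l where "l \<in> keys (restrict_keys (\<lambda>m. \<not> ?P m) p)" "monom_deg k = e + monom_deg l"
        using * by blast
      then show "monom_deg k \<noteq> n" by auto
    qed
    ultimately show ?thesis using True by (metis hom_comp_add hom_comp_def add.right_neutral)
  qed
qed

lemma sum_hom_comp: "p = (\<Sum>n\<in>monom_deg ` keys p. hom_comp n p)"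
proof (rule poly_mapping_eqI)
  fix k
  show "lookup p k = lookup (\<Sum>n\<in>monom_deg ` keys p. hom_comp n p) k"
    by (auto simp: lookup_sum hom_comp_def when_def in_keys_iff)
qed

section \<open>Ideals, regular sequences and leading units\<close>

definition poly_ideal :: "'v set \<Rightarrow> ('v, 'k::field) mpoly set \<Rightarrow> bool" where
  "poly_ideal V J \<longleftrightarrow> J \<subseteq> polys V \<and> 0 \<in> J \<and> (\<forall>a\<in>J. \<forall>b\<in>J. a + b \<in> J) \<and> (\<forall>a\<in>J. \<forall>s\<in>polys V. s * a \<in> J)"

lemma poly_ideal_polys: "poly_ideal V J \<Longrightarrow> a \<in> J \<Longrightarrow> a \<in> polys V"
  and poly_ideal_0: "poly_ideal V J \<Longrightarrow> 0 \<in> J"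
  and poly_ideal_add: "poly_ideal V J \<Longrightarrow> a \<in> J \<Longrightarrow> b \<in> J \<Longrightarrow> a + b \<in> J"
  and poly_ideal_mult: "poly_ideal V J \<Longrightarrow> a \<in> J \<Longrightarrow> s \<in> polys V \<Longrightarrow> s * a \<in> J"
  by (auto simp: poly_ideal_def)

lemma poly_ideal_uminus: "poly_ideal V J \<Longrightarrow> a \<in> J \<Longrightarrow> - a \<in> J"
  using poly_ideal_mult[of V J a "- 1"] by simp

lemma poly_ideal_diff: "poly_ideal V J \<Longrightarrow> a \<in> J \<Longrightarrow> b \<in> J \<Longrightarrow> a - b \<in> J"
  using poly_ideal_add[of V J a "- b"] poly_ideal_uminus[of V J b] by simp

lemma poly_ideal_mult2: "poly_ideal V J \<Longrightarrow> a \<in> J \<Longrightarrow> s \<in> polys V \<Longrightarrow> a * s \<in> J"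
  using poly_ideal_mult[of V J a s] by (simp add: mult.commute)

lemma poly_ideal_sum: "poly_ideal V J \<Longrightarrow> (\<And>i. i \<in> I \<Longrightarrow> f i \<in> J) \<Longrightarrow> sum f I \<in> J"
  by (induction I rule: infinite_finite_induct) (simp_all add: poly_ideal_0 poly_ideal_add)

lemma poly_ideal_cong: "poly_ideal V J \<Longrightarrow> a - b \<in> J \<Longrightarrow> b \<in> J \<Longrightarrow> a \<in> J"
  using poly_ideal_add[of V J "a - b" b] by simp

text \<open>The ideal generated by \<open>J\<close> and \<open>t\<close>, in a form that exposes the
  cofactor of \<open>t\<close>.\<close>

definition adjoin :: "'v set \<Rightarrow> ('v, 'k::field) mpoly set \<Rightarrow> ('v, 'k) mpoly \<Rightarrow> ('v, 'k) mpoly set" where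
  "adjoin V J t = {x \<in> polys V. \<exists>s\<in>polys V. x - t * s \<in> J}"

lemma adjoinI: "x - t * s \<in> J \<Longrightarrow> x \<in> polys V \<Longrightarrow> s \<in> polys V \<Longrightarrow> x \<in> adjoin V J t"
  by (auto simp: adjoin_def)

lemma adjoinE:
  assumes "x \<in> adjoin V J t"
  obtains s where "x \<in> polys V" "s \<in> polys V" "x - t * s \<in> J"
  using assms by (auto simp: adjoin_def)

lemma adjoin_ideal:
  fixes J :: "('v, 'k::field) mpoly set"
  assumes J: "poly_ideal V J"
  shows "poly_ideal V (adjoin V J t)"
  unfolding poly_ideal_def
proof (intro conjI ballI)
  show "adjoin V J t \<subseteq> polys V" by (auto simp: adjoin_def)
  show "0 \<in> adjoin V J t" by (rule adjoinI[of _ _ 0]) (simp_all add: poly_ideal_0[OF J])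
next
  fix a b assume a: "a \<in> adjoin V J t" and b: "b \<in> adjoin V J t"
  obtain s where s: "a \<in> polys V" "s \<in> polys V" "a - t * s \<in> J" using a by (rule adjoinE)
  obtain r where r: "b \<in> polys V" "r \<in> polys V" "b - t * r \<in> J" using b by (rule adjoinE)
  have "a + b - t * (s + r) \<in> J" using poly_ideal_add[OF J s(3) r(3)] by (simp add: algebra_simps)
  then show "a + b \<in> adjoin V J t" using s r by (intro adjoinI[of _ _ "s + r"]) auto
next
  fix a r :: "('v, 'k) mpoly"
  assume a: "a \<in> adjoin V J t" and r: "r \<in> polys V"
  obtain s where s: "a \<in> polys V" "s \<in> polys V" "a - t * s \<in> J" using a by (rule adjoinE)
  have "r * a - t * (r * s) \<in> J" using poly_ideal_mult[OF J s(3) r] by (simp add: algebra_simps)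
  then show "r * a \<in> adjoin V J t" using s r by (intro adjoinI[of _ _ "r * s"]) auto
qed

lemma adjoin_mono: "poly_ideal V J \<Longrightarrow> x \<in> J \<Longrightarrow> x \<in> adjoin V J t"
  by (rule adjoinI[of _ _ 0]) (auto simp: poly_ideal_polys)

lemma adjoin_gen: "poly_ideal V J \<Longrightarrow> t \<in> polys V \<Longrightarrow> s \<in> polys V \<Longrightarrow> t * s \<in> adjoin V J t"
  by (rule adjoinI[of _ _ s]) (auto simp: poly_ideal_0)

definition graded_ideal :: "('v, 'k::field) mpoly set \<Rightarrow> bool" where
  "graded_ideal J \<longleftrightarrow> (\<forall>p\<in>J. \<forall>n. hom_comp n p \<in> J)"

lemma graded_ideal_memI:
  assumes "poly_ideal V J" "\<And>n. hom_comp n p \<in> J" shows "p \<in> J"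
proof -
  have "(\<Sum>n\<in>monom_deg ` keys p. hom_comp n p) \<in> J" by (intro poly_ideal_sum[OF assms(1)] assms(2))
  then show ?thesis by (simp only: sum_hom_comp[of p, symmetric])
qed

lemma adjoin_graded:
  assumes J: "poly_ideal V J" "graded_ideal J" and t: "t \<in> hom_polys V e"
  shows "graded_ideal (adjoin V J t)"
  unfolding graded_ideal_def
proof (intro ballI allI)
  fix p n assume "p \<in> adjoin V J t"
  then obtain s where s: "p \<in> polys V" "s \<in> polys V" "p - t * s \<in> J" by (rule adjoinE)
  have "hom_comp n (p - t * s) \<in> J" using J(2) s(3) by (simp add: graded_ideal_def)
  then have "hom_comp n p - (if e \<le> n then t * hom_comp (n - e) s else 0) \<in> J"
    by (simp add: hom_comp_diff hom_comp_mult[OF t])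
  then have *: "hom_comp n p - t * (if e \<le> n then hom_comp (n - e) s else 0) \<in> J"
    by (simp split: if_splits)
  show "hom_comp n p \<in> adjoin V J t"
    by (rule adjoinI[OF *]) (use s in auto)
qed

definition regular_mod :: "'v set \<Rightarrow> ('v, 'k::field) mpoly set \<Rightarrow> ('v, 'k) mpoly \<Rightarrow> bool" where
  "regular_mod V J t \<longleftrightarrow> (\<forall>a\<in>polys V. t * a \<in> J \<longrightarrow> a \<in> J)"

text \<open>Properness of the ideal generated at the end is kept apart, as a condition
  \<open>1 \<notin> adjoins V J ts\<close>.\<close>

fun reg_seq :: "'v set \<Rightarrow> ('v, 'k::field) mpoly set \<Rightarrow> ('v, 'k) mpoly list \<Rightarrow> bool" where
  "reg_seq V J [] \<longleftrightarrow> True"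
| "reg_seq V J (t # ts) \<longleftrightarrow> regular_mod V J t \<and> reg_seq V (adjoin V J t) ts"

definition pos_hom :: "'v set \<Rightarrow> ('v, 'k::field) mpoly \<Rightarrow> bool" where
  "pos_hom V t \<longleftrightarrow> (\<exists>e>0. t \<in> hom_polys V e)"

lemma pos_hom_polys: "pos_hom V t \<Longrightarrow> t \<in> polys V"
  by (auto simp: pos_hom_def)

text \<open>The lexicographically lowest coefficient of \<open>f\<close> with respect to the list is a non-zero constant.
  The cofactor \<open>p\<close> is an arbitrary polynomial; it need not be a polynomial in the list elements.\<close>

fun leading_unit ::
  "'v set \<Rightarrow> (nat \<Rightarrow> ('v, 'k::field) mpoly set) \<Rightarrow> ('v, 'k) mpoly list \<Rightarrow> ('v, 'k) mpoly \<Rightarrow> bool" where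
  "leading_unit V gr [] f \<longleftrightarrow> (\<exists>c. c \<noteq> 0 \<and> f = const c)"
| "leading_unit V gr (t # ts) f \<longleftrightarrow>
     (\<exists>a n q p. f = t ^ a * (q + t * p) \<and> q + t * p \<in> gr n \<and> p \<in> polys V \<and> leading_unit V gr ts q)"

lemma leading_unit_polys:
  assumes "set ts \<subseteq> polys V" "leading_unit V gr ts f" shows "f \<in> polys V"
  using assms
proof (induction ts arbitrary: f)
  case (Cons t ts)
  then obtain a n q p where "f = t ^ a * (q + t * p)" "p \<in> polys V" "leading_unit V gr ts q" by auto
  then show ?case using Cons by auto
qed auto

lemma regular_modD: "regular_mod V J t \<Longrightarrow> a \<in> polys V \<Longrightarrow> t * a \<in> J \<Longrightarrow> a \<in> J"
  by (auto simp: regular_mod_def)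

lemma regular_mod_power: "regular_mod V J t \<Longrightarrow> t \<in> polys V \<Longrightarrow> regular_mod V J (t ^ n)"
proof (induction n)
  case (Suc n)
  show ?case unfolding regular_mod_def
  proof (intro ballI impI)
    fix a assume a: "a \<in> polys V" "t ^ Suc n * a \<in> J"
    have "t * (t ^ n * a) \<in> J" using a(2) by (simp add: mult.assoc)
    then have "t ^ n * a \<in> J" using regular_modD[OF Suc.prems(1)] Suc.prems(2) a(1) by simp
    then show "a \<in> J" using regular_modD[OF Suc.IH[OF Suc.prems] a(1)] by blast
  qed
qed (simp add: regular_mod_def)

text \<open>Write \<open>q = t ^ a * g\<close> with \<open>g = q' + t * p\<close>. Modulo
  \<open>t\<close>, \<open>g\<close> becomes \<open>q'\<close>, which is regular by induction, so
  \<open>g * b \<in> J\<close> forces \<open>b = t * s\<close> modulo \<open>J\<close>; cancelling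
  \<open>t\<close> gives the same relation for \<open>s\<close>. As \<open>t\<close> has positive
  degree, \<open>s\<close> can be taken in smaller degree than a homogeneous \<open>b\<close>, and
  the descent ends.\<close>

lemma leading_unit_regular:
  assumes "poly_ideal V J" "graded_ideal J" "\<And>t. t \<in> set ts \<Longrightarrow> pos_hom V t" "reg_seq V J ts"
    and "leading_unit V (hom_polys V) ts q"
  shows "regular_mod V J q"
  using assms
proof (induction ts arbitrary: J q)
  case Nil
  then obtain c where c: "c \<noteq> 0" "q = const c" by auto
  show ?case unfolding regular_mod_def
  proof (intro ballI impI)
    fix a assume "a \<in> polys V" "q * a \<in> J"
    then have "const (inverse c) * (q * a) \<in> J" using Nil.prems(1) by (simp add: poly_ideal_mult)
    also have "const (inverse c) * (q * a) = (const (inverse c) * const c) * a" using c by (simp add: mult.assoc)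
    also have "\<dots> = a" using c by (simp add: mult_single)
    finally show "a \<in> J" .
  qed
next
  case (Cons t ts)
  note J = Cons.prems(1,2)
  obtain e where e: "e > 0" "t \<in> hom_polys V e" using Cons.prems(3)[of t] by (auto simp: pos_hom_def)
  have t: "t \<in> polys V" using e by simp
  have reg: "regular_mod V J t" and reg': "reg_seq V (adjoin V J t) ts" using Cons.prems(4) by auto
  obtain a n q' p where q: "q = t ^ a * (q' + t * p)" and f: "q' + t * p \<in> hom_polys V n"
    and p: "p \<in> polys V" and q': "leading_unit V (hom_polys V) ts q'" using Cons.prems(5) by auto
  define g where "g = q' + t * p"
  have "set ts \<subseteq> polys V" by (intro subsetI pos_hom_polys Cons.prems(3)) simp
  then have q'S: "q' \<in> polys V" using q' by (rule leading_unit_polys)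
  have g: "g \<in> hom_polys V n" "g \<in> polys V" using f by (auto simp: g_def)
  have reg'': "regular_mod V (adjoin V J t) q'"
    using Cons.IH[OF adjoin_ideal[OF J(1)] adjoin_graded[OF J e(2)] _ reg' q'] Cons.prems(3) by simp
  have hom: "b \<in> J" if "b \<in> hom_polys V D" "g * b \<in> J" for b D
    using that
  proof (induction D arbitrary: b rule: less_induct)
    case (less D)
    have b: "b \<in> polys V" using less.prems by simp
    have "q' * b - t * (- p * b) \<in> J" using less.prems(2) by (simp add: g_def algebra_simps)
    then have "q' * b \<in> adjoin V J t" by (rule adjoinI) (use b p q'S in auto)
    then have "b \<in> adjoin V J t" using reg'' b by (auto dest: regular_modD)
    then obtain s where s: "s \<in> polys V" "b - t * s \<in> J" by (rule adjoinE)
    have "hom_comp D (b - t * s) \<in> J" using s J by (simp add: graded_ideal_def)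
    then have *: "b - (if e \<le> D then t * hom_comp (D - e) s else 0) \<in> J"
      by (simp add: hom_comp_diff hom_comp_mult[OF e(2)] hom_comp_id[OF less.prems(1)])
    show ?case
    proof (cases "e \<le> D")
      case True
      define s' where "s' = hom_comp (D - e) s"
      have s': "s' \<in> hom_polys V (D - e)" "s' \<in> polys V" using s(1) by (auto simp: s'_def)
      have bJ: "b - t * s' \<in> J" using * True by (simp add: s'_def)
      have "g * b - g * (b - t * s') \<in> J"
        using less.prems(2) poly_ideal_mult[OF J(1) bJ g(2)] poly_ideal_diff[OF J(1)] by blast
      then have "t * (g * s') \<in> J" by (simp add: algebra_simps)
      then have "g * s' \<in> J" using regular_modD[OF reg] g(2) s'(2) polys_mult by blast
      then have "s' \<in> J" using less.IH[of "D - e"] e True s' by simp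
      then have "t * s' \<in> J" using poly_ideal_mult[OF J(1) _ t] by blast
      then show ?thesis using poly_ideal_cong[OF J(1) bJ] by blast
    qed (use * in simp)
  qed
  \<comment> \<open>Since \<open>g\<close> is homogeneous, \<open>g * b \<in> J\<close> holds for
    each homogeneous component of \<open>b\<close> separately.\<close>
  have "regular_mod V J g"
    unfolding regular_mod_def
  proof (intro ballI impI)
    fix b assume b: "b \<in> polys V" "g * b \<in> J"
    show "b \<in> J"
    proof (rule graded_ideal_memI[OF J(1)])
      fix k
      have "hom_comp (n + k) (g * b) \<in> J" using b J by (simp add: graded_ideal_def)
      then have "g * hom_comp k b \<in> J" by (simp add: hom_comp_mult[OF g(1)])
      then show "hom_comp k b \<in> J" using hom hom_comp_hom_polys[OF b(1)] by blast
    qed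
  qed
  moreover have "regular_mod V J (t ^ a)" using regular_mod_power[OF reg t] .
  ultimately show ?case unfolding regular_mod_def q g_def[symmetric]
    using g by (metis mult.assoc polys_mult)
qed

text \<open>Powers are peeled off one by one: if \<open>h = t ^ k * b\<close> modulo
  \<open>J\<close> with \<open>k < c\<close>, cancelling \<open>t ^ k\<close> shows that
  \<open>t\<close> divides \<open>g * b\<close> modulo \<open>J\<close>, and so divides
  \<open>b\<close>.\<close>

lemma adjoin_power_regular:
  assumes J: "poly_ideal V J" and t: "t \<in> polys V" "regular_mod V J t"
    and g: "g \<in> polys V" "regular_mod V (adjoin V J t) g"
    and h: "h \<in> polys V" "g * h \<in> adjoin V J (t ^ c)"
  shows "h \<in> adjoin V J (t ^ c)"
proof -
  obtain s where s: "s \<in> polys V" "g * h - t ^ c * s \<in> J" using h(2) by (rule adjoinE)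
  have "\<exists>b\<in>polys V. h - t ^ k * b \<in> J" if "k \<le> c" for k
    using that
  proof (induction k)
    case 0
    then show ?case using h(1) by (intro bexI[of _ h]) (auto simp: poly_ideal_0[OF J])
  next
    case (Suc k)
    then obtain b where b: "b \<in> polys V" "h - t ^ k * b \<in> J" by auto
    obtain l where l: "c = k + Suc l" using Suc.prems by (metis add_Suc_right less_iff_Suc_add Suc_le_eq)
    have "g * h - t ^ c * s - g * (h - t ^ k * b) \<in> J"
      using poly_ideal_diff[OF J s(2) poly_ideal_mult[OF J b(2) g(1)]] .
    also have "g * h - t ^ c * s - g * (h - t ^ k * b) = t ^ k * (g * b - t * (t ^ l * s))"
      by (simp add: l power_add algebra_simps)
    finally have "g * b - t * (t ^ l * s) \<in> J"
      using regular_modD[OF regular_mod_power[OF t(2,1)]] b g t s by auto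
    then have "g * b \<in> adjoin V J t" by (rule adjoinI) (use b g t s in auto)
    then have "b \<in> adjoin V J t" using g b by (auto dest: regular_modD)
    then obtain r where r: "r \<in> polys V" "b - t * r \<in> J" by (rule adjoinE)
    have "h - t ^ k * b + t ^ k * (b - t * r) \<in> J"
      using poly_ideal_add[OF J b(2) poly_ideal_mult[OF J r(2)]] t by simp
    then show ?case using r by (intro bexI[of _ r]) (simp_all add: algebra_simps)
  qed
  then obtain b where "h - t ^ c * b \<in> J" "b \<in> polys V" by blast
  then show ?thesis using h(1) by (intro adjoinI)
qed

text \<open>The regular pair \<open>t\<close>, \<open>g\<close> can be swapped: in
  \<open>t ^ c * b = g * h\<close> modulo \<open>J\<close>, the previous lemma makes
  \<open>h\<close> a multiple of \<open>t ^ c\<close>, which then cancels.\<close>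

lemma regular_cancel_adjoin:
  assumes J: "poly_ideal V J" and t: "t \<in> polys V" "regular_mod V J t"
    and g: "g \<in> polys V" "regular_mod V (adjoin V J t) g"
    and b: "b \<in> polys V" "t ^ c * b \<in> adjoin V J g"
  shows "b \<in> adjoin V J g"
proof -
  obtain h where h: "h \<in> polys V" "t ^ c * b - g * h \<in> J" using b(2) by (rule adjoinE)
  have "g * h - t ^ c * b \<in> J" using poly_ideal_uminus[OF J h(2)] by simp
  then have "g * h \<in> adjoin V J (t ^ c)" by (rule adjoinI) (use b g h in auto)
  then have "h \<in> adjoin V J (t ^ c)" using adjoin_power_regular[OF J t g h(1)] by blast
  then obtain r where r: "r \<in> polys V" "h - t ^ c * r \<in> J" by (rule adjoinE)
  have "t ^ c * b - g * h + g * (h - t ^ c * r) \<in> J"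
    using poly_ideal_add[OF J h(2) poly_ideal_mult[OF J r(2) g(1)]] .
  then have "t ^ c * (b - g * r) \<in> J" by (simp add: algebra_simps)
  then have "b - g * r \<in> J" using regular_modD[OF regular_mod_power[OF t(2,1)]] b g r by auto
  then show ?thesis by (rule adjoinI) (use b r in auto)
qed

text \<open>The multipliers \<open>q\<close> are polynomials in all but one element of the regular sequence, so no
  nonconstant factor of \<open>f\<close> can divide all of them.\<close>

lemma leading_unit_divides:
  assumes "poly_ideal V J" "graded_ideal J" "\<And>t. t \<in> set ts \<Longrightarrow> pos_hom V t" "reg_seq V J ts"
    and "leading_unit V (hom_polys V) ts f" "b \<in> hom_polys V D"
    and "\<And>i. i < length ts \<Longrightarrow>
      \<exists>q. leading_unit V (hom_polys V) (take i ts @ drop (Suc i) ts) q \<and> q * b \<in> adjoin V J f"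
  shows "b \<in> adjoin V J f"
  using assms
proof (induction ts arbitrary: J f b D)
  case Nil
  then obtain c where c: "c \<noteq> 0" "f = const c" by auto
  have "b - f * (const (inverse c) * b) = b - (const c * const (inverse c)) * b" using c by (simp add: mult.assoc)
  also have "\<dots> = 0" using c by (simp add: mult_single)
  finally have "b - f * (const (inverse c) * b) \<in> J" using poly_ideal_0[OF Nil.prems(1)] by simp
  then show ?case by (rule adjoinI) (use Nil.prems in auto)
next
  case (Cons t ts)
  note J = Cons.prems(1,2)
  obtain e where e: "e > 0" "t \<in> hom_polys V e" using Cons.prems(3)[of t] by (auto simp: pos_hom_def)
  have t: "t \<in> polys V" using e by simp
  have tsS: "set ts \<subseteq> polys V" by (intro subsetI pos_hom_polys Cons.prems(3)) simp
  have reg: "regular_mod V J t" and reg': "reg_seq V (adjoin V J t) ts" using Cons.prems(4) by auto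
  have pos: "\<And>t. t \<in> set ts \<Longrightarrow> pos_hom V t" using Cons.prems(3) by simp
  define J' where "J' = adjoin V J t"
  have J': "poly_ideal V J'" "graded_ideal J'" using J adjoin_ideal adjoin_graded e by (auto simp: J'_def)
  obtain a n f' p where f: "f = t ^ a * (f' + t * p)" and fhom: "f' + t * p \<in> hom_polys V n"
    and p: "p \<in> polys V" and f': "leading_unit V (hom_polys V) ts f'" using Cons.prems(5) by auto
  define g where "g = f' + t * p"
  have f'S: "f' \<in> polys V" using leading_unit_polys[OF tsS f'] .
  have g: "g \<in> hom_polys V n" "g \<in> polys V" using fhom by (auto simp: g_def)
  have J'cong: "x * h \<in> J'" if "(x + t * y) * h \<in> J'" "x \<in> polys V" "y \<in> polys V" "h \<in> polys V" for x y h
  proof -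
    have "t * (y * h) \<in> J'" unfolding J'_def using adjoin_gen[OF J(1) t] that by simp
    then have "(x + t * y) * h - t * (y * h) \<in> J'" using poly_ideal_diff[OF J'(1) that(1)] by blast
    then show ?thesis by (simp add: algebra_simps)
  qed
  have regg: "regular_mod V J' g"
    using leading_unit_regular[OF J' pos reg'[folded J'_def] f'] J'cong f'S p
    unfolding regular_mod_def g_def by blast
  have ta: "t ^ a \<in> polys V" using t by simp

  \<comment> \<open>This treats the factor \<open>g\<close> of \<open>f = t ^ a * g\<close>, using
    the multipliers that keep \<open>t\<close>. Modulo \<open>t\<close> they become multipliers for
    the shorter list, and the induction hypothesis gives \<open>x = g * h + t * s'\<close> modulo
    \<open>J\<close>. The part of \<open>s'\<close> in degree \<open>D - e\<close> inherits the
    assumptions, so descent on the degree applies.\<close>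
  have div: "x \<in> adjoin V J g"
    if x: "x \<in> hom_polys V D" and q: "\<And>i. i < length ts \<Longrightarrow>
      \<exists>q. leading_unit V (hom_polys V) (t # take i ts @ drop (Suc i) ts) q \<and> q * x \<in> adjoin V J g" for x D
    using that
  proof (induction D arbitrary: x rule: less_induct)
    case (less D)
    have x: "x \<in> polys V" using less.prems(1) by simp
    have "\<exists>q. leading_unit V (hom_polys V) (take i ts @ drop (Suc i) ts) q \<and> q * x \<in> adjoin V J' f'"
      if i: "i < length ts" for i
    proof -
      obtain q where q: "leading_unit V (hom_polys V) (t # take i ts @ drop (Suc i) ts) q" "q * x \<in> adjoin V J g"
        using less.prems(2)[OF i] by blast
      then obtain c k q' r where q': "q = t ^ c * (q' + t * r)" "q' + t * r \<in> hom_polys V k" "r \<in> polys V"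
        "leading_unit V (hom_polys V) (take i ts @ drop (Suc i) ts) q'" by auto
      have "set (take i ts @ drop (Suc i) ts) \<subseteq> polys V"
        using tsS by (auto dest: in_set_takeD in_set_dropD)
      then have q'S: "q' \<in> polys V" using leading_unit_polys q'(4) by blast
      have "t ^ c * ((q' + t * r) * x) \<in> adjoin V J g" using q(2) q'(1) by (simp add: mult.assoc)
      then have "(q' + t * r) * x \<in> adjoin V J g"
        using regular_cancel_adjoin[OF J(1) t reg g(2) regg[unfolded J'_def]] x q' by simp
      then obtain h where h: "h \<in> polys V" "(q' + t * r) * x - g * h \<in> J" by (rule adjoinE)
      have "q' * x - f' * h - t * (p * h - r * x) \<in> J" using h(2) by (simp add: g_def algebra_simps)
      then have "q' * x - f' * h \<in> J'"
        unfolding J'_def by (rule adjoinI) (use h x q'S f'S p q'(3) in auto)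
      then have "q' * x \<in> adjoin V J' f'" by (rule adjoinI) (use x q'S h in auto)
      then show ?thesis using q'(4) by blast
    qed
    then have "x \<in> adjoin V J' f'"
      using Cons.IH[OF J' pos reg'[folded J'_def] f' less.prems(1)] by blast
    then obtain h where h: "h \<in> polys V" "x - f' * h \<in> J'" by (rule adjoinE)
    obtain s where s: "s \<in> polys V" "x - f' * h - t * s \<in> J" using h(2) unfolding J'_def by (rule adjoinE)
    define s' where "s' = s - p * h"
    have s': "s' \<in> polys V" using s p h by (simp add: s'_def)
    have "x - g * h - t * s' \<in> J" using s(2) by (simp add: g_def s'_def algebra_simps)
    then have "hom_comp D (x - g * h - t * s') \<in> J" using J by (simp add: graded_ideal_def)
    then have *: "x - hom_comp D (g * h) - (if e \<le> D then t * hom_comp (D - e) s' else 0) \<in> J"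
      by (simp add: hom_comp_diff hom_comp_mult[OF e(2)] hom_comp_id[OF less.prems(1)])
    have "hom_comp D (g * h) = g * (if n \<le> D then hom_comp (D - n) h else 0)"
      by (simp add: hom_comp_mult[OF g(1)])
    then obtain h' where h': "h' \<in> polys V" "hom_comp D (g * h) = g * h'"
      using h(1) by (metis polys_0 hom_comp_polys)
    show ?case
    proof (cases "e \<le> D")
      case False
      then have "x - g * h' \<in> J" using * h' by simp
      then show ?thesis by (rule adjoinI) (use x h' in auto)
    next
      case True
      define y where "y = hom_comp (D - e) s'"
      have y: "y \<in> hom_polys V (D - e)" "y \<in> polys V" using s' by (auto simp: y_def)
      have xy: "x - t * y - g * h' \<in> J" using * True h' by (simp add: y_def algebra_simps)
      then have xy': "x - t * y \<in> adjoin V J g" by (rule adjoinI) (use x t y h' in auto)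
      have "\<exists>q. leading_unit V (hom_polys V) (t # take i ts @ drop (Suc i) ts) q \<and> q * y \<in> adjoin V J g"
        if i: "i < length ts" for i
      proof -
        obtain q where q: "leading_unit V (hom_polys V) (t # take i ts @ drop (Suc i) ts) q" "q * x \<in> adjoin V J g"
          using less.prems(2)[OF i] by blast
        have "set (t # take i ts @ drop (Suc i) ts) \<subseteq> polys V"
          using tsS t by (auto dest: in_set_takeD in_set_dropD)
        then have qS: "q \<in> polys V" using leading_unit_polys q(1) by blast
        have "q * x - q * (x - t * y) \<in> adjoin V J g"
          using poly_ideal_diff[OF adjoin_ideal[OF J(1)] q(2) poly_ideal_mult[OF adjoin_ideal[OF J(1)] xy' qS]] .
        then have "t ^ 1 * (q * y) \<in> adjoin V J g" by (simp add: algebra_simps)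
        then have "q * y \<in> adjoin V J g"
          using regular_cancel_adjoin[OF J(1) t reg g(2) regg[unfolded J'_def]] y qS polys_mult by blast
        then show ?thesis using q(1) by blast
      qed
      then have "y \<in> adjoin V J g" using less.IH[of "D - e" y] e True y by simp
      then have "t * y \<in> adjoin V J g" using poly_ideal_mult[OF adjoin_ideal[OF J(1)] _ t] by blast
      then show ?thesis using poly_ideal_cong[OF adjoin_ideal[OF J(1)] xy'] by blast
    qed
  qed

  have b: "b \<in> polys V" using Cons.prems(6) by simp
  \<comment> \<open>The multiplier for index 0 does not involve \<open>t\<close> and is regular
    modulo \<open>t\<close>, so \<open>b\<close> is divisible by \<open>t ^ a\<close>. The remaining
    multipliers then settle the quotient through \<open>div\<close>.\<close>
  obtain q where q: "leading_unit V (hom_polys V) ts q" "q * b \<in> adjoin V J f"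
    using Cons.prems(7)[of 0] by auto
  have qS: "q \<in> polys V" using leading_unit_polys[OF tsS q(1)] .
  obtain h where h: "h \<in> polys V" "q * b - f * h \<in> J" using q(2) by (rule adjoinE)
  then have "q * b - t ^ a * (g * h) \<in> J" by (simp add: f g_def mult.assoc)
  then have "q * b \<in> adjoin V J (t ^ a)" by (rule adjoinI) (use b qS h g in auto)
  then have "b \<in> adjoin V J (t ^ a)"
    using adjoin_power_regular[OF J(1) t reg qS leading_unit_regular[OF J' pos reg'[folded J'_def] q(1), unfolded J'_def] b]
    by blast
  then obtain s where s: "s \<in> polys V" "b - t ^ a * s \<in> J" by (rule adjoinE)
  have "hom_comp D (b - t ^ a * s) \<in> J" using s J by (simp add: graded_ideal_def)
  then have *: "b - (if a * e \<le> D then t ^ a * hom_comp (D - a * e) s else 0) \<in> J"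
    by (simp add: hom_comp_diff hom_comp_mult[OF hom_polys_power[OF e(2)]] hom_comp_id[OF Cons.prems(6)])
  show ?case
  proof (cases "a * e \<le> D")
    case False
    then show ?thesis using * adjoin_mono[OF J(1)] by simp
  next
    case True
    define x where "x = hom_comp (D - a * e) s"
    have x: "x \<in> hom_polys V (D - a * e)" "x \<in> polys V" using s(1) by (auto simp: x_def)
    have bx: "b - t ^ a * x \<in> J" using * True by (simp add: x_def)
    have "\<exists>q. leading_unit V (hom_polys V) (t # take i ts @ drop (Suc i) ts) q \<and> q * x \<in> adjoin V J g"
      if i: "i < length ts" for i
    proof -
      obtain q where q: "leading_unit V (hom_polys V) (t # take i ts @ drop (Suc i) ts) q" "q * b \<in> adjoin V J f"
        using Cons.prems(7)[of "Suc i"] i by (auto simp del: leading_unit.simps)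
      have "set (t # take i ts @ drop (Suc i) ts) \<subseteq> polys V"
        using tsS t by (auto dest: in_set_takeD in_set_dropD)
      then have qS: "q \<in> polys V" using leading_unit_polys q(1) by blast
      obtain h where h: "h \<in> polys V" "q * b - f * h \<in> J" using q(2) by (rule adjoinE)
      have "q * b - f * h - q * (b - t ^ a * x) \<in> J"
        using poly_ideal_diff[OF J(1) h(2) poly_ideal_mult[OF J(1) bx qS]] .
      also have "q * b - f * h - q * (b - t ^ a * x) = t ^ a * (q * x - g * h)"
        by (simp add: f g_def algebra_simps)
      finally have "q * x - g * h \<in> J"
        using regular_modD[OF regular_mod_power[OF reg t]] x qS g h by auto
      then have "q * x \<in> adjoin V J g" by (rule adjoinI) (use x qS h in auto)
      then show ?thesis using q(1) by blast
    qed
    then have "x \<in> adjoin V J g" using div[OF x(1)] by blast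
    then obtain h where h: "h \<in> polys V" "x - g * h \<in> J" by (rule adjoinE)
    have "b - t ^ a * x + t ^ a * (x - g * h) \<in> J"
      using poly_ideal_add[OF J(1) bx poly_ideal_mult[OF J(1) h(2) ta]] .
    then have "b - f * h \<in> J" by (simp add: f g_def algebra_simps)
    then show ?thesis by (rule adjoinI) (use b h in auto)
  qed
qed

section \<open>Counting monomials to find combinations of products\<close>

text \<open>Gaussian elimination: one pivot vector clears one coordinate, so the surplus of vectors
  over coordinates persists.\<close>

lemma exists_linear_relation:
  fixes v :: "'x \<Rightarrow> 'b \<Rightarrow> 'k::field"
  assumes "finite B" "finite X" "card B < card X"
  shows "\<exists>c. (\<exists>x\<in>X. c x \<noteq> 0) \<and> (\<forall>b\<in>B. (\<Sum>x\<in>X. c x * v x b) = 0)"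
  using assms
proof (induction B arbitrary: X v rule: finite_induct)
  case empty
  then have "X \<noteq> {}" by auto
  then show ?case by (intro exI[of _ "\<lambda>_. 1"]) auto
next
  case (insert b B)
  show ?case
  proof (cases "\<forall>x\<in>X. v x b = 0")
    case True
    have "card B < card X" using insert.prems(2) insert.hyps by simp
    then obtain c where "\<exists>x\<in>X. c x \<noteq> 0" "\<forall>b\<in>B. (\<Sum>x\<in>X. c x * v x b) = 0"
      using insert.IH[OF insert.prems(1), of v] by blast
    then show ?thesis using True by (intro exI[of _ c]) auto
  next
    case False
    then obtain y where y: "y \<in> X" "v y b \<noteq> 0" by blast
    define u where "u x b' = v x b' - v x b / v y b * v y b'" for x b'
    have "finite (X - {y})" "card B < card (X - {y})"
      using insert.prems insert.hyps y by (auto simp: card_Diff_singleton)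
    then obtain c where c: "\<exists>x\<in>X - {y}. c x \<noteq> 0" "\<forall>b'\<in>B. (\<Sum>x\<in>X - {y}. c x * u x b') = 0"
      using insert.IH[of "X - {y}" u] by auto
    define s where "s = (\<Sum>x\<in>X - {y}. c x * v x b)"
    define c' where "c' = c(y := - s / v y b)"
    have sum: "(\<Sum>x\<in>X. c' x * v x b') = - s / v y b * v y b' + (\<Sum>x\<in>X - {y}. c x * v x b')" for b'
      using y insert.prems by (subst sum.remove[of X y]) (auto simp: c'_def intro!: sum.cong)
    have "(\<Sum>x\<in>X. c' x * v x b') = 0" if "b' \<in> B" for b'
    proof -
      have "0 = (\<Sum>x\<in>X - {y}. c x * v x b' - c x * v x b / v y b * v y b')"
        using c(2) that by (simp add: u_def algebra_simps)
      also have "\<dots> = (\<Sum>x\<in>X - {y}. c x * v x b') - s / v y b * v y b'"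
        by (simp add: s_def sum_subtractf sum_divide_distrib sum_distrib_right)
      finally show ?thesis by (simp add: sum)
    qed
    moreover have "(\<Sum>x\<in>X. c' x * v x b) = 0" using y by (simp add: sum s_def)
    moreover have "\<exists>x\<in>X. c' x \<noteq> 0" using c(1) by (auto simp: c'_def)
    ultimately show ?thesis by blast
  qed
qed

text \<open>Exponent vectors are lists aligned with the list of polynomials, so that the recursion
  matches that of \<open>leading_unit\<close>; only lists of the same length are used.\<close>

fun list_monom :: "'a::comm_ring_1 list \<Rightarrow> nat list \<Rightarrow> 'a" where
  "list_monom [] x = 1"
| "list_monom (t # ts) x = t ^ hd x * list_monom ts (tl x)"

fun list_weight :: "nat list \<Rightarrow> nat list \<Rightarrow> nat" where
  "list_weight [] x = 0"
| "list_weight (e # es) x = hd x * e + list_weight es (tl x)"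

text \<open>The pieces need not be independent. The constant family \<open>polys V\<close> thus
  qualifies next to \<open>hom_polys V\<close>: the former serves chains of primes, the latter
  regular sequences.\<close>

definition is_grading :: "'v set \<Rightarrow> (nat \<Rightarrow> ('v, 'k::field) mpoly set) \<Rightarrow> bool" where
  "is_grading V gr \<longleftrightarrow>
     (\<forall>n. gr n \<subseteq> polys V \<and> 0 \<in> gr n \<and> (\<forall>a\<in>gr n. \<forall>b\<in>gr n. a + b \<in> gr n)) \<and>
     (\<forall>c. const c \<in> gr 0) \<and> (\<forall>k n. \<forall>a\<in>gr k. \<forall>b\<in>gr n. a * b \<in> gr (k + n))"

lemma is_grading_polys: "is_grading V (\<lambda>_. polys V)"
  by (simp add: is_grading_def)

lemma is_grading_hom_polys: "is_grading V (hom_polys V)"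
  by (auto simp: is_grading_def hom_polys_add hom_polys_mult)

lemma grading_sum: "is_grading V gr \<Longrightarrow> (\<And>i. i \<in> I \<Longrightarrow> f i \<in> gr n) \<Longrightarrow> sum f I \<in> gr n"
  by (induction I rule: infinite_finite_induct) (auto simp: is_grading_def)

lemma grading_mult: "is_grading V gr \<Longrightarrow> a \<in> gr k \<Longrightarrow> b \<in> gr n \<Longrightarrow> a * b \<in> gr (k + n)"
  unfolding is_grading_def by blast

lemma grading_const: "is_grading V gr \<Longrightarrow> const c \<in> gr 0"
  unfolding is_grading_def by blast

lemma grading_polys: "is_grading V gr \<Longrightarrow> a \<in> gr n \<Longrightarrow> a \<in> polys V"
  unfolding is_grading_def by blast

lemma grading_const_mult: "is_grading V gr \<Longrightarrow> a \<in> gr n \<Longrightarrow> const c * a \<in> gr n"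
  using grading_mult[of V gr "const c" 0 a n] grading_const[of V gr c] by simp

lemma grading_power:
  assumes gr: "is_grading V gr" and t: "t \<in> gr e" shows "t ^ k \<in> gr (k * e)"
proof (induction k)
  case 0
  show ?case using grading_const[OF gr, of 1] by simp
next
  case (Suc k)
  show ?case using grading_mult[OF gr t Suc] by simp
qed

lemma list_monom_grading:
  assumes gr: "is_grading V gr" and "list_all2 (\<lambda>t e. t \<in> gr e) ts es"
  shows "list_monom ts x \<in> gr (list_weight es x)"
  using assms(2)
proof (induction ts es arbitrary: x rule: list_all2_induct)
  case Nil
  show ?case using grading_const[OF gr, of 1] by simp
next
  case (Cons t ts e es)
  show ?case using grading_mult[OF gr grading_power[OF gr Cons.hyps(1)] Cons.IH] by simp
qed

text \<open>Factor out the lowest power \<open>t ^ a\<close> that occurs. The terms with exponent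
  exactly \<open>a\<close> form a combination \<open>q\<close> of products of the remaining
  elements, to which induction applies; all other terms keep a factor \<open>t\<close> and go into
  \<open>t * p\<close>.\<close>

lemma leading_unit_combination:
  fixes c :: "nat list \<Rightarrow> 'k::field"
  assumes gr: "is_grading V gr" and "list_all2 (\<lambda>t e. t \<in> gr e) ts es"
    and "finite X" "\<And>x. x \<in> X \<Longrightarrow> length x = length ts" "\<And>x. x \<in> X \<Longrightarrow> list_weight es x = w"
    and "\<exists>x\<in>X. c x \<noteq> 0"
  shows "leading_unit V gr ts (\<Sum>x\<in>X. const (c x) * list_monom ts x)"
  using assms(2-)
proof (induction ts es arbitrary: X c w rule: list_all2_induct)
  case Nil
  then have "X = {[]}" by fastforce
  then show ?case using Nil by auto
next
  case (Cons t ts e es)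
  \<comment> \<open>Zero coefficients are discarded before the minimum is taken, so that
    \<open>q\<close> retains a non-zero one.\<close>
  define X0 where "X0 = {x \<in> X. c x \<noteq> 0}"
  have X0: "finite X0" "X0 \<noteq> {}" using Cons.prems by (auto simp: X0_def)
  define a where "a = Min (hd ` X0)"
  have a_le: "a \<le> hd x" if "x \<in> X0" for x using X0 that by (simp add: a_def)
  have "a \<in> hd ` X0" unfolding a_def using X0 by (intro Min_in) auto
  then obtain x0 where x0: "x0 \<in> X0" "hd x0 = a" by blast
  have Cons_hd: "x = hd x # tl x" if "x \<in> X0" for x
    using that Cons.prems(2)[of x] by (cases x) (auto simp: X0_def)
  define Xa where "Xa = {x \<in> X0. hd x = a}"
  define Xb where "Xb = {x \<in> X0. hd x \<noteq> a}"
  define g where "g = (\<Sum>x\<in>X0. const (c x) * (t ^ (hd x - a) * list_monom ts (tl x)))"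
  define q where "q = (\<Sum>y\<in>tl ` Xa. const (c (a # y)) * list_monom ts y)"
  define p where "p = (\<Sum>x\<in>Xb. const (c x) * (t ^ (hd x - Suc a) * list_monom ts (tl x)))"
  have tP: "t \<in> polys V" using grading_polys[OF gr Cons.hyps(1)] .
  have mP: "list_monom ts y \<in> polys V" for y
    using grading_polys[OF gr list_monom_grading[OF gr Cons.hyps(2)]] .
  have "(\<Sum>x\<in>X. const (c x) * list_monom (t # ts) x) = (\<Sum>x\<in>X0. const (c x) * list_monom (t # ts) x)"
    using Cons.prems(1) by (intro sum.mono_neutral_right) (auto simp: X0_def)
  also have "\<dots> = (\<Sum>x\<in>X0. t ^ a * (const (c x) * (t ^ (hd x - a) * list_monom ts (tl x))))"
  proof (rule sum.cong[OF refl])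
    fix x assume "x \<in> X0"
    then have "t ^ hd x = t ^ a * t ^ (hd x - a)" using a_le by (simp flip: power_add)
    then show "const (c x) * list_monom (t # ts) x = t ^ a * (const (c x) * (t ^ (hd x - a) * list_monom ts (tl x)))"
      by (simp add: mult_ac)
  qed
  finally have sum_eq: "(\<Sum>x\<in>X. const (c x) * list_monom (t # ts) x) = t ^ a * g"
    by (simp add: g_def sum_distrib_left)
  have inj: "inj_on tl Xa"
    by (rule inj_onI) (metis (mono_tags, lifting) Cons_hd Xa_def mem_Collect_eq)
  have qa: "q = (\<Sum>x\<in>Xa. const (c x) * (t ^ (hd x - a) * list_monom ts (tl x)))"
    unfolding q_def sum.reindex[OF inj] o_def
  proof (rule sum.cong[OF refl])
    fix x assume "x \<in> Xa"
    then have "a # tl x = x" "hd x = a" using Cons_hd[of x] by (auto simp: Xa_def)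
    then show "const (c (a # tl x)) * list_monom ts (tl x) = const (c x) * (t ^ (hd x - a) * list_monom ts (tl x))"
      by simp
  qed
  have pb: "t * p = (\<Sum>x\<in>Xb. const (c x) * (t ^ (hd x - a) * list_monom ts (tl x)))"
    unfolding p_def sum_distrib_left
  proof (rule sum.cong[OF refl])
    fix x assume "x \<in> Xb"
    then have "a < hd x" using a_le[of x] by (auto simp: Xb_def)
    then have "hd x - a = Suc (hd x - Suc a)" by simp
    then show "t * (const (c x) * (t ^ (hd x - Suc a) * list_monom ts (tl x))) =
        const (c x) * (t ^ (hd x - a) * list_monom ts (tl x))" by (simp add: mult_ac)
  qed
  have "X0 = Xa \<union> Xb" "Xa \<inter> Xb = {}" by (auto simp: Xa_def Xb_def)
  then have g: "g = q + t * p"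
    unfolding g_def qa pb using X0(1) by (simp add: sum.union_disjoint)
  have "g \<in> gr (w - a * e)"
    unfolding g_def
  proof (rule grading_sum[OF gr])
    fix x assume x: "x \<in> X0"
    have "t ^ (hd x - a) * list_monom ts (tl x) \<in> gr ((hd x - a) * e + list_weight es (tl x))"
      using grading_mult[OF gr grading_power[OF gr Cons.hyps(1)] list_monom_grading[OF gr Cons.hyps(2)]] .
    moreover have "w = hd x * e + list_weight es (tl x)"
      using Cons.prems(3)[of x] x by (simp add: X0_def)
    then have "(hd x - a) * e + list_weight es (tl x) = w - a * e"
      using a_le[OF x] by (simp add: diff_mult_distrib)
    ultimately show "const (c x) * (t ^ (hd x - a) * list_monom ts (tl x)) \<in> gr (w - a * e)"
      using grading_const_mult[OF gr] by metis
  qed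
  moreover have "p \<in> polys V" unfolding p_def using tP mP by simp
  moreover have "leading_unit V gr ts q"
    unfolding q_def
  proof (rule Cons.IH[where w = "w - a * e"])
    show "finite (tl ` Xa)" using X0 by (simp add: Xa_def)
    show "length y = length ts" if "y \<in> tl ` Xa" for y
      using that Cons.prems(2) by (auto simp: Xa_def X0_def)
    show "list_weight es y = w - a * e" if y: "y \<in> tl ` Xa" for y
    proof -
      obtain x where x: "x \<in> Xa" "y = tl x" using y by blast
      then have "w = a * e + list_weight es y" using Cons.prems(3)[of x] by (auto simp: Xa_def X0_def)
      then show ?thesis by simp
    qed
    have "c (a # tl x0) \<noteq> 0" using x0 Cons_hd[of x0] by (auto simp: X0_def)
    then show "\<exists>y\<in>tl ` Xa. c (a # y) \<noteq> 0" using x0 by (auto simp: Xa_def)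
  qed
  ultimately show ?case unfolding sum_eq g by auto
qed

lemma lookup_le_monom_deg: "lookup m v \<le> monom_deg m"
proof (cases "v \<in> keys m")
  case True
  then show ?thesis unfolding monom_deg_def by (intro member_le_sum) auto
next
  case False
  then show ?thesis by (simp add: in_keys_iff)
qed

lemma monom_deg_mult_le:
  assumes "\<forall>m\<in>keys p. monom_deg m \<le> a" "\<forall>m\<in>keys q. monom_deg m \<le> b"
  shows "\<forall>m\<in>keys (p * q). monom_deg m \<le> a + b"
proof
  fix m assume "m \<in> keys (p * q)"
  then obtain k l where "k \<in> keys p" "l \<in> keys q" "m = k + l" by (rule keys_multE)
  then show "monom_deg m \<le> a + b" using assms by (simp add: monom_deg_add add_mono)
qed

lemma monom_deg_one: "m \<in> keys (1 :: ('v, 'k::field) mpoly) \<Longrightarrow> monom_deg m = 0"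
  by (simp add: monom_deg_def)

lemma monom_deg_power_le:
  fixes p :: "('v, 'k::field) mpoly"
  assumes "\<forall>m\<in>keys p. monom_deg m \<le> a"
  shows "\<forall>m\<in>keys (p ^ k). monom_deg m \<le> k * a"
proof (induction k)
  case 0
  then show ?case using monom_deg_one by simp
next
  case (Suc k)
  show ?case using monom_deg_mult_le[OF assms Suc] by simp
qed

lemma monom_deg_list_monom_le:
  fixes ts :: "('v, 'k::field) mpoly list"
  assumes "\<forall>t\<in>set ts. \<forall>m\<in>keys t. monom_deg m \<le> a" "set x \<subseteq> {..<N}" "length x = length ts"
  shows "\<forall>m\<in>keys (list_monom ts x). monom_deg m \<le> length ts * a * N"
  using assms
proof (induction ts arbitrary: x)
  case Nil
  then show ?case using monom_deg_one by simp
next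
  case (Cons t ts)
  obtain k y where x: "x = k # y" using Cons.prems by (cases x) auto
  have "\<forall>m\<in>keys (t ^ k * list_monom ts y). monom_deg m \<le> k * a + length ts * a * N"
    using Cons x by (intro monom_deg_mult_le monom_deg_power_le Cons.IH) auto
  moreover have "k * a \<le> a * N" using Cons.prems x by (simp add: mult.commute)
  ultimately have le: "\<forall>m\<in>keys (t ^ k * list_monom ts y). monom_deg m \<le> a * N + length ts * a * N"
    by (meson add_le_mono1 order_trans)
  then show ?case by (simp add: x algebra_simps)
qed

lemma card_bounded_monomials:
  assumes "finite F"
  shows "finite {m :: 'v \<Rightarrow>\<^sub>0 nat. keys m \<subseteq> F \<and> (\<forall>v. lookup m v \<le> M)}"
    and "card {m :: 'v \<Rightarrow>\<^sub>0 nat. keys m \<subseteq> F \<and> (\<forall>v. lookup m v \<le> M)} \<le> (M + 1) ^ card F"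
proof -
  let ?B = "{m :: 'v \<Rightarrow>\<^sub>0 nat. keys m \<subseteq> F \<and> (\<forall>v. lookup m v \<le> M)}"
  let ?f = "\<lambda>m. restrict (lookup m) F"
  have inj: "inj_on ?f ?B"
  proof (rule inj_onI, rule poly_mapping_eqI)
    fix m n v assume *: "m \<in> ?B" "n \<in> ?B" "?f m = ?f n"
    show "lookup m v = lookup n v"
    proof (cases "v \<in> F")
      case True
      then show ?thesis using fun_cong[OF *(3), of v] by simp
    next
      case False
      then have "v \<notin> keys m" "v \<notin> keys n" using * by blast+
      then show ?thesis by (simp add: in_keys_iff)
    qed
  qed
  have sub: "?f ` ?B \<subseteq> PiE F (\<lambda>_. {..M})" by (auto simp: PiE_def)
  have fin: "finite (PiE F (\<lambda>_. {..M}))" using assms by (intro finite_PiE) auto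
  show "finite ?B" using inj_on_finite[OF inj sub fin] .
  have "card ?B \<le> card (PiE F (\<lambda>_. {..M}))" using card_inj_on_le[OF inj sub fin] .
  also have "\<dots> = (M + 1) ^ card F" using assms by (simp add: card_PiE)
  finally show "card ?B \<le> (M + 1) ^ card F" .
qed

text \<open>Exponents below \<open>N\<close> give \<open>N ^ length ts\<close> products, all of
  degree at most \<open>L * N\<close>. At most \<open>card \<Gamma> * ((L + 1) * N) ^ k\<close>
  monomials of such degree are supported on \<Gamma>. As \<open>k < length ts\<close>, the products
  outnumber these monomials for large \<open>N\<close>, and some combination has coefficient 0 at
  all of them.\<close>

lemma exists_combination:
  fixes ts :: "('v, 'k::field) mpoly list"
  assumes \<Gamma>: "finite \<Gamma>" "\<And>F. F \<in> \<Gamma> \<Longrightarrow> finite F \<and> card F \<le> k" and len: "k < length ts"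
  obtains X c where "finite X" "\<And>x. x \<in> X \<Longrightarrow> length x = length ts" "\<exists>x\<in>X. c x \<noteq> (0 :: 'k)"
    "\<And>m. m \<in> keys (\<Sum>x\<in>X. const (c x) * list_monom ts x) \<Longrightarrow> keys m \<notin> \<Gamma>"
proof -
  define a where "a = (\<Sum>t\<in>set ts. \<Sum>m\<in>keys t. monom_deg m)"
  have a: "\<forall>t\<in>set ts. \<forall>m\<in>keys t. monom_deg m \<le> a"
  proof (intro ballI)
    fix t m assume tm: "t \<in> set ts" "m \<in> keys t"
    have "monom_deg m \<le> (\<Sum>m\<in>keys t. monom_deg m)" using tm by (intro member_le_sum) auto
    also have "\<dots> \<le> a" unfolding a_def using tm by (intro member_le_sum[of t "set ts" "\<lambda>t. \<Sum>m\<in>keys t. monom_deg m"]) auto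
    finally show "monom_deg m \<le> a" .
  qed
  define L where "L = length ts * a"
  \<comment> \<open>One more than the constant in the count, so that \<open>N * N ^ k\<close>
    exceeds it. Being positive, \<open>N\<close> also gives
    \<open>L * N + 1 \<le> (L + 1) * N\<close>.\<close>
  define N where "N = card \<Gamma> * (L + 1) ^ k + 1"
  define X where "X = {x. set x \<subseteq> {..<N} \<and> length x = length ts}"
  have X: "finite X" "card X = N ^ length ts"
    unfolding X_def using finite_lists_length_eq[of "{..<N}"] card_lists_length_eq[of "{..<N}"] by auto
  define S where "S F = {m :: 'v \<Rightarrow>\<^sub>0 nat. keys m \<subseteq> F \<and> (\<forall>v. lookup m v \<le> L * N)}" for F
  define B where "B = (\<Union>F\<in>\<Gamma>. S F)"
  have finB: "finite B" unfolding B_def S_def using \<Gamma> by (intro finite_UN_I card_bounded_monomials) auto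
  have "card (S F) \<le> ((L + 1) * N) ^ k" if "F \<in> \<Gamma>" for F
  proof -
    have "card (S F) \<le> (L * N + 1) ^ card F" unfolding S_def using \<Gamma>(2)[OF that] by (intro card_bounded_monomials) auto
    also have "\<dots> \<le> (L * N + 1) ^ k" using \<Gamma>(2)[OF that] by (intro power_increasing) auto
    also have "\<dots> \<le> ((L + 1) * N) ^ k" by (intro power_mono) (auto simp: N_def)
    finally show ?thesis .
  qed
  then have "(\<Sum>F\<in>\<Gamma>. card (S F)) \<le> of_nat (card \<Gamma>) * ((L + 1) * N) ^ k" by (rule sum_bounded_above)
  then have "(\<Sum>F\<in>\<Gamma>. card (S F)) \<le> card \<Gamma> * ((L + 1) * N) ^ k" by (simp only: of_nat_id)
  then have "card B \<le> card \<Gamma> * ((L + 1) * N) ^ k"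
    unfolding B_def using card_UN_le[OF \<Gamma>(1), of S] by linarith
  also have "\<dots> = card \<Gamma> * (L + 1) ^ k * N ^ k" by (simp only: power_mult_distrib mult.assoc)
  also have "\<dots> < N * N ^ k" by (simp add: N_def)
  also have "\<dots> = N ^ Suc k" by simp
  also have "\<dots> \<le> N ^ length ts" using len by (intro power_increasing) (auto simp: N_def)
  finally have "card B < card X" using X by simp
  then obtain c where c: "\<exists>x\<in>X. c x \<noteq> (0 :: 'k)" "\<forall>b\<in>B. (\<Sum>x\<in>X. c x * lookup (list_monom ts x) b) = 0"
    using exists_linear_relation[OF finB X(1), of "\<lambda>x. lookup (list_monom ts x)"] by blast
  have "keys m \<notin> \<Gamma>" if m: "m \<in> keys (\<Sum>x\<in>X. const (c x) * list_monom ts x)" for m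
  proof
    assume mem: "keys m \<in> \<Gamma>"
    have look: "lookup (const (c x) * list_monom ts x) m = c x * lookup (list_monom ts x) m" for x
      using lookup_single_mult[of 0 "c x" "list_monom ts x" m] by simp
    have sum: "lookup (\<Sum>x\<in>X. const (c x) * list_monom ts x) m = (\<Sum>x\<in>X. c x * lookup (list_monom ts x) m)"
      by (simp add: lookup_sum look)
    then obtain x where x: "x \<in> X" "c x * lookup (list_monom ts x) m \<noteq> 0"
      using m by (metis (no_types, lifting) in_keys_iff sum.neutral)
    then have "m \<in> keys (list_monom ts x)" by (auto simp: in_keys_iff)
    then have "monom_deg m \<le> L * N"
      using monom_deg_list_monom_le[OF a, of x N] x(1) unfolding L_def X_def by blast
    then have "lookup m v \<le> L * N" for v using lookup_le_monom_deg[of m v] by linarith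
    then have "m \<in> B" unfolding B_def S_def using mem by blast
    then show False using c(2) sum m by (auto simp: in_keys_iff)
  qed
  moreover have "\<And>x. x \<in> X \<Longrightarrow> length x = length ts" by (simp add: X_def)
  ultimately show thesis using that X(1) c(1) by blast
qed

lemma exists_leading_unit:
  fixes ts :: "('v, 'k::field) mpoly list"
  assumes "finite \<Gamma>" "\<And>F. F \<in> \<Gamma> \<Longrightarrow> finite F \<and> card F \<le> k" "k < length ts" and ts: "set ts \<subseteq> polys V"
  obtains f where "leading_unit V (\<lambda>_. polys V) ts f" "\<And>m. m \<in> keys f \<Longrightarrow> keys m \<notin> \<Gamma>"
proof -
  obtain X c where X: "finite X" "\<And>x. x \<in> X \<Longrightarrow> length x = length ts" "\<exists>x\<in>X. c x \<noteq> (0 :: 'k)"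
    "\<And>m. m \<in> keys (\<Sum>x\<in>X. const (c x) * list_monom ts x) \<Longrightarrow> keys m \<notin> \<Gamma>"
    using exists_combination[OF assms(1-3)] by blast
  let ?es = "replicate (length ts) 0"
  have "list_all2 (\<lambda>t e. t \<in> polys V) ts ?es" using ts by (auto simp: list_all2_conv_all_nth)
  moreover have "list_weight (replicate n 0) x = 0" for n x by (induction n arbitrary: x) auto
  ultimately have "leading_unit V (\<lambda>_. polys V) ts (\<Sum>x\<in>X. const (c x) * list_monom ts x)"
    using X(1-3) by (intro leading_unit_combination[OF is_grading_polys, where w = 0 and es = ?es]) auto
  then show thesis using that X(4) by blast
qed

lemma hom_comp_sum: "hom_comp n (sum f I) = (\<Sum>i\<in>I. hom_comp n (f i))"
  by (induction I rule: infinite_finite_induct) (auto simp: hom_comp_add hom_comp_id[of 0 UNIV])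

lemma exists_homogeneous_leading_unit:
  fixes ts :: "('v, 'k::field) mpoly list"
  assumes "finite \<Gamma>" "\<And>F. F \<in> \<Gamma> \<Longrightarrow> finite F \<and> card F \<le> k" "k < length ts"
    and ts: "\<And>t. t \<in> set ts \<Longrightarrow> pos_hom V t"
  obtains f n where "leading_unit V (hom_polys V) ts f" "f \<in> hom_polys V n" "\<And>m. m \<in> keys f \<Longrightarrow> keys m \<notin> \<Gamma>"
proof -
  obtain X c where X: "finite X" "\<And>x. x \<in> X \<Longrightarrow> length x = length ts" "\<exists>x\<in>X. c x \<noteq> (0 :: 'k)"
    "\<And>m. m \<in> keys (\<Sum>x\<in>X. const (c x) * list_monom ts x) \<Longrightarrow> keys m \<notin> \<Gamma>"
    using exists_combination[OF assms(1-3)] by blast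
  have "\<forall>t\<in>set ts. \<exists>e. t \<in> hom_polys V e" using ts by (auto simp: pos_hom_def)
  then obtain dg where dg: "\<And>t. t \<in> set ts \<Longrightarrow> t \<in> hom_polys V (dg t)" by metis
  define es where "es = map dg ts"
  have all2: "list_all2 (\<lambda>t e. t \<in> hom_polys V e) ts es"
    using dg by (auto simp: es_def list_all2_conv_all_nth)
  obtain x0 where x0: "x0 \<in> X" "c x0 \<noteq> 0" using X(3) by blast
  \<comment> \<open>Keeping only the terms of one weight amounts to taking the component of degree
    \<open>w\<close>, which creates no new monomials; \<open>x0\<close> guarantees a non-zero
    coefficient.\<close>
  define w where "w = list_weight es x0"
  define X' where "X' = {x \<in> X. list_weight es x = w}"
  let ?f = "\<Sum>x\<in>X'. const (c x) * list_monom ts x"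
  have gr: "const (c x) * list_monom ts x \<in> hom_polys V (list_weight es x)" for x
    using grading_const_mult[OF is_grading_hom_polys list_monom_grading[OF is_grading_hom_polys all2]] .
  have "hom_comp w (\<Sum>x\<in>X. const (c x) * list_monom ts x) = (\<Sum>x\<in>X. hom_comp w (const (c x) * list_monom ts x))"
    by (rule hom_comp_sum)
  also have "\<dots> = (\<Sum>x\<in>X'. hom_comp w (const (c x) * list_monom ts x))"
    using X(1) hom_comp_none[OF gr] by (intro sum.mono_neutral_right) (auto simp: X'_def)
  also have "\<dots> = ?f" using hom_comp_id[OF gr] by (intro sum.cong) (auto simp: X'_def)
  finally have f: "hom_comp w (\<Sum>x\<in>X. const (c x) * list_monom ts x) = ?f" .
  have "leading_unit V (hom_polys V) ts ?f"
    using X x0 by (intro leading_unit_combination[OF is_grading_hom_polys all2, where w = w]) (auto simp: X'_def w_def)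
  moreover have "?f \<in> hom_polys V w"
    using gr by (intro grading_sum[OF is_grading_hom_polys]) (auto simp: X'_def)
  moreover have "keys m \<notin> \<Gamma>" if "m \<in> keys ?f" for m
    using that X(4) unfolding f[symmetric] by (simp add: hom_comp_def)
  ultimately show thesis using that by blast
qed

section \<open>Quotients of the polynomial ring\<close>

lemma poly_ring_simps [simp]:
  "carrier (poly_ring V) = polys V" "p \<otimes>\<^bsub>poly_ring V\<^esub> q = p * q" "p \<oplus>\<^bsub>poly_ring V\<^esub> q = p + q"
  "\<one>\<^bsub>poly_ring V\<^esub> = 1" "\<zero>\<^bsub>poly_ring V\<^esub> = 0"
  by (simp_all add: poly_ring_def polys_def)

lemma cring_poly_ring: "cring (poly_ring V :: ('v, 'k::field) mpoly ring)"
proof (intro cringI abelian_groupI comm_monoidI)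
  fix x :: "('v, 'k) mpoly" assume "x \<in> carrier (poly_ring V)"
  then show "\<exists>y\<in>carrier (poly_ring V). y \<oplus>\<^bsub>poly_ring V\<^esub> x = \<zero>\<^bsub>poly_ring V\<^esub>"
    by (intro bexI[of _ "- x"]) auto
qed (simp_all add: algebra_simps)

lemma ring_poly_ring: "ring (poly_ring V :: ('v, 'k::field) mpoly ring)"
  using cring_poly_ring by (rule cring.axioms)

lemma a_inv_poly_ring: "b \<in> polys V \<Longrightarrow> \<ominus>\<^bsub>poly_ring V\<^esub> b = - b"
  by (rule abelian_group.minus_equality[OF ring.is_abelian_group[OF ring_poly_ring]]) auto

lemma ideal_poly_ring_iff: "ideal J (poly_ring V) \<longleftrightarrow> poly_ideal V J"
proof
  assume J: "ideal J (poly_ring V)"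
  interpret ideal J "poly_ring V" by (rule J)
  note sub = additive_subgroup_axioms
  show "poly_ideal V J"
    unfolding poly_ideal_def
  proof (intro conjI ballI)
    show "J \<subseteq> polys V" using a_subset by (simp only: poly_ring_simps)
    show "0 \<in> J" using additive_subgroup.zero_closed[OF sub] by (simp only: poly_ring_simps)
    show "a + b \<in> J" if "a \<in> J" "b \<in> J" for a b
      using additive_subgroup.a_closed[OF sub that] by (simp only: poly_ring_simps)
    show "s * a \<in> J" if "a \<in> J" "s \<in> polys V" for a s
      using I_l_closed[of a s] that by (simp only: poly_ring_simps)
  qed
next
  assume J: "poly_ideal V J"
  show "ideal J (poly_ring V)"
  proof (rule idealI[OF ring_poly_ring])
    show "subgroup J (add_monoid (poly_ring V))"
    proof (rule group.subgroupI[OF abelian_group.a_group[OF ring.is_abelian_group[OF ring_poly_ring]]])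
      show "J \<subseteq> carrier (add_monoid (poly_ring V))" using poly_ideal_polys[OF J] by auto
      show "J \<noteq> {}" using poly_ideal_0[OF J] by blast
      show "inv\<^bsub>add_monoid (poly_ring V)\<^esub> a \<in> J" if "a \<in> J" for a
        using that a_inv_poly_ring[of a V] poly_ideal_uminus[OF J] poly_ideal_polys[OF J]
        by (simp add: a_inv_def)
      show "a \<otimes>\<^bsub>add_monoid (poly_ring V)\<^esub> b \<in> J" if "a \<in> J" "b \<in> J" for a b
        using poly_ideal_add[OF J that] by simp
    qed
  qed (use poly_ideal_mult[OF J] poly_ideal_mult2[OF J] in auto)
qed

lemma genideal_poly_ring_ideal: "X \<subseteq> polys V \<Longrightarrow> poly_ideal V (genideal (poly_ring V) X)"
  using ring.genideal_ideal[OF ring_poly_ring, of X V] by (simp add: ideal_poly_ring_iff)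

lemma genideal_poly_ring_minimal: "poly_ideal V J \<Longrightarrow> X \<subseteq> J \<Longrightarrow> genideal (poly_ring V) X \<subseteq> J"
  by (auto simp: genideal_def ideal_poly_ring_iff)

lemma genideal_poly_ring_self: "X \<subseteq> genideal (poly_ring V) X"
  by (auto simp: genideal_def)

fun adjoins :: "'v set \<Rightarrow> ('v, 'k::field) mpoly set \<Rightarrow> ('v, 'k) mpoly list \<Rightarrow> ('v, 'k) mpoly set" where
  "adjoins V J [] = J"
| "adjoins V J (t # ts) = adjoins V (adjoin V J t) ts"

lemma adjoins_ideal: "poly_ideal V J \<Longrightarrow> poly_ideal V (adjoins V J ts)"
  by (induction ts arbitrary: J) (auto intro: adjoin_ideal)

lemma adjoin_minimal:
  assumes "poly_ideal V K" "J \<subseteq> K" "t \<in> K" shows "adjoin V J t \<subseteq> K"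
proof
  fix x assume "x \<in> adjoin V J t"
  then obtain s where "s \<in> polys V" "x - t * s \<in> J" by (rule adjoinE)
  then show "x \<in> K" using poly_ideal_cong[OF assms(1), of x "t * s"] poly_ideal_mult2[OF assms(1,3)] assms(2) by blast
qed

lemma adjoin_mem: "poly_ideal V J \<Longrightarrow> t \<in> polys V \<Longrightarrow> t \<in> adjoin V J t"
  using adjoin_gen[of V J t 1] by simp

lemma adjoins_minimal:
  "poly_ideal V K \<Longrightarrow> J \<subseteq> K \<Longrightarrow> set ts \<subseteq> K \<Longrightarrow> adjoins V J ts \<subseteq> K"
  by (induction ts arbitrary: J) (simp_all add: adjoin_minimal)

lemma adjoins_superset:
  "poly_ideal V J \<Longrightarrow> set ts \<subseteq> polys V \<Longrightarrow> J \<union> set ts \<subseteq> adjoins V J ts"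
proof (induction ts arbitrary: J)
  case (Cons t ts)
  have "adjoin V J t \<union> set ts \<subseteq> adjoins V J (t # ts)"
    using Cons by (simp add: adjoin_ideal)
  moreover have "J \<subseteq> adjoin V J t" "t \<in> adjoin V J t"
    using Cons.prems adjoin_mono adjoin_mem by auto
  ultimately show ?case by auto
qed simp

lemma reg_seq_iff_nth:
  "reg_seq V J ts \<longleftrightarrow> (\<forall>i<length ts. regular_mod V (adjoins V J (take i ts)) (ts ! i))"
proof (induction ts arbitrary: J)
  case (Cons t ts)
  show ?case
    unfolding reg_seq.simps Cons by (auto simp: All_less_Suc2)
qed simp

section \<open>Cosets and regular sequences in the quotient ring\<close>

abbreviation coset :: "'v set \<Rightarrow> ('v, 'k::field) mpoly set \<Rightarrow> ('v, 'k) mpoly \<Rightarrow> ('v, 'k) mpoly set" where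
  "coset V I \<equiv> (+>\<^bsub>poly_ring V\<^esub>) I"

abbreviation quot :: "'v set \<Rightarrow> ('v, 'k::field) mpoly set \<Rightarrow> ('v, 'k) mpoly set ring" where
  "quot V I \<equiv> poly_ring V Quot I"

lemma coset_eq_iff:
  assumes "poly_ideal V I" "a \<in> polys V" "b \<in> polys V"
  shows "coset V I a = coset V I b \<longleftrightarrow> a - b \<in> I"
  using ring.quotient_eq_iff_same_a_r_cos[OF ring_poly_ring, of I V a b] assms a_inv_poly_ring[of b V]
  by (simp add: ideal_poly_ring_iff a_minus_def)

context
  fixes V :: "'v set" and I :: "('v, 'k::field) mpoly set"
  assumes I: "poly_ideal V I"
begin

lemma cring_quot: "cring (quot V I)"
  using ideal.quotient_is_cring[OF _ cring_poly_ring] I by (simp add: ideal_poly_ring_iff)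

lemma ring_quot: "ring (quot V I)"
  using cring_quot by (rule cring.axioms)

lemma coset_hom: "coset V I \<in> ring_hom (poly_ring V) (quot V I)"
  using ideal.rcos_ring_hom[of I "poly_ring V"] I by (simp add: ideal_poly_ring_iff)

lemma coset_simps:
  "a \<in> polys V \<Longrightarrow> coset V I a \<in> carrier (quot V I)"
  "a \<in> polys V \<Longrightarrow> b \<in> polys V \<Longrightarrow> coset V I a \<oplus>\<^bsub>quot V I\<^esub> coset V I b = coset V I (a + b)"
  "a \<in> polys V \<Longrightarrow> b \<in> polys V \<Longrightarrow> coset V I a \<otimes>\<^bsub>quot V I\<^esub> coset V I b = coset V I (a * b)"
  "\<one>\<^bsub>quot V I\<^esub> = coset V I 1"
  using ring_hom_closed[OF coset_hom, of a] ring_hom_add[OF coset_hom, of a b]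
    ring_hom_mult[OF coset_hom, of a b] ring_hom_one[OF coset_hom] by simp_all

lemma coset_zero: "\<zero>\<^bsub>quot V I\<^esub> = coset V I 0"
  using ring_hom_zero[OF coset_hom ring_poly_ring ring_quot] by simp

lemma carrier_quot: "carrier (quot V I) = coset V I ` polys V"
  by (auto simp: FactRing_def A_RCOSETS_def' a_r_coset_def')

lemma coset_mem_image_iff:
  assumes "poly_ideal V J" "I \<subseteq> J" "a \<in> polys V"
  shows "coset V I a \<in> coset V I ` J \<longleftrightarrow> a \<in> J"
proof
  assume "coset V I a \<in> coset V I ` J"
  then obtain b where b: "b \<in> J" "coset V I a = coset V I b" by blast
  then have "a - b \<in> I" using coset_eq_iff[OF I assms(3)] poly_ideal_polys[OF assms(1)] by blast
  then show "a \<in> J" using poly_ideal_cong[OF assms(1) _ b(1)] assms(2) by blast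
qed blast

lemma ideal_image_coset:
  assumes J: "poly_ideal V J"
  shows "ideal (coset V I ` J) (quot V I)"
proof (rule idealI[OF ring_quot])
  interpret Q: cring "quot V I" by (rule cring_quot)
  have JP: "a \<in> J \<Longrightarrow> a \<in> polys V" for a using poly_ideal_polys[OF J] .
  show "subgroup (coset V I ` J) (add_monoid (quot V I))"
  proof (rule group.subgroupI[OF Q.a_group])
    show "coset V I ` J \<subseteq> carrier (add_monoid (quot V I))" using JP coset_simps(1) by auto
    show "coset V I ` J \<noteq> {}" using poly_ideal_0[OF J] by blast
    show "inv\<^bsub>add_monoid (quot V I)\<^esub> x \<in> coset V I ` J" if x: "x \<in> coset V I ` J" for x
    proof -
      obtain a where a: "a \<in> J" "x = coset V I a" using x by blast
      have "\<ominus>\<^bsub>quot V I\<^esub> x = coset V I (- a)"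
        using a JP[of a] coset_simps by (intro Q.minus_equality) (auto simp: coset_zero)
      then show ?thesis using a(1) poly_ideal_uminus[OF J] by (simp add: a_inv_def)
    qed
    show "x \<otimes>\<^bsub>add_monoid (quot V I)\<^esub> y \<in> coset V I ` J" if "x \<in> coset V I ` J" "y \<in> coset V I ` J" for x y
      using that poly_ideal_add[OF J] JP by (auto simp: coset_simps)
  qed
  fix x y assume "x \<in> coset V I ` J" "y \<in> carrier (quot V I)"
  then obtain a b where ab: "a \<in> J" "x = coset V I a" "b \<in> polys V" "y = coset V I b"
    by (auto simp: carrier_quot)
  show "y \<otimes>\<^bsub>quot V I\<^esub> x \<in> coset V I ` J" "x \<otimes>\<^bsub>quot V I\<^esub> y \<in> coset V I ` J"
    using ab JP poly_ideal_mult[OF J] poly_ideal_mult2[OF J] by (auto simp: coset_simps)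
qed

lemma poly_ideal_vimage_coset:
  assumes K: "ideal K (quot V I)"
  shows "poly_ideal V {a \<in> polys V. coset V I a \<in> K}" and "I \<subseteq> {a \<in> polys V. coset V I a \<in> K}"
proof -
  note sub = ideal.axioms(1)[OF K]
  have K0: "coset V I 0 \<in> K" using additive_subgroup.zero_closed[OF sub] by (simp only: coset_zero)
  show "poly_ideal V {a \<in> polys V. coset V I a \<in> K}"
    unfolding poly_ideal_def
  proof (intro conjI ballI)
    show "0 \<in> {a \<in> polys V. coset V I a \<in> K}" using K0 by simp
  next
    fix a b assume ab: "a \<in> {a \<in> polys V. coset V I a \<in> K}" "b \<in> {a \<in> polys V. coset V I a \<in> K}"
    then show "a + b \<in> {a \<in> polys V. coset V I a \<in> K}"
      using additive_subgroup.a_closed[OF sub, of "coset V I a" "coset V I b"] by (simp add: coset_simps)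
  next
    fix a s :: "('v, 'k) mpoly" assume as: "a \<in> {a \<in> polys V. coset V I a \<in> K}" "s \<in> polys V"
    then show "s * a \<in> {a \<in> polys V. coset V I a \<in> K}"
      using ideal.I_l_closed[OF K, of "coset V I a" "coset V I s"] by (simp add: coset_simps)
  qed blast
  show "I \<subseteq> {a \<in> polys V. coset V I a \<in> K}"
  proof
    fix a assume a: "a \<in> I"
    then have aP: "a \<in> polys V" using poly_ideal_polys[OF I] by blast
    then have "coset V I a = coset V I 0" using a coset_eq_iff[OF I aP] by simp
    then show "a \<in> {a \<in> polys V. coset V I a \<in> K}" using aP K0 by simp
  qed
qed

lemma genideal_coset:
  assumes ts: "set ts \<subseteq> polys V"
  shows "genideal (quot V I) (coset V I ` set ts) = coset V I ` adjoins V I ts"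
proof
  show "genideal (quot V I) (coset V I ` set ts) \<subseteq> coset V I ` adjoins V I ts"
    using ring.genideal_minimal[OF ring_quot ideal_image_coset[OF adjoins_ideal[OF I]]]
      adjoins_superset[OF I ts] by blast
  let ?K = "genideal (quot V I) (coset V I ` set ts)"
  have sub: "coset V I ` set ts \<subseteq> carrier (quot V I)" using ts coset_simps(1) by blast
  have "ideal ?K (quot V I)" using ring.genideal_ideal[OF ring_quot sub] .
  then have "adjoins V I ts \<subseteq> {a \<in> polys V. coset V I a \<in> ?K}"
    using poly_ideal_vimage_coset[of ?K] ring.genideal_self[OF ring_quot sub] ts
    by (intro adjoins_minimal) auto
  then show "coset V I ` adjoins V I ts \<subseteq> ?K" by blast
qed

lemma regular_sequence_coset_iff:
  assumes ts: "set ts \<subseteq> polys V"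
  shows "regular_sequence (quot V I) (map (coset V I) ts) \<longleftrightarrow> reg_seq V I ts \<and> 1 \<notin> adjoins V I ts"
proof -
  have take: "genideal (quot V I) (set (take i (map (coset V I) ts))) = coset V I ` adjoins V I (take i ts)" for i
    using genideal_coset[of "take i ts"] ts set_take_subset[of i ts] by (simp add: take_map)
  have mem: "coset V I a \<in> coset V I ` adjoins V I (take i ts) \<longleftrightarrow> a \<in> adjoins V I (take i ts)"
    if "a \<in> polys V" for a i
    using coset_mem_image_iff[OF adjoins_ideal[OF I] _ that] adjoins_superset[OF I, of "take i ts"] ts set_take_subset[of i ts]
    by blast
  have "(\<forall>i<length ts. \<forall>a\<in>carrier (quot V I).
          map (coset V I) ts ! i \<otimes>\<^bsub>quot V I\<^esub> a \<in> coset V I ` adjoins V I (take i ts) \<longrightarrow>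
          a \<in> coset V I ` adjoins V I (take i ts)) \<longleftrightarrow> reg_seq V I ts"
    unfolding reg_seq_iff_nth carrier_quot ball_simps regular_mod_def
  proof (intro all_cong1 imp_cong refl ball_cong)
    fix i and a :: "('v, 'k) mpoly"
    assume i: "i < length ts" and a: "a \<in> polys V"
    have "ts ! i \<in> polys V" using i ts by auto
    then show "(map (coset V I) ts ! i \<otimes>\<^bsub>quot V I\<^esub> coset V I a \<in> coset V I ` adjoins V I (take i ts)) =
        (ts ! i * a \<in> adjoins V I (take i ts))"
      using i a mem by (simp add: coset_simps)
    show "(coset V I a \<in> coset V I ` adjoins V I (take i ts)) = (a \<in> adjoins V I (take i ts))"
      using mem[OF a] .
  qed
  moreover have "coset V I ` adjoins V I ts \<noteq> carrier (quot V I) \<longleftrightarrow> 1 \<notin> adjoins V I ts"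
  proof
    assume ne: "coset V I ` adjoins V I ts \<noteq> carrier (quot V I)"
    show "1 \<notin> adjoins V I ts"
    proof
      assume "1 \<in> adjoins V I ts"
      then have "polys V \<subseteq> adjoins V I ts" using poly_ideal_mult2[OF adjoins_ideal[OF I], of 1 ts] by auto
      then have "adjoins V I ts = polys V" using poly_ideal_polys[OF adjoins_ideal[OF I]] by blast
      then show False using ne carrier_quot by simp
    qed
  next
    assume "1 \<notin> adjoins V I ts"
    then have "coset V I 1 \<notin> coset V I ` adjoins V I ts" using mem[of 1 "length ts"] by simp
    then show "coset V I ` adjoins V I ts \<noteq> carrier (quot V I)" using coset_simps(1)[of 1] by auto
  qed
  moreover have "set (map (coset V I) ts) \<subseteq> carrier (quot V I)" using ts coset_simps(1) by auto
  ultimately show ?thesis unfolding regular_sequence_def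
    using take take[of "length ts"] by simp
qed

text \<open>A homogeneous class is by definition the class of a homogeneous polynomial, so regular
  sequences lift, and depth becomes a question about lists of polynomials.\<close>

lemma graded_depth_eq:
  "graded_depth V I = (SUP ts\<in>{ts. reg_seq V I ts \<and> 1 \<notin> adjoins V I ts \<and> (\<forall>t\<in>set ts. pos_hom V t)}. enat (length ts))"
proof -
  have pos: "pos_homogeneous_elements V I = coset V I ` {t. pos_hom V t}"
    unfolding pos_homogeneous_elements_def pos_hom_def hom_polys_def poly_ring_simps by blast
  have "{xs. regular_sequence (quot V I) xs \<and> set xs \<subseteq> pos_homogeneous_elements V I} =
      map (coset V I) ` {ts. reg_seq V I ts \<and> 1 \<notin> adjoins V I ts \<and> (\<forall>t\<in>set ts. pos_hom V t)}"
    (is "?A = map _ ` ?B")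
  proof (intro equalityI subsetI)
    fix xs assume xs: "xs \<in> ?A"
    then have "xs \<in> lists (coset V I ` {t. pos_hom V t})" unfolding pos lists_eq_set by blast
    then have "xs \<in> map (coset V I) ` lists {t. pos_hom V t}" by (simp only: lists_image)
    then obtain ts where ts: "xs = map (coset V I) ts" "set ts \<subseteq> {t. pos_hom V t}"
      unfolding lists_eq_set by blast
    then have "set ts \<subseteq> polys V" using pos_hom_polys by blast
    then show "xs \<in> map (coset V I) ` ?B" using xs ts regular_sequence_coset_iff[of ts] by blast
  next
    fix xs assume "xs \<in> map (coset V I) ` ?B"
    then obtain ts where ts: "xs = map (coset V I) ts" "ts \<in> ?B" by blast
    then have "set ts \<subseteq> polys V" using pos_hom_polys by blast
    moreover have "set xs \<subseteq> coset V I ` {t. pos_hom V t}" using ts by auto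
    ultimately show "xs \<in> ?A" unfolding pos using ts regular_sequence_coset_iff[of ts] by blast
  qed
  then show ?thesis by (simp add: graded_depth_def image_image)
qed

end

section \<open>Krull dimension\<close>

text \<open>Leading monomials multiply. The variables carry no order, so an injection of
  \<open>V\<close> into the natural numbers transports exponents by the additive map \<Psi> to
  monomials that do have a compatible linear order.\<close>

lemma polys_no_zero_divisors:
  fixes p q :: "('v, 'k::field) mpoly"
  assumes fin: "finite V" and p: "p \<in> polys V" "p \<noteq> 0" and q: "q \<in> polys V" "q \<noteq> 0"
  shows "p * q \<noteq> 0"
proof -
  obtain g :: "'v \<Rightarrow> nat" where g: "inj_on g V" using finite_imp_inj_to_nat_seg[OF fin] by blast
  define \<Psi> :: "('v \<Rightarrow>\<^sub>0 nat) \<Rightarrow> (nat \<Rightarrow>\<^sub>0 nat)"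
    where "\<Psi> m = (\<Sum>v\<in>V. Poly_Mapping.single (g v) (lookup m v))" for m
  have add: "\<Psi> (m + n) = \<Psi> m + \<Psi> n" for m n
    by (simp add: \<Psi>_def lookup_add single_add sum.distrib)
  have look: "lookup (\<Psi> m) (g v) = lookup m v" if v: "v \<in> V" for m v
  proof -
    have "lookup (\<Psi> m) (g v) = (\<Sum>u\<in>V. if u = v then lookup m v else 0)"
      unfolding \<Psi>_def lookup_sum
      by (intro sum.cong) (use g v in \<open>auto simp: lookup_single when_def inj_on_def\<close>)
    then show ?thesis using fin v by simp
  qed
  have inj: "m = n" if "keys m \<subseteq> V" "keys n \<subseteq> V" "\<Psi> m = \<Psi> n" for m n
  proof (rule poly_mapping_eqI)
    fix v
    show "lookup m v = lookup n v"
    proof (cases "v \<in> V")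
      case True
      then show ?thesis using look that(3) by metis
    next
      case False
      then have "v \<notin> keys m" "v \<notin> keys n" using that by blast+
      then show ?thesis by (simp add: in_keys_iff)
    qed
  qed
  have max: "\<exists>m\<in>keys r. \<forall>n\<in>keys r. n \<noteq> m \<longrightarrow> \<Psi> n < \<Psi> m"
    if r: "r \<in> polys V" "r \<noteq> 0" for r :: "('v, 'k) mpoly"
  proof -
    have ne: "keys r \<noteq> {}" using r(2) by simp
    have "Max (\<Psi> ` keys r) \<in> \<Psi> ` keys r" using ne by (intro Max_in) auto
    then obtain m where m: "m \<in> keys r" "\<Psi> m = Max (\<Psi> ` keys r)" by fastforce
    have "\<Psi> n < \<Psi> m" if n: "n \<in> keys r" "n \<noteq> m" for n
    proof -
      have "\<Psi> n \<le> \<Psi> m" unfolding m(2) using n by (intro Max_ge) auto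
      moreover have "\<Psi> n \<noteq> \<Psi> m" using inj[of n m] n m(1) r(1) by (auto simp: polys_def)
      ultimately show ?thesis by simp
    qed
    then show ?thesis using m(1) by blast
  qed
  obtain m where m: "m \<in> keys p" "\<And>n. n \<in> keys p \<Longrightarrow> n \<noteq> m \<Longrightarrow> \<Psi> n < \<Psi> m" using max[OF p] by blast
  obtain l where l: "l \<in> keys q" "\<And>n. n \<in> keys q \<Longrightarrow> n \<noteq> l \<Longrightarrow> \<Psi> n < \<Psi> l" using max[OF q] by blast
  define p' where "p' = restrict_keys (\<lambda>n. n \<noteq> m) p"
  have psplit: "p = Poly_Mapping.single m (lookup p m) + p'"
    by (rule poly_mapping_eqI) (auto simp: p'_def lookup_add lookup_single when_def)
  have "m + l \<notin> keys (p' * q)"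
  proof
    assume "m + l \<in> keys (p' * q)"
    then obtain a b where ab: "a \<in> keys p'" "b \<in> keys q" "m + l = a + b" by (rule keys_multE)
    have "\<Psi> a < \<Psi> m" using m(2)[of a] ab(1) by (simp add: p'_def)
    moreover have "\<Psi> b \<le> \<Psi> l" using l(2)[OF ab(2)] by (cases "b = l") (auto intro: less_imp_le)
    ultimately have "\<Psi> a + \<Psi> b < \<Psi> m + \<Psi> l" by (rule add_less_le_mono)
    then show False using ab(3) add by (metis less_irrefl)
  qed
  moreover have "p * q = Poly_Mapping.single m (lookup p m) * q + p' * q"
    by (subst psplit) (rule distrib_right)
  ultimately have "lookup (p * q) (m + l) = lookup p m * lookup q l"
    by (simp add: lookup_add lookup_single_mult in_keys_iff)
  then show ?thesis using m(1) l(1) by (auto simp: in_keys_iff)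
qed

text \<open>The ideal generated by the variables of \<open>V\<close> outside \<open>F\<close>,
  described through its monomials.\<close>

definition face_prime :: "'v set \<Rightarrow> 'v set \<Rightarrow> ('v, 'k::field) mpoly set" where
  "face_prime V F = {p \<in> polys V. \<forall>m\<in>keys p. \<not> keys m \<subseteq> F}"

definition stanley_reisner :: "'v set \<Rightarrow> 'v set set \<Rightarrow> ('v, 'k::field) mpoly set" where
  "stanley_reisner V \<Delta> = {p \<in> polys V. \<forall>m\<in>keys p. keys m \<notin> \<Delta>}"

lemma poly_ideal_monomial:
  assumes "\<And>m n. P m \<Longrightarrow> P (m + n)"
  shows "poly_ideal V {p \<in> polys V. \<forall>m\<in>keys p. P m}"
  unfolding poly_ideal_def
proof (intro conjI ballI)
  fix a b :: "('a, 'b::field) mpoly"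
  assume "a \<in> {p \<in> polys V. \<forall>m\<in>keys p. P m}" "b \<in> {p \<in> polys V. \<forall>m\<in>keys p. P m}"
  then show "a + b \<in> {p \<in> polys V. \<forall>m\<in>keys p. P m}" using keys_add[of a b] by auto
next
  fix a s :: "('a, 'b::field) mpoly"
  assume a: "a \<in> {p \<in> polys V. \<forall>m\<in>keys p. P m}" and s: "s \<in> polys V"
  have "P m" if "m \<in> keys (s * a)" for m
  proof -
    from that obtain k l where "k \<in> keys s" "l \<in> keys a" "m = k + l" by (rule keys_multE)
    then show ?thesis using a assms[of l k] by (simp add: add.commute)
  qed
  then show "s * a \<in> {p \<in> polys V. \<forall>m\<in>keys p. P m}" using a s by simp
qed auto

lemma poly_ideal_face_prime: "poly_ideal V (face_prime V F)"
  unfolding face_prime_def by (rule poly_ideal_monomial) (auto simp: keys_add_nat)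

lemma poly_ideal_stanley_reisner:
  assumes "\<And>S T. S \<in> \<Delta> \<Longrightarrow> T \<subseteq> S \<Longrightarrow> T \<in> \<Delta>"
  shows "poly_ideal V (stanley_reisner V \<Delta>)"
  unfolding stanley_reisner_def
proof (rule poly_ideal_monomial)
  fix m n :: "'a \<Rightarrow>\<^sub>0 nat" assume "keys m \<notin> \<Delta>"
  then show "keys (m + n) \<notin> \<Delta>" using assms[of "keys (m + n)" "keys m"] by (auto simp: keys_add_nat)
qed

lemma graded_stanley_reisner: "graded_ideal (stanley_reisner V \<Delta>)"
  by (auto simp: graded_ideal_def stanley_reisner_def hom_comp_def)

text \<open>Modulo this ideal a polynomial equals its part in the variables of \<open>F\<close>, and
  such parts multiply without zero divisors.\<close>

lemma face_prime_prime:
  fixes p q :: "('v, 'k::field) mpoly"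
  assumes fin: "finite V" and p: "p \<in> polys V" and q: "q \<in> polys V" and pq: "p * q \<in> face_prime V F"
  shows "p \<in> face_prime V F \<or> q \<in> face_prime V F"
proof (rule ccontr)
  assume neg: "\<not> ?thesis"
  let ?r = "restrict_keys (\<lambda>m. keys m \<subseteq> F) :: ('v, 'k) mpoly \<Rightarrow> _"
  let ?s = "restrict_keys (\<lambda>m. \<not> keys m \<subseteq> F) :: ('v, 'k) mpoly \<Rightarrow> _"
  have nz: "?r x \<noteq> 0" if x: "x \<in> polys V" "x \<notin> face_prime V F" for x
  proof -
    obtain m where "m \<in> keys x" "keys m \<subseteq> F" using x by (auto simp: face_prime_def)
    then have "m \<in> keys (?r x)" by simp
    then show ?thesis by (metis empty_iff keys_zero)
  qed
  have "?r p * ?r q \<noteq> 0" using neg p q nz by (intro polys_no_zero_divisors[OF fin]) auto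
  then obtain m where m: "m \<in> keys (?r p * ?r q)" by fastforce
  then obtain a b where ab: "a \<in> keys (?r p)" "b \<in> keys (?r q)" "m = a + b" by (rule keys_multE)
  then have mF: "keys m \<subseteq> F" by (simp add: keys_add_nat)
  have sP: "?s x \<in> face_prime V F" if "x \<in> polys V" for x using that by (auto simp: face_prime_def)
  have pe: "p = ?r p + ?s p" and qe: "q = ?r q + ?s q" by (rule restrict_keys_split)+
  have "p * q - ?r p * ?r q = ?r p * ?s q + q * ?s p"
  proof -
    have "p * q = ?r p * q + ?s p * q" by (subst pe) (rule distrib_right)
    moreover have "?r p * q = ?r p * ?r q + ?r p * ?s q" by (subst (1) qe) (rule distrib_left)
    ultimately show ?thesis by (simp add: mult.commute)
  qed
  also have "\<dots> \<in> face_prime V F"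
    by (intro poly_ideal_add[of V] poly_ideal_mult[of V] poly_ideal_face_prime sP p q polys_restrict_keys)
  finally have "p * q - (p * q - ?r p * ?r q) \<in> face_prime V F"
    using poly_ideal_diff[OF poly_ideal_face_prime pq] by blast
  then have "?r p * ?r q \<in> face_prime V F" by simp
  then have "\<not> keys m \<subseteq> F" using m unfolding face_prime_def by blast
  then show False using mF by simp
qed

text \<open>By induction \<open>q\<close> avoids \<open>P (Suc 0)\<close>, which contains
  \<open>t * p\<close>; so \<open>q + t * p\<close> avoids \<open>P (Suc 0)\<close> and the smaller
  \<open>P 0\<close>. As \<open>t\<close> avoids \<open>P 0\<close> too, primality excludes
  \<open>t ^ a * (q + t * p)\<close>.\<close>

lemma leading_unit_notin_prime:
  fixes P :: "nat \<Rightarrow> ('v, 'k::field) mpoly set"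
  assumes "\<And>i. i \<le> length ts \<Longrightarrow> poly_ideal V (P i)" "\<And>i. i \<le> length ts \<Longrightarrow> 1 \<notin> P i"
    "\<And>i a b. i \<le> length ts \<Longrightarrow> a \<in> polys V \<Longrightarrow> b \<in> polys V \<Longrightarrow> a * b \<in> P i \<Longrightarrow> a \<in> P i \<or> b \<in> P i"
    "\<And>i. i < length ts \<Longrightarrow> P i \<subseteq> P (Suc i)"
    "\<And>i. i < length ts \<Longrightarrow> ts ! i \<in> P (Suc i)" "\<And>i. i < length ts \<Longrightarrow> ts ! i \<notin> P i"
    and "leading_unit V gr ts f"
  shows "f \<notin> P 0"
  using assms
proof (induction ts arbitrary: P f)
  case Nil
  then obtain c where c: "c \<noteq> 0" "f = const c" by auto
  show ?case
  proof
    assume "f \<in> P 0"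
    then have "const (inverse c) * f \<in> P 0" using Nil.prems(1)[of 0] by (intro poly_ideal_mult) auto
    also have "const (inverse c) * f = 1" using c by (simp add: mult_single)
    finally show False using Nil.prems(2)[of 0] by simp
  qed
next
  case (Cons t ts)
  have P: "poly_ideal V (P i)" if "i \<le> Suc (length ts)" for i using Cons.prems(1) that by simp
  obtain a n q p where f: "f = t ^ a * (q + t * p)" and p: "p \<in> polys V" and q: "leading_unit V gr ts q"
    using Cons.prems(7) by auto
  have t: "t \<in> P (Suc 0)" "t \<notin> P 0" using Cons.prems(5,6)[of 0] by auto
  have tP: "t \<in> polys V" using poly_ideal_polys[OF P t(1)] by simp
  have tsP: "set ts \<subseteq> polys V"
  proof
    fix x assume "x \<in> set ts"
    then obtain i where "i < length ts" "x = ts ! i" by (metis in_set_conv_nth)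
    then show "x \<in> polys V" using poly_ideal_polys[OF P, of "Suc (Suc i)" x] Cons.prems(5)[of "Suc i"] by simp
  qed
  then have qP: "q \<in> polys V" using q by (rule leading_unit_polys)
  have "q \<notin> P (Suc 0)"
  proof (rule Cons.IH[of "\<lambda>i. P (Suc i)", OF _ _ _ _ _ _ q])
    fix i
    show "poly_ideal V (P (Suc i))" "1 \<notin> P (Suc i)" if "i \<le> length ts"
      using that Cons.prems(1,2)[of "Suc i"] by simp_all
    show "a \<in> P (Suc i) \<or> b \<in> P (Suc i)"
      if "i \<le> length ts" "a \<in> polys V" "b \<in> polys V" "a * b \<in> P (Suc i)" for a b
      using that Cons.prems(3)[of "Suc i" a b] by simp
    show "P (Suc i) \<subseteq> P (Suc (Suc i))" "ts ! i \<in> P (Suc (Suc i))" "ts ! i \<notin> P (Suc i)" if "i < length ts"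
      using that Cons.prems(4,5,6)[of "Suc i"] by simp_all
  qed
  moreover have "t * p \<in> P (Suc 0)" using poly_ideal_mult2[OF P t(1) p] by simp
  ultimately have "q + t * p \<notin> P (Suc 0)"
    using poly_ideal_diff[OF P, of "Suc 0" "q + t * p" "t * p"] by auto
  then have g: "q + t * p \<notin> P 0" using Cons.prems(4)[of 0] by auto
  have "t ^ k * (q + t * p) \<notin> P 0" for k
  proof (induction k)
    case (Suc k)
    show ?case
      using Cons.prems(3)[of 0 t "t ^ k * (q + t * p)"] Suc t(2) tP qP p by (auto simp: mult.assoc)
  qed (use g in simp)
  then show ?case by (simp add: f)
qed

section \<open>The edge ideal and the Krull dimension of its quotient\<close>

context matched_graph
begin

abbreviation I :: "('v, 'k::field) mpoly set" where
  "I \<equiv> stanley_reisner V (Ind V E)"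

lemma poly_ideal_I: "poly_ideal V I"
  using Ind_subset by (rule poly_ideal_stanley_reisner)

lemma Var_mult_Var: "Var u * Var v = Poly_Mapping.single (Poly_Mapping.single u 1 + Poly_Mapping.single v 1) 1"
  by (simp add: Var_def mult_single)

lemma keys_single_add: "keys (Poly_Mapping.single u (Suc 0) + Poly_Mapping.single v (Suc 0)) = {u, v}"
  by (auto simp: keys_add_nat)

text \<open>A monomial whose support is not independent is divisible by the product of the two ends
  of an edge.\<close>

lemma edge_ideal_eq: "edge_ideal V E = (I :: ('v, 'k::field) mpoly set)"
proof
  let ?X = "{Var u * Var v | u v. {u, v} \<in> E} :: ('v, 'k) mpoly set"
  have X: "?X \<subseteq> I"
  proof
    fix x assume "x \<in> ?X"
    then obtain u v where uv: "{u, v} \<in> E" "x = Var u * Var v" by blast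
    have "{u, v} \<notin> Ind V E" using uv(1) by (auto simp: Ind_iff)
    then show "x \<in> I" using uv edgeD[OF uv(1)]
      by (simp add: stanley_reisner_def polys_def Var_mult_Var keys_single_add)
  qed
  show "edge_ideal V E \<subseteq> (I :: ('v, 'k) mpoly set)"
    unfolding edge_ideal_def by (rule genideal_poly_ring_minimal[OF poly_ideal_I X])
  have XP: "?X \<subseteq> polys V" using X by (auto simp: stanley_reisner_def)
  have J: "poly_ideal V (edge_ideal V E :: ('v, 'k) mpoly set)"
    unfolding edge_ideal_def by (rule genideal_poly_ring_ideal[OF XP])
  show "(I :: ('v, 'k) mpoly set) \<subseteq> edge_ideal V E"
  proof
    fix p :: "('v, 'k) mpoly" assume p: "p \<in> I"
    have "Poly_Mapping.single m (lookup p m) \<in> edge_ideal V E" if m: "m \<in> keys p" for m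
    proof -
      have mV: "keys m \<subseteq> V" and mI: "keys m \<notin> Ind V E" using p m by (auto simp: stanley_reisner_def polys_def)
      then obtain u v where uv: "u \<in> keys m" "v \<in> keys m" "{u, v} \<in> E" by (auto simp: Ind_iff)
      let ?s = "Poly_Mapping.single u (1::nat) + Poly_Mapping.single v 1"
      have "lookup m u > 0" "lookup m v > 0" using uv by (auto simp: in_keys_iff)
      \<comment> \<open>Both exponents are positive and \<open>u \<noteq> v\<close>, so truncated
        subtraction of \<open>?s\<close> loses nothing.\<close>
      then have ms: "m = (m - ?s) + ?s"
        using edgeD(3)[OF uv(3)] by (intro poly_mapping_eqI) (auto simp: lookup_add lookup_minus lookup_single when_def)
      have "(Var u * Var v :: ('v, 'k) mpoly) \<in> ?X" using uv(3) by blast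
      then have "(Var u * Var v :: ('v, 'k) mpoly) \<in> edge_ideal V E"
        unfolding edge_ideal_def by (rule subsetD[OF genideal_poly_ring_self])
      moreover have "Poly_Mapping.single (m - ?s) (lookup p m) \<in> polys V"
      proof -
        have "keys (m - ?s) \<subseteq> keys (m - ?s + ?s)" unfolding keys_add_nat by blast
        then have "keys (m - ?s) \<subseteq> V" unfolding ms[symmetric] using mV by blast
        then show ?thesis by (simp add: polys_def)
      qed
      ultimately have "Poly_Mapping.single (m - ?s) (lookup p m) * (Var u * Var v) \<in> edge_ideal V E"
        using poly_ideal_mult[OF J] by blast
      then have "Poly_Mapping.single (m - ?s + ?s) (lookup p m) \<in> edge_ideal V E"
        by (simp only: Var_mult_Var mult_single mult_1_right)
      then show ?thesis by (simp only: ms[symmetric])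
    qed
    then have "(\<Sum>m\<in>keys p. Poly_Mapping.single m (lookup p m)) \<in> edge_ideal V E"
      using poly_ideal_sum[OF J, of "keys p" "\<lambda>m. Poly_Mapping.single m (lookup p m)"] by blast
    then show "p \<in> edge_ideal V E" by (simp only: poly_mapping_sum_single[of p, symmetric])
  qed
qed

lemma Ind_small: "F \<in> Ind V E \<Longrightarrow> finite F \<and> card F \<le> d"
  using Ind_finite card_le by blast

text \<open>Removing the vertices of a facet one at a time makes the face primes grow strictly in
  \<open>d\<close> steps.\<close>

lemma krull_dim_ge: "enat d \<le> krull_dim (quot V (I :: ('v, 'k::field) mpoly set))"
proof -
  obtain F where F: "F \<in> facets (Ind V E)" using empty_Ind by (rule Ind_extend)
  have FI: "F \<in> Ind V E" using facet_Ind[OF F] .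
  obtain fs where fs: "set fs = F" "distinct fs" using finite_distinct_list[OF Ind_finite[OF FI]] by blast
  have len: "length fs = d" using card_facet[OF F] fs distinct_card by metis
  define P :: "nat \<Rightarrow> ('v, 'k) mpoly set" where "P i = face_prime V (set (drop i fs))" for i
  have IP: "I \<subseteq> P i" for i
  proof -
    have "T \<in> Ind V E" if "T \<subseteq> set (drop i fs)" for T
      using that fs(1) set_drop_subset[of i fs] Ind_subset[OF FI] by blast
    then show ?thesis unfolding P_def face_prime_def stanley_reisner_def by blast
  qed
  have PI: "poly_ideal V (P i)" for i unfolding P_def by (rule poly_ideal_face_prime)
  have prime: "primeideal (coset V I ` P i) (quot V I)" for i
  proof (rule primeidealI[OF ideal_image_coset[OF poly_ideal_I PI] cring_quot[OF poly_ideal_I]])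
    have "(1 :: ('v, 'k) mpoly) \<notin> P i" by (simp add: P_def face_prime_def)
    then have "coset V I 1 \<notin> coset V I ` P i" using coset_mem_image_iff[OF poly_ideal_I PI IP] by simp
    then show "carrier (quot V I) \<noteq> coset V I ` P i" using coset_simps(1)[OF poly_ideal_I, of 1] by auto
    fix x y assume "x \<in> carrier (quot V I)" "y \<in> carrier (quot V I)" and xy: "x \<otimes>\<^bsub>quot V I\<^esub> y \<in> coset V I ` P i"
    then obtain a b where ab: "a \<in> polys V" "x = coset V I a" "b \<in> polys V" "y = coset V I b"
      by (auto simp: carrier_quot[OF poly_ideal_I])
    then have "a * b \<in> P i" using xy coset_mem_image_iff[OF poly_ideal_I PI IP, of "a * b" i]
      by (simp add: coset_simps[OF poly_ideal_I])
    then have "a \<in> P i \<or> b \<in> P i" unfolding P_def using face_prime_prime[OF finV] ab by blast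
    then show "x \<in> coset V I ` P i \<or> y \<in> coset V I ` P i" using ab by blast
  qed
  have strict: "coset V I ` P i \<subset> coset V I ` P (Suc i)" if i: "i < d" for i
  proof -
    have drop: "drop i fs = fs ! i # drop (Suc i) fs" using i len by (simp add: Cons_nth_drop_Suc)
    then have sub: "P i \<subseteq> P (Suc i)" unfolding P_def face_prime_def by auto
    have "fs ! i \<notin> set (drop (Suc i) fs)" using fs(2) drop by (metis distinct.simps(2) distinct_drop)
    moreover have "fs ! i \<in> V" using i len fs(1) FI nth_mem[of i fs] by (auto simp: Ind_iff)
    ultimately have "(Var (fs ! i) :: ('v, 'k) mpoly) \<in> P (Suc i)" "(Var (fs ! i) :: ('v, 'k) mpoly) \<notin> P i"
      using drop by (auto simp: P_def face_prime_def Var_def polys_def)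
    moreover from this have "(Var (fs ! i) :: ('v, 'k) mpoly) \<in> polys V" using poly_ideal_polys[OF PI] by blast
    ultimately have "coset V I (Var (fs ! i)) \<in> coset V I ` P (Suc i) - coset V I ` P i"
      using coset_mem_image_iff[OF poly_ideal_I PI IP] by blast
    then show ?thesis using sub by blast
  qed
  have "prime_chain (quot V I) d (\<lambda>i. coset V I ` P i)"
    unfolding prime_chain_def using prime strict by blast
  then show ?thesis unfolding krull_dim_def by (intro SUP_upper) blast
qed

text \<open>Choosing \<open>t i\<close> in \<open>P (Suc i) - P i\<close> along \<open>d + 1\<close>
  inclusions gives enough elements for a leading unit inside \<open>I\<close>, hence inside
  \<open>P 0\<close>, where no leading unit can lie.\<close>

lemma prime_chain_le:
  assumes "prime_chain (quot V (I :: ('v, 'k::field) mpoly set)) n Q"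
  shows "n \<le> d"
proof (rule ccontr)
  assume "\<not> n \<le> d"
  then have n: "Suc d \<le> n" by simp
  have prime: "primeideal (Q i) (quot V I)" if "i \<le> n" for i using assms that by (simp add: prime_chain_def)
  have strict: "Q i \<subset> Q (Suc i)" if "i < n" for i using assms that by (simp add: prime_chain_def)
  have ideal: "ideal (Q i) (quot V I)" if "i \<le> n" for i using prime[OF that] by (rule primeideal.axioms)
  define P where "P i = {a \<in> polys V. coset V I a \<in> Q i}" for i
  have PI: "poly_ideal V (P i)" "I \<subseteq> P i" if "i \<le> n" for i
    unfolding P_def using poly_ideal_vimage_coset[OF poly_ideal_I ideal[OF that]] .
  have "\<exists>t. t \<in> P (Suc i) - P i" if i: "i < n" for i
  proof -
    obtain x where x: "x \<in> Q (Suc i)" "x \<notin> Q i" using strict[OF i] by blast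
    have "Q (Suc i) \<subseteq> carrier (quot V I)"
      using additive_subgroup.a_subset[OF ideal.axioms(1)[OF ideal]] i by simp
    then have "x \<in> coset V I ` polys V" using x carrier_quot[OF poly_ideal_I] by blast
    then show ?thesis using x unfolding P_def by blast
  qed
  then obtain t where t: "\<And>i. i < n \<Longrightarrow> t i \<in> P (Suc i) - P i" by metis
  define ts where "ts = map t [0..<Suc d]"
  have len: "length ts = Suc d" by (simp add: ts_def)
  have nth: "ts ! i = t i" if "i < Suc d" for i using that by (simp add: ts_def del: upt_Suc)
  have "set ts \<subseteq> polys V" using t n by (fastforce simp: ts_def P_def)
  then obtain f where f: "leading_unit V (\<lambda>_. polys V) ts f" "\<And>m. m \<in> keys f \<Longrightarrow> keys m \<notin> Ind V E"
    using exists_leading_unit[OF finite_Ind Ind_small, of ts V] len by auto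
  have "f \<in> polys V" using leading_unit_polys \<open>set ts \<subseteq> polys V\<close> f(1) by blast
  then have "f \<in> P 0" using f(2) PI(2)[of 0] by (auto simp: stanley_reisner_def)
  moreover have "f \<notin> P 0"
  proof (rule leading_unit_notin_prime[OF _ _ _ _ _ _ f(1)])
    fix i assume i: "i \<le> length ts"
    then have i': "i \<le> n" using len n by simp
    show "poly_ideal V (P i)" using PI(1)[OF i'] .
    show "1 \<notin> P i"
    proof
      assume "1 \<in> P i"
      then have "\<one>\<^bsub>quot V I\<^esub> \<in> Q i" by (simp add: P_def coset_simps(4)[OF poly_ideal_I])
      then have "Q i = carrier (quot V I)" using ideal.one_imp_carrier[OF ideal[OF i']] by blast
      then show False using primeideal.I_notcarr[OF prime[OF i']] by simp
    qed
    fix a b assume "a \<in> polys V" "b \<in> polys V" "a * b \<in> P i"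
    then show "a \<in> P i \<or> b \<in> P i"
      using primeideal.I_prime[OF prime[OF i'], of "coset V I a" "coset V I b"]
      by (simp add: P_def coset_simps[OF poly_ideal_I])
  next
    fix i assume i: "i < length ts"
    then have i': "i < n" "i < Suc d" using len n by auto
    show "P i \<subseteq> P (Suc i)" using strict[OF i'(1)] by (auto simp: P_def)
    show "ts ! i \<in> P (Suc i)" "ts ! i \<notin> P i" using t[OF i'(1)] nth[OF i'(2)] by auto
  qed
  ultimately show False by blast
qed

lemma krull_dim_eq: "krull_dim (quot V (I :: ('v, 'k::field) mpoly set)) = enat d"
proof (rule antisym[OF _ krull_dim_ge])
  show "krull_dim (quot V (I :: ('v, 'k) mpoly set)) \<le> enat d"
    unfolding krull_dim_def using prime_chain_le by (intro SUP_least) auto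
qed

end

section \<open>Depth\<close>

text \<open>The effect on monomials of substituting \<open>Var (h v)\<close> for
  \<open>Var v\<close>; exponents of variables with the same image add up.\<close>

definition push_monom :: "('v \<Rightarrow> 'v) \<Rightarrow> ('v \<Rightarrow>\<^sub>0 nat) \<Rightarrow> ('v \<Rightarrow>\<^sub>0 nat)" where
  "push_monom h n = (\<Sum>v\<in>keys n. Poly_Mapping.single (h v) (lookup n v))"

definition push_poly :: "('v \<Rightarrow> 'v) \<Rightarrow> ('v, 'k::field) mpoly \<Rightarrow> ('v, 'k) mpoly" where
  "push_poly h p = (\<Sum>n\<in>keys p. Poly_Mapping.single (push_monom h n) (lookup p n))"

lemma push_monom_add: "push_monom h (k + n) = push_monom h k + push_monom h n"
  unfolding push_monom_def by (rule setsum_keys_plus_distrib) (simp_all add: single_add)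

lemma push_monom_single [simp]: "push_monom h (Poly_Mapping.single v k) = Poly_Mapping.single (h v) k"
  by (simp add: push_monom_def)

lemma push_monom_0 [simp]: "push_monom h 0 = 0"
  by (simp add: push_monom_def)

lemma push_poly_add: "push_poly h (p + q) = push_poly h p + push_poly h q"
  unfolding push_poly_def by (rule setsum_keys_plus_distrib) (simp_all add: single_add)

lemma push_poly_single [simp]: "push_poly h (Poly_Mapping.single n c) = Poly_Mapping.single (push_monom h n) c"
  by (simp add: push_poly_def)

lemma push_poly_0 [simp]: "push_poly h 0 = 0"
  by (simp add: push_poly_def)

lemma push_poly_diff: "push_poly h (p - q) = push_poly h p - push_poly h q"
  using push_poly_add[of h "p - q" q] by simp

lemma push_poly_sum: "push_poly h (sum f I) = (\<Sum>i\<in>I. push_poly h (f i))"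
  by (induction I rule: infinite_finite_induct) (simp_all add: push_poly_add)

lemma push_poly_mult: "push_poly h (p * q) = push_poly h p * push_poly h q"
proof -
  have "p * q = (\<Sum>a\<in>keys p. Poly_Mapping.single a (lookup p a)) * (\<Sum>b\<in>keys q. Poly_Mapping.single b (lookup q b))"
    by (simp only: poly_mapping_sum_single[symmetric])
  also have "\<dots> = (\<Sum>a\<in>keys p. \<Sum>b\<in>keys q. Poly_Mapping.single (a + b) (lookup p a * lookup q b))"
    by (simp only: sum_product mult_single)
  finally have "push_poly h (p * q) =
      (\<Sum>a\<in>keys p. \<Sum>b\<in>keys q. Poly_Mapping.single (push_monom h a) (lookup p a) * Poly_Mapping.single (push_monom h b) (lookup q b))"
    by (simp only: push_poly_sum push_poly_single push_monom_add mult_single)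
  then show ?thesis by (simp only: push_poly_def[of h p] push_poly_def[of h q] sum_product)
qed

lemma push_poly_Var: "push_poly h (Var v) = Var (h v)"
  by (simp add: Var_def)

lemma keys_push_poly: "keys (push_poly h p) \<subseteq> push_monom h ` keys p"
proof
  fix k assume "k \<in> keys (push_poly h p)"
  then have "(\<Sum>n\<in>keys p. lookup (Poly_Mapping.single (push_monom h n) (lookup p n)) k) \<noteq> 0"
    by (simp add: push_poly_def in_keys_iff lookup_sum)
  then obtain n where "n \<in> keys p" "lookup (Poly_Mapping.single (push_monom h n) (lookup p n)) k \<noteq> 0"
    by (rule sum.not_neutral_contains_not_neutral)
  then show "k \<in> push_monom h ` keys p" by (auto simp: lookup_single when_def split: if_splits)
qed

lemma keys_push_monom: "keys (push_monom h n) = h ` keys n"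
proof -
  have "lookup (push_monom h n) k = (\<Sum>v\<in>keys n. if h v = k then lookup n v else 0)" for k
    by (simp add: push_monom_def lookup_sum lookup_single when_def)
  then have "k \<in> keys (push_monom h n) \<longleftrightarrow> (\<exists>v\<in>keys n. (if h v = k then lookup n v else 0) \<noteq> 0)" for k
    by (simp add: in_keys_iff)
  moreover have "(\<exists>v\<in>keys n. (if h v = k then lookup n v else 0) \<noteq> 0) \<longleftrightarrow> (\<exists>v\<in>keys n. h v = k)" for k
    by (intro bex_cong refl) (simp add: in_keys_iff)
  ultimately have "k \<in> keys (push_monom h n) \<longleftrightarrow> (\<exists>v\<in>keys n. h v = k)" for k by metis
  then show ?thesis unfolding set_eq_iff image_iff by metis
qed

lemma push_poly_polys:
  assumes "p \<in> polys V" "h ` V \<subseteq> V" shows "push_poly h p \<in> polys V"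
proof -
  have "keys k \<subseteq> V" if k: "k \<in> keys (push_poly h p)" for k
  proof -
    obtain n where "n \<in> keys p" "k = push_monom h n" using k keys_push_poly by blast
    then show ?thesis using assms by (auto simp: keys_push_monom polys_def)
  qed
  then show ?thesis by (simp add: polys_def)
qed

lemma monom_remove_var:
  fixes n :: "'v \<Rightarrow>\<^sub>0 nat"
  assumes "0 < lookup n v"
  shows "n = Poly_Mapping.single v 1 + (n - Poly_Mapping.single v 1)"
  using assms by (intro poly_mapping_eqI) (auto simp: lookup_add lookup_minus lookup_single when_def)

lemma lookup_Var_mult: "lookup (Var v * p) n = (if 0 < lookup n v then lookup p (n - Poly_Mapping.single v 1) else 0)"
proof (cases "0 < lookup n v")
  case True
  have "lookup (Var v * p) (Poly_Mapping.single v 1 + (n - Poly_Mapping.single v 1)) = lookup p (n - Poly_Mapping.single v 1)"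
    unfolding Var_def lookup_single_mult by simp
  then show ?thesis using True by (simp only: monom_remove_var[OF True, symmetric] if_True)
next
  case False
  then have "n \<noteq> Poly_Mapping.single v 1 + k" for k by (auto simp: lookup_add)
  then show ?thesis using False by (simp add: Var_def lookup_single_mult_0)
qed

lemma Var_hom_polys: "v \<in> V \<Longrightarrow> Var v \<in> hom_polys V 1"
  by (simp add: hom_polys_iff) (simp add: Var_def monom_deg_def)

section \<open>Upper bound for the depth, and a regular sequence from a facet\<close>

context matched_graph
begin

lemma one_notin_I: "1 \<notin> I"
  by (simp add: stanley_reisner_def empty_Ind)

lemma reg_seq_length_le:
  fixes ts :: "('v, 'k::field) mpoly list"
  assumes "reg_seq V I ts" "\<And>t. t \<in> set ts \<Longrightarrow> pos_hom V t"
  shows "length ts \<le> d"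
proof (rule ccontr)
  assume "\<not> length ts \<le> d"
  then have "d < length ts" by simp
  then obtain f n where f: "leading_unit V (hom_polys V) ts f" "f \<in> hom_polys V n"
    "\<And>m. m \<in> keys f \<Longrightarrow> keys m \<notin> Ind V E"
    using exists_homogeneous_leading_unit[OF finite_Ind Ind_small _ assms(2)] by metis
  have "regular_mod V I f"
    using leading_unit_regular[OF poly_ideal_I graded_stanley_reisner assms(2,1) f(1)] by blast
  moreover have "f \<in> I" using f(2,3) by (simp add: stanley_reisner_def)
  ultimately have "(1 :: ('v, 'k) mpoly) \<in> I" using regular_modD[of V I f 1] by simp
  then show False using one_notin_I by blast
qed

text \<open>For independent \<open>A\<close> this sends \<open>m x\<close> to \<open>x\<close> for
  each \<open>x \<in> A\<close> and fixes the other vertices of \<open>V\<close>.\<close>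

definition proj :: "'v set \<Rightarrow> 'v \<Rightarrow> 'v" where
  "proj A v = (if m v \<in> A then m v else v)"

text \<open>Modulo the binomials \<open>Var x - Var (m x)\<close>, \<open>x \<in> A\<close>, the edge ideal becomes the monomial ideal
  with generators \<open>Var (proj A u) * Var (proj A v)\<close>, which are squares for \<open>v = m u\<close>.\<close>

definition divisible :: "'v set \<Rightarrow> ('v \<Rightarrow>\<^sub>0 nat) \<Rightarrow> bool" where
  "divisible A n \<longleftrightarrow> (\<exists>u v. {u, v} \<in> E \<and> proj A u \<in> keys n \<and> proj A v \<in> keys n \<and>
     (proj A u = proj A v \<longrightarrow> 2 \<le> lookup n (proj A u)))"

abbreviation contracted :: "'v set \<Rightarrow> ('v, 'k::field) mpoly set" where
  "contracted A \<equiv> {p \<in> polys V. \<forall>n\<in>keys p. divisible A n}"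

lemma divisible_add: "divisible A n \<Longrightarrow> divisible A (n + k)"
  unfolding divisible_def by (fastforce simp: keys_add_nat lookup_add)

lemma divisible_iff: "divisible A n \<longleftrightarrow>
  (\<exists>u v k. {u, v} \<in> E \<and> n = Poly_Mapping.single (proj A u) 1 + Poly_Mapping.single (proj A v) 1 + k)"
proof
  assume "divisible A n"
  then obtain u v where uv: "{u, v} \<in> E" "proj A u \<in> keys n" "proj A v \<in> keys n"
    "proj A u = proj A v \<longrightarrow> 2 \<le> lookup n (proj A u)" by (auto simp: divisible_def)
  then have "n = Poly_Mapping.single (proj A u) 1 + Poly_Mapping.single (proj A v) 1 +
      (n - (Poly_Mapping.single (proj A u) 1 + Poly_Mapping.single (proj A v) 1))"
    by (intro poly_mapping_eqI) (auto simp: lookup_add lookup_minus lookup_single when_def in_keys_iff)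
  then show "\<exists>u v k. {u, v} \<in> E \<and> n = Poly_Mapping.single (proj A u) 1 + Poly_Mapping.single (proj A v) 1 + k"
    using uv(1) by blast
next
  assume "\<exists>u v k. {u, v} \<in> E \<and> n = Poly_Mapping.single (proj A u) 1 + Poly_Mapping.single (proj A v) 1 + k"
  then obtain u v k where uv: "{u, v} \<in> E"
    "n = Poly_Mapping.single (proj A u) 1 + Poly_Mapping.single (proj A v) 1 + k" by blast
  then show "divisible A n"
    unfolding divisible_def by (intro exI[of _ u] exI[of _ v]) (auto simp: in_keys_iff lookup_add lookup_single when_def)
qed

lemma poly_ideal_contracted: "poly_ideal V (contracted A)"
  by (rule poly_ideal_monomial) (rule divisible_add)

lemma contracted_empty: "contracted {} = I"
proof -
  have "divisible {} n \<longleftrightarrow> keys n \<notin> Ind V E" if "keys n \<subseteq> V" for n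
  proof -
    have "proj {} u = u" for u by (simp add: proj_def)
    then have "divisible {} n \<longleftrightarrow> (\<exists>u v. {u, v} \<in> E \<and> u \<in> keys n \<and> v \<in> keys n)"
      unfolding divisible_def using edgeD(3) by metis
    then show ?thesis using that unfolding Ind_iff by blast
  qed
  then show ?thesis by (auto simp: stanley_reisner_def polys_def)
qed

text \<open>Let \<open>n\<close> be a monomial of \<open>p\<close>. If it contains both
  \<open>x\<close> and \<open>m x\<close>, the matching edge divides it. If it contains one of them,
  multiplying by that one again yields nothing new, as its square is not a generator. If it contains
  neither, generators through \<open>x\<close> and through \<open>m x\<close> combine by
  \<open>edge_across\<close>, and \<open>gen\<close> keeps the result from being a square, so it
  divides \<open>n\<close> itself.\<close>

lemma regular_mod_contracted:
  fixes A :: "'v set"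
  assumes x: "x \<in> V" "x \<notin> A" "m x \<notin> A"
    and gen: "\<And>v w. {v, x} \<in> E \<Longrightarrow> {w, m x} \<in> E \<Longrightarrow> v \<noteq> m x \<Longrightarrow> proj A v \<noteq> proj A w"
  shows "regular_mod V (contracted A) (Var x - Var (m x) :: ('v, 'k::field) mpoly)"
  unfolding regular_mod_def
proof (intro ballI impI)
  let ?y = "m x"
  have y: "?y \<in> V" "?y \<noteq> x" "m ?y = x" using x matching by auto
  have proj_xy: "proj A x = x" "proj A ?y = ?y" using x y by (auto simp: proj_def)
  \<comment> \<open>Only members of \<open>A\<close> can have a second preimage under
    \<open>proj A\<close>.\<close>
  have proj_eq: "u = z" if "proj A u = z" "z \<notin> A" for u z
    using that by (auto simp: proj_def split: if_splits)
  have both: "divisible A n" if "x \<in> keys n" "?y \<in> keys n" for n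
    unfolding divisible_def using that matching(1)[OF x(1)] proj_xy y(2) by (intro exI[of _ x] exI[of _ ?y]) auto
  have edge: "\<exists>v. {v, z} \<in> E \<and> proj A v \<in> keys n"
    if z: "z \<notin> A" and nd: "\<not> divisible A n" and dv: "divisible A (n + Poly_Mapping.single z 1)" for z n
  proof -
    obtain u v where uv: "{u, v} \<in> E" "proj A u \<in> insert z (keys n)" "proj A v \<in> insert z (keys n)"
      "proj A u = proj A v \<longrightarrow> 2 \<le> lookup (n + Poly_Mapping.single z 1) (proj A u)"
      using dv unfolding divisible_def by (auto simp: keys_add_nat)
    have "u \<noteq> v" using edgeD(3) uv(1) by blast
    show ?thesis
    proof (cases "proj A u = z \<or> proj A v = z")
      case False
      then have "divisible A n" unfolding divisible_def using uv
        by (intro exI[of _ u] exI[of _ v]) (auto simp: lookup_add lookup_single when_def)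
      then show ?thesis using nd by blast
    next
      case True
      then show ?thesis
      proof
        assume "proj A u = z"
        moreover from this have "u = z" using proj_eq z by blast
        ultimately show ?thesis using uv proj_eq[of v z] z \<open>u \<noteq> v\<close> by (metis insertE insert_commute)
      next
        assume "proj A v = z"
        moreover from this have "v = z" using proj_eq z by blast
        ultimately show ?thesis using uv proj_eq[of u z] z \<open>u \<noteq> v\<close> by (metis insertE)
      qed
    qed
  qed
  have square: "divisible A n"
    if z: "z \<notin> A" "z \<in> keys n" and dv: "divisible A (n + Poly_Mapping.single z 1)" for z n
  proof -
    obtain u v where uv: "{u, v} \<in> E" "proj A u \<in> keys n" "proj A v \<in> keys n"
      "proj A u = proj A v \<longrightarrow> 2 \<le> lookup (n + Poly_Mapping.single z 1) (proj A u)"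
      using dv z(2) unfolding divisible_def by (auto simp: keys_add_nat)
    have "proj A u = proj A v \<longrightarrow> proj A u \<noteq> z" using proj_eq z(1) edgeD(3)[OF uv(1)] by metis
    then show ?thesis unfolding divisible_def using uv
      by (intro exI[of _ u] exI[of _ v]) (auto simp: lookup_add lookup_single when_def)
  qed
  have cross: "divisible A n"
    if n: "x \<notin> keys n" "?y \<notin> keys n" "divisible A (n + Poly_Mapping.single x 1)" "divisible A (n + Poly_Mapping.single ?y 1)" for n
  proof (rule ccontr)
    assume nd: "\<not> divisible A n"
    obtain v where v: "{v, x} \<in> E" "proj A v \<in> keys n" using edge[OF x(2) nd n(3)] by blast
    obtain w where w: "{w, ?y} \<in> E" "proj A w \<in> keys n" using edge[OF x(3) nd n(4)] by blast
    have "{v, w} \<in> E" using edge_across[OF v(1) w(1)] .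
    moreover have "v \<noteq> ?y" using v(2) n(2) proj_xy by auto
    then have "proj A v \<noteq> proj A w" using gen[OF v(1) w(1)] by blast
    ultimately have "divisible A n" unfolding divisible_def using v w by blast
    then show False using nd by blast
  qed
  fix p :: "('v, 'k) mpoly"
  assume p: "p \<in> polys V" and mem: "(Var x - Var ?y) * p \<in> contracted A"
  have coeff: "lookup ((Var x - Var ?y) * p) n =
      (if 0 < lookup n x then lookup p (n - Poly_Mapping.single x 1) else 0) -
      (if 0 < lookup n ?y then lookup p (n - Poly_Mapping.single ?y 1) else 0)" for n
    by (simp only: left_diff_distrib lookup_minus lookup_Var_mult)
  have div: "divisible A n" if "lookup ((Var x - Var ?y) * p) n \<noteq> 0" for n
    using mem that by (auto simp: in_keys_iff)
  have "divisible A n" if n: "n \<in> keys p" for n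
  proof (rule ccontr)
    assume nd: "\<not> divisible A n"
    have np: "lookup p n \<noteq> 0" using n by (simp add: in_keys_iff)
    \<comment> \<open>Without \<open>?y\<close> in \<open>n\<close>, nothing cancels: the
      coefficient of the product at \<open>n + Poly_Mapping.single x 1\<close> is
      \<open>lookup p n\<close>.\<close>
    have dx: "divisible A (n + Poly_Mapping.single x 1)" if "?y \<notin> keys n"
      using that y(2) np by (intro div) (auto simp: coeff lookup_add lookup_single when_def in_keys_iff)
    have dy: "divisible A (n + Poly_Mapping.single ?y 1)" if "x \<notin> keys n"
      using that y(2) np by (intro div) (auto simp: coeff lookup_add lookup_single when_def in_keys_iff)
    consider "x \<in> keys n" "?y \<in> keys n" | "x \<in> keys n" "?y \<notin> keys n" | "x \<notin> keys n" "?y \<in> keys n"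
      | "x \<notin> keys n" "?y \<notin> keys n" by blast
    then show False
    proof cases
      case 1 then show ?thesis using both nd by blast
    next
      case 2 then show ?thesis using square[OF x(2) _ dx] nd by blast
    next
      case 3 then show ?thesis using square[OF x(3) _ dy] nd by blast
    next
      case 4 then show ?thesis using cross[OF _ _ dx dy] nd by blast
    qed
  qed
  then show "p \<in> contracted A" using p by blast
qed

lemma proj_in: "A \<subseteq> V \<Longrightarrow> proj A ` V \<subseteq> V"
  by (auto simp: proj_def)

text \<open>The preimage of the monomial ideal under the substitution is an ideal containing
  \<open>I\<close> and the binomials. Conversely, each polynomial is congruent to its image modulo
  the binomials, and each monomial generator is congruent to the product of the ends of an
  edge.\<close>

lemma adjoins_iff_contracted:
  fixes fs :: "'v list" and a :: "('v, 'k::field) mpoly"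
  assumes fs: "set fs \<in> Ind V E" and a: "a \<in> polys V"
  defines "ts \<equiv> map (\<lambda>x. Var x - Var (m x)) fs :: ('v, 'k) mpoly list"
  shows "a \<in> adjoins V I ts \<longleftrightarrow> push_poly (proj (set fs)) a \<in> contracted (set fs)"
proof
  let ?A = "set fs" and ?J = "adjoins V I ts"
  let ?h = "proj ?A"
  let ?M = "contracted ?A :: ('v, 'k) mpoly set"
  have AV: "?A \<subseteq> V" using fs by (simp add: Ind_iff)
  have mA: "m x \<notin> ?A" if "x \<in> ?A" for x
    using fs matching(1)[of x] that AV by (auto simp: Ind_iff)
  have h: "?h x = x" "?h (m x) = x" if "x \<in> ?A" for x
    using mA[OF that] that AV matching(2)[of x] by (auto simp: proj_def)
  have hV: "?h v \<in> V" if "v \<in> V" for v using proj_in[OF AV] that by blast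
  have tsP: "set ts \<subseteq> polys V" using AV by (auto simp: ts_def)
  have J: "poly_ideal V ?J" by (rule adjoins_ideal[OF poly_ideal_I])
  have sub: "I \<union> set ts \<subseteq> ?J" by (rule adjoins_superset[OF poly_ideal_I tsP])
  {
    let ?K = "{b \<in> polys V. push_poly ?h b \<in> ?M}"
    have M: "poly_ideal V ?M" by (rule poly_ideal_contracted)
    have K: "poly_ideal V ?K"
      unfolding poly_ideal_def
    proof (intro conjI ballI)
      show "0 \<in> ?K" by simp
      show "b + c \<in> ?K" if "b \<in> ?K" "c \<in> ?K" for b c
        using that poly_ideal_add[OF M, of "push_poly ?h b" "push_poly ?h c"] by (simp add: push_poly_add)
      show "s * b \<in> ?K" if "b \<in> ?K" "s \<in> polys V" for b s
        using that poly_ideal_mult[OF M, of "push_poly ?h b" "push_poly ?h s"] push_poly_polys[OF that(2) proj_in[OF AV]]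
        by (simp add: push_poly_mult)
    qed blast
    have "b \<in> ?K" if b: "b \<in> I" for b
    proof -
      have "divisible ?A k" if k: "k \<in> keys (push_poly ?h b)" for k
      proof -
        obtain n where n: "n \<in> keys b" "k = push_monom ?h n" using k keys_push_poly by blast
        then have "n \<in> keys b" "b \<in> (contracted {} :: ('v, 'k) mpoly set)" using b contracted_empty by auto
        then have "divisible {} n" by blast
        then obtain u v l where uv: "{u, v} \<in> E" "n = Poly_Mapping.single u 1 + Poly_Mapping.single v 1 + l"
          unfolding divisible_iff by (auto simp: proj_def)
        then have "k = Poly_Mapping.single (?h u) 1 + Poly_Mapping.single (?h v) 1 + push_monom ?h l"
          using n(2) by (simp add: push_monom_add)
        then show ?thesis unfolding divisible_iff using uv(1) by blast
      qed
      moreover have bP: "b \<in> polys V" using b by (simp add: stanley_reisner_def)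
      ultimately show ?thesis using push_poly_polys[OF bP proj_in[OF AV]] by blast
    qed
    moreover have "t \<in> ?K" if t: "t \<in> set ts" for t
    proof -
      obtain x where x: "x \<in> ?A" "t = Var x - Var (m x)" using t by (auto simp: ts_def)
      then have "push_poly ?h t = 0" using h[OF x(1)] by (simp add: push_poly_diff push_poly_Var)
      then show ?thesis using t tsP by auto
    qed
    ultimately have "?J \<subseteq> ?K" by (intro adjoins_minimal[OF K]) blast+
    moreover assume "a \<in> ?J"
    ultimately show "push_poly ?h a \<in> ?M" by blast
  }
  have var: "Var v - Var (?h v) \<in> ?J" if v: "v \<in> V" for v
  proof (cases "m v \<in> ?A")
    case True
    then have "Var (m v) - Var (m (m v)) \<in> ?J" using sub by (auto simp: ts_def)
    then have "- (Var (m v) - Var (m (m v))) \<in> ?J" by (rule poly_ideal_uminus[OF J])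
    then show ?thesis using True v matching(2) by (simp add: proj_def)
  next
    case False
    then show ?thesis using poly_ideal_0[OF J] by (simp add: proj_def)
  qed
  have monom: "Poly_Mapping.single n 1 - Poly_Mapping.single (push_monom ?h n) 1 \<in> ?J" if "keys n \<subseteq> V" for n
    using that
  proof (induction "monom_deg n" arbitrary: n rule: less_induct)
    case less
    show ?case
    proof (cases "n = 0")
      case True
      then show ?thesis using poly_ideal_0[OF J] by simp
    next
      case False
      then have "keys n \<noteq> {}" by simp
      then obtain v where v: "v \<in> keys n" by blast
      define k where "k = n - Poly_Mapping.single v 1"
      have n: "n = Poly_Mapping.single v 1 + k"
        unfolding k_def using v by (intro monom_remove_var) (simp add: in_keys_iff)
      have kV: "keys k \<subseteq> V" "v \<in> V" using less.prems v unfolding n keys_add_nat by auto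
      have "monom_deg (Poly_Mapping.single v (1::nat)) = 1" by (simp add: monom_deg_def)
      then have "monom_deg k < monom_deg n" using n monom_deg_add by (metis less_add_same_cancel2 zero_less_one)
      then have IH: "Poly_Mapping.single k 1 - Poly_Mapping.single (push_monom ?h k) 1 \<in> ?J" using less.hyps kV(1) by blast
      let ?k = "Poly_Mapping.single k 1 :: ('v, 'k) mpoly"
        and ?k' = "Poly_Mapping.single (push_monom ?h k) 1 :: ('v, 'k) mpoly"
      have kP: "?k \<in> polys V" using kV(1) by (simp add: polys_def)
      have "(Var v - Var (?h v)) * ?k + Var (?h v) * (?k - ?k') \<in> ?J"
        using poly_ideal_add[OF J poly_ideal_mult2[OF J var[OF kV(2)] kP] poly_ideal_mult[OF J IH]] hV[OF kV(2)] by simp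
      moreover have "Poly_Mapping.single n 1 = Var v * ?k" by (simp add: n Var_def mult_single)
      moreover have "Poly_Mapping.single (push_monom ?h n) 1 = Var (?h v) * ?k'"
        by (simp add: n Var_def mult_single push_monom_add)
      ultimately show ?thesis by (simp add: algebra_simps)
    qed
  qed
  have "Poly_Mapping.single n c - Poly_Mapping.single (push_monom ?h n) c \<in> ?J" if "keys n \<subseteq> V" for n and c :: 'k
    using poly_ideal_mult[OF J monom[OF that], of "const c"] by (simp add: mult_single algebra_simps)
  then have "(\<Sum>n\<in>keys a. Poly_Mapping.single n (lookup a n) - Poly_Mapping.single (push_monom ?h n) (lookup a n)) \<in> ?J"
    using a by (intro poly_ideal_sum[OF J]) (auto simp: polys_def)
  then have cong: "a - push_poly ?h a \<in> ?J"
    by (simp only: sum_subtractf poly_mapping_sum_single[of a, symmetric] push_poly_def[symmetric])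
  assume mem: "push_poly ?h a \<in> ?M"
  have "Poly_Mapping.single n c \<in> ?J" if n: "n \<in> keys (push_poly ?h a)" for n and c :: 'k
  proof -
    have nV: "keys n \<subseteq> V" using mem n by (auto simp: polys_def)
    obtain u v k where uv: "{u, v} \<in> E" "n = Poly_Mapping.single (?h u) 1 + Poly_Mapping.single (?h v) 1 + k"
      using mem n unfolding divisible_iff by blast
    have V: "u \<in> V" "v \<in> V" using uv(1) edgeD by blast+
    have kP: "Poly_Mapping.single k c \<in> polys V" using nV unfolding uv(2) keys_add_nat by (auto simp: polys_def)
    have "{u, v} \<notin> Ind V E" using uv(1) by (auto simp: Ind_iff)
    then have "(Var u * Var v :: ('v, 'k) mpoly) \<in> I"
      using V by (simp add: stanley_reisner_def polys_def Var_mult_Var keys_single_add)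
    then have e: "(Var u * Var v :: ('v, 'k) mpoly) \<in> ?J" using sub by blast
    have "Var u * Var v - (Var u - Var (?h u)) * Var v - Var (?h u) * (Var v - Var (?h v)) \<in> ?J"
      using e V hV poly_ideal_diff[OF J] poly_ideal_mult[OF J var] poly_ideal_mult2[OF J var] by simp
    then have "Var (?h u) * Var (?h v) \<in> ?J" by (simp add: algebra_simps)
    then have "Var (?h u) * Var (?h v) * Poly_Mapping.single k c \<in> ?J" using poly_ideal_mult2[OF J _ kP] by blast
    then show ?thesis unfolding uv(2) Var_mult_Var mult_single by simp
  qed
  then have "(\<Sum>n\<in>keys (push_poly ?h a). Poly_Mapping.single n (lookup (push_poly ?h a) n)) \<in> ?J"
    by (intro poly_ideal_sum[OF J])
  then have "push_poly ?h a \<in> ?J" by (simp only: poly_mapping_sum_single[symmetric])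
  then show "a \<in> ?J" using poly_ideal_cong[OF J cong] by blast
qed

lemma exists_regular_sequence:
  assumes good: no_parallel_edges
  obtains ts :: "('v, 'k::field) mpoly list"
  where "reg_seq V I ts" "1 \<notin> adjoins V I ts" "\<forall>t\<in>set ts. pos_hom V t" "length ts = d"
proof -
  obtain F where F: "F \<in> facets (Ind V E)" using empty_Ind by (rule Ind_extend)
  have FI: "F \<in> Ind V E" using facet_Ind[OF F] .
  then have FV: "F \<subseteq> V" by (simp add: Ind_iff)
  obtain fs where fs: "set fs = F" "distinct fs" using finite_distinct_list[OF Ind_finite[OF FI]] by blast
  have len: "length fs = d" using card_facet[OF F] fs distinct_card by metis
  define ts where "ts = map (\<lambda>x. Var x - Var (m x) :: ('v, 'k) mpoly) fs"
  have sub: "set (take i fs) \<in> Ind V E" for i using Ind_subset[OF FI] fs(1) set_take_subset by metis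
  have take: "take i ts = map (\<lambda>x. Var x - Var (m x)) (take i fs)" for i by (simp add: ts_def take_map)
  have mem: "a \<in> adjoins V I (take i ts) \<longleftrightarrow> push_poly (proj (set (take i fs))) a \<in> contracted (set (take i fs))"
    if "a \<in> polys V" for a :: "('v, 'k) mpoly" and i
    unfolding take using adjoins_iff_contracted[OF sub that] .
  have "regular_mod V (adjoins V I (take i ts)) (ts ! i)" if i: "i < length ts" for i
  proof -
    let ?A = "set (take i fs)"
    let ?h = "push_poly (proj ?A) :: ('v, 'k) mpoly \<Rightarrow> _"
    define x where "x = fs ! i"
    have i': "i < length fs" using i by (simp add: ts_def)
    have x: "x \<in> F" "x \<in> V" using i' fs(1) FV nth_mem by (auto simp: x_def)
    have mx: "m x \<notin> F" using facet_matching[OF F x(2)] x(1) by blast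
    have AF: "?A \<subseteq> F" using fs(1) set_take_subset[of i fs] by simp
    have "fs = take i fs @ x # drop (Suc i) fs" unfolding x_def using i' by (rule id_take_nth_drop)
    then have xA: "x \<notin> ?A" using fs(2) by (metis distinct_append disjoint_iff list.set_intros(1))
    have mxA: "m x \<notin> ?A" using mx AF by blast
    have t: "ts ! i = Var x - Var (m x)" using i' by (simp add: ts_def x_def)
    have pt: "?h (Var x - Var (m x)) = Var x - Var (m x)"
      using xA mxA x(2) matching(2)[of x] by (simp add: push_poly_diff push_poly_Var proj_def)
    \<comment> \<open>Distinct \<open>v\<close> and \<open>w\<close> are merged only if
      \<open>w = m v\<close>, and then \<open>{v, x}\<close> and \<open>{m v, m x}\<close> are
      parallel edges.\<close>
    have gen: "proj ?A v \<noteq> proj ?A w" if vw: "{v, x} \<in> E" "{w, m x} \<in> E" "v \<noteq> m x" for v w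
    proof
      assume eq: "proj ?A v = proj ?A w"
      have V: "v \<in> V" "w \<in> V" using vw edgeD by blast+
      have "v \<noteq> w" using edge_across[OF vw(1,2)] edgeD(3) by blast
      then have "w = m v" using eq V matching(2) inj_onD[OF inj_matching _ V] unfolding proj_def by (metis (full_types))
      then have "{m v, m x} \<in> E" using vw(2) by simp
      then have "x = m v" using good vw(1) unfolding no_parallel_edges_def by blast
      then show False using vw(3) V matching(2) by simp
    qed
    have reg: "regular_mod V (contracted ?A) (Var x - Var (m x) :: ('v, 'k) mpoly)"
      using regular_mod_contracted[OF x(2) xA mxA gen] .
    have AV: "?A \<subseteq> V" using AF FV by blast
    show ?thesis
      unfolding regular_mod_def t
    proof (intro ballI impI)
      fix a :: "('v, 'k) mpoly" assume a: "a \<in> polys V" "(Var x - Var (m x)) * a \<in> adjoins V I (take i ts)"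
      have "(Var x - Var (m x)) * a \<in> polys V" using a(1) x(2) by simp
      then have "?h ((Var x - Var (m x)) * a) \<in> contracted ?A" using mem a(2) by blast
      then have "(Var x - Var (m x)) * ?h a \<in> contracted ?A" by (simp only: push_poly_mult pt)
      then have "?h a \<in> contracted ?A" by (rule regular_modD[OF reg push_poly_polys[OF a(1) proj_in[OF AV]]])
      then show "a \<in> adjoins V I (take i ts)" using mem a(1) by blast
    qed
  qed
  then have "reg_seq V I ts" by (simp add: reg_seq_iff_nth)
  moreover have "1 \<notin> adjoins V I ts"
  proof -
    have "push_poly h (1 :: ('v, 'k) mpoly) = 1" for h using push_poly_single[of h 0 1] by simp
    moreover have "(1 :: ('v, 'k) mpoly) \<notin> contracted A" for A by (simp add: divisible_def)
    ultimately show ?thesis using mem[of 1 "length ts"] by simp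
  qed
  moreover have "pos_hom V t" if t: "t \<in> set ts" for t
  proof -
    obtain x where x: "x \<in> F" "t = Var x - Var (m x)" using t fs(1) by (auto simp: ts_def)
    then have "x \<in> V" using FV by blast
    then have "t \<in> hom_polys V 1" unfolding x(2) by (intro hom_polys_diff Var_hom_polys) auto
    then show ?thesis unfolding pos_hom_def by (intro exI[of _ 1]) auto
  qed
  moreover have "length ts = d" using len by (simp add: ts_def)
  ultimately show thesis using that by blast
qed

section \<open>The connectedness argument for parallel edges\<close>

text \<open>No localisation is formed: a denominator of \<open>Var u / x\<close> is a
  \<open>q\<close> with \<open>q * Var u \<in> adjoin V I x\<close>. For the denominator
  \<open>f\<close>, with \<open>f * Var u = x * b\<close> modulo \<open>I\<close>,
  \<open>leading_unit_divides\<close> makes \<open>b\<close> a multiple of \<open>f\<close>; the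
  fraction would then be represented by a polynomial \<open>h\<close>, which linear coefficients
  refute.\<close>

lemma parallel_edges_length_neq:
  fixes ts :: "('v, 'k::field) mpoly list"
  assumes uv: "{u, v} \<in> E" "{m u, m v} \<in> E" "v \<noteq> m u"
    and reg: "reg_seq V I ts" and pos: "\<And>t. t \<in> set ts \<Longrightarrow> pos_hom V t"
  shows "length ts \<noteq> d"
proof
  assume len: "length ts = d"
  note J = poly_ideal_I graded_stanley_reisner
  have V: "u \<in> V" "v \<in> V" "m u \<in> V" "m v \<in> V" using uv(1) edgeD matching_in by blast+
  define x :: "('v, 'k) mpoly" where "x = Var u - Var (m u)"
  have xh: "x \<in> hom_polys V 1" unfolding x_def using V by (intro hom_polys_diff Var_hom_polys)
  have xP: "x \<in> polys V" using xh by simp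
  \<comment> \<open>With nothing contracted, regularity only asks that \<open>u\<close> and
    \<open>m u\<close> have no common neighbour.\<close>
  have xreg: "regular_mod V I x"
  proof -
    have "regular_mod V (contracted {}) x"
      unfolding x_def
    proof (rule regular_mod_contracted[OF V(1)])
      fix v w assume "{v, u} \<in> E" "{w, m u} \<in> E"
      then show "proj {} v \<noteq> proj {} w" using edge_across[of v u w] edgeD(3)[of v w] by (simp add: proj_def)
    qed auto
    then show ?thesis by (simp only: contracted_empty)
  qed
  have edge_mem: "Var p * Var q \<in> (I :: ('v, 'k) mpoly set)" if "{p, q} \<in> E" for p q
  proof -
    have "{p, q} \<notin> Ind V E" using that by (auto simp: Ind_iff)
    then show ?thesis using edgeD(1,2)[OF that]
      by (simp add: stanley_reisner_def polys_def Var_mult_Var keys_single_add)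
  qed
  define W where "W = {u, m u, v, m v}"
  define \<Gamma> where "\<Gamma> = {F \<in> Ind V E. F \<inter> W = {}}"
  have neq: "u \<noteq> v" "u \<noteq> m v" "m u \<noteq> v" "m u \<noteq> m v"
    using uv edgeD(3) V matching(2) by metis+
  \<comment> \<open>Every facet above \<open>F\<close> has one vertex in \<open>{u, m u}\<close> and
    another in \<open>{v, m v}\<close>, both outside \<open>F\<close>. The bound
    \<open>2 \<le> d\<close> is recorded because \<open>d - 2\<close> is truncated.\<close>
  have \<Gamma>: "finite F \<and> card F \<le> d - 2 \<and> 2 \<le> d" if F: "F \<in> \<Gamma>" for F
  proof -
    have FI: "F \<in> Ind V E" "F \<inter> W = {}" using F by (auto simp: \<Gamma>_def)
    obtain T where T: "T \<in> facets (Ind V E)" "F \<subseteq> T" using FI(1) by (rule Ind_extend)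
    have finT: "finite T" using facet_Ind[OF T(1)] Ind_finite by blast
    obtain p where p: "p \<in> T" "p = u \<or> p = m u" using facet_matching[OF T(1) V(1)] by blast
    obtain q where q: "q \<in> T" "q = v \<or> q = m v" using facet_matching[OF T(1) V(2)] by blast
    have pq: "p \<noteq> q" using p q neq by auto
    have "F \<subseteq> T - {p, q}" using T(2) FI(2) p q by (auto simp: W_def)
    then have "card F \<le> card (T - {p, q})" using finT by (intro card_mono) auto
    also have "\<dots> = card T - card {p, q}" using p q by (intro card_Diff_subset) auto
    finally have "card F \<le> d - 2" using pq card_facet[OF T(1)] by simp
    moreover have "card {p, q} \<le> card T" using finT p q by (intro card_mono) auto
    ultimately show ?thesis using pq card_facet[OF T(1)] Ind_finite[OF FI(1)] by simp
  qed
  have fin\<Gamma>: "finite \<Gamma>" unfolding \<Gamma>_def using finite_Ind by simp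
  have d2: "2 \<le> d" using \<Gamma>[of "{}"] empty_Ind by (simp add: \<Gamma>_def)
  have \<Gamma>': "finite F \<and> card F \<le> d - 2" if "F \<in> \<Gamma>" for F using \<Gamma>[OF that] by blast
  have AX: "poly_ideal V (adjoin V I x)" by (rule adjoin_ideal[OF J(1)])
  have kill: "q * Var u \<in> adjoin V I x" if q: "q \<in> polys V" "\<And>n. n \<in> keys q \<Longrightarrow> keys n \<notin> \<Gamma>"
    for q :: "('v, 'k) mpoly"
  proof -
    \<comment> \<open>Modulo \<open>I\<close>, the products of \<open>Var u\<close> with
      \<open>Var (m u)\<close> and \<open>Var v\<close> vanish, its square is
      \<open>x * Var u\<close>, and its product with \<open>Var (m v)\<close> is
      \<open>x * Var (m v)\<close> because \<open>{m u, m v}\<close> is an edge.\<close>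
    have vars: "Var z * Var u \<in> adjoin V I x" if z: "z \<in> W" for z
    proof -
      have zV: "z \<in> V" using z V by (auto simp: W_def)
      have a: "Var u * Var (m u) \<in> (I :: ('v, 'k) mpoly set)" using edge_mem matching(1) V by blast
      have b: "Var (m u) * Var (m v) \<in> (I :: ('v, 'k) mpoly set)" using edge_mem uv(2) by blast
      have c: "Var u * Var v \<in> (I :: ('v, 'k) mpoly set)" using edge_mem uv(1) by blast
      consider "z = u" | "z = m u" | "z = v" | "z = m v" using z by (auto simp: W_def)
      then have "\<exists>s\<in>polys V. Var z * Var u - x * s \<in> I"
      proof cases
        case 1
        then show ?thesis using a V by (intro bexI[of _ "Var u"]) (simp_all add: x_def algebra_simps)
      next
        case 2
        then show ?thesis using a by (intro bexI[of _ 0]) (simp_all add: mult.commute)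
      next
        case 3
        then show ?thesis using c by (intro bexI[of _ 0]) (simp_all add: mult.commute)
      next
        case 4
        then show ?thesis using b V by (intro bexI[of _ "Var (m v)"]) (simp_all add: x_def algebra_simps)
      qed
      then show ?thesis using zV V by (auto intro: adjoinI)
    qed
    have "Poly_Mapping.single n (lookup q n) * Var u \<in> adjoin V I x" if n: "n \<in> keys q" for n
    proof (cases "keys n \<in> Ind V E")
      case True
      then obtain z where z: "z \<in> keys n" "z \<in> W" using q(2)[OF n] by (auto simp: \<Gamma>_def)
      define k where "k = n - Poly_Mapping.single z 1"
      have nk: "n = Poly_Mapping.single z 1 + k"
        unfolding k_def using z by (intro monom_remove_var) (simp add: in_keys_iff)
      have "keys n \<subseteq> V" using q(1) n by (auto simp: polys_def)
      then have kP: "Poly_Mapping.single k (lookup q n) \<in> polys V" unfolding nk keys_add_nat by (auto simp: polys_def)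
      have "Poly_Mapping.single k (lookup q n) * (Var z * Var u) \<in> adjoin V I x"
        using poly_ideal_mult[OF AX vars[OF z(2)] kP] .
      moreover have "Poly_Mapping.single n (lookup q n) = Poly_Mapping.single k (lookup q n) * Var z"
        using nk by (simp add: Var_def mult_single add.commute)
      ultimately show ?thesis by (simp only: mult.assoc)
    next
      case False
      then have "Poly_Mapping.single n (lookup q n) \<in> I" using q(1) n by (auto simp: stanley_reisner_def polys_def)
      then show ?thesis using adjoin_mono[OF J(1)] poly_ideal_mult2[OF AX] V(1) by (meson polys_Var)
    qed
    then have "(\<Sum>n\<in>keys q. Poly_Mapping.single n (lookup q n) * Var u) \<in> adjoin V I x"
      by (intro poly_ideal_sum[OF AX])
    then show ?thesis by (simp only: sum_distrib_right[symmetric] poly_mapping_sum_single[of q, symmetric])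
  qed
  have "d - 2 < length ts" using len d2 by simp
  then obtain f n where f: "leading_unit V (hom_polys V) ts f" "f \<in> hom_polys V n"
    "\<And>m. m \<in> keys f \<Longrightarrow> keys m \<notin> \<Gamma>"
    using exists_homogeneous_leading_unit[OF fin\<Gamma> \<Gamma>' _ pos] by metis
  have fP: "f \<in> polys V" using f(2) by simp
  have freg: "regular_mod V I f" using leading_unit_regular[OF J pos reg f(1)] by blast
  obtain b0 where b0: "b0 \<in> polys V" "f * Var u - x * b0 \<in> I" using kill[OF fP f(3)] by (auto elim: adjoinE)
  \<comment> \<open>One component suffices: \<open>x\<close> has degree 1 and
    \<open>f * Var u\<close> has degree \<open>n + 1\<close>.\<close>
  define b where "b = hom_comp n b0"
  have b: "b \<in> hom_polys V n" "b \<in> polys V" using b0 by (auto simp: b_def)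
  have fu: "f * Var u \<in> hom_polys V (n + 1)" using hom_polys_mult[OF f(2) Var_hom_polys[OF V(1)]] .
  have "hom_comp (n + 1) (f * Var u - x * b0) \<in> I" using b0(2) J(2) unfolding graded_ideal_def by blast
  then have fb: "f * Var u - x * b \<in> I"
    by (simp add: hom_comp_diff hom_comp_id[OF fu, simplified] hom_comp_mult[OF xh] b_def)
  have "\<exists>q. leading_unit V (hom_polys V) (take i ts @ drop (Suc i) ts) q \<and> q * b \<in> adjoin V I f"
    if i: "i < length ts" for i
  proof -
    let ?ts = "take i ts @ drop (Suc i) ts"
    have pos': "pos_hom V t" if "t \<in> set ?ts" for t
      using that pos by (auto dest: in_set_takeD in_set_dropD)
    have "d - 2 < length ?ts" using i len d2 by simp
    then obtain q k where q: "leading_unit V (hom_polys V) ?ts q" "q \<in> hom_polys V k"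
      "\<And>m. m \<in> keys q \<Longrightarrow> keys m \<notin> \<Gamma>"
      using exists_homogeneous_leading_unit[OF fin\<Gamma> \<Gamma>' _ pos'] by metis
    have qP: "q \<in> polys V" using q(2) by simp
    obtain h where h: "h \<in> polys V" "q * Var u - x * h \<in> I" using kill[OF qP q(3)] by (auto elim: adjoinE)
    \<comment> \<open>Cross-multiplying the two representations of the fraction leaves a multiple of
      the regular element \<open>x\<close>.\<close>
    have "f * (q * Var u - x * h) - q * (f * Var u - x * b) \<in> I"
      using poly_ideal_diff[OF J(1) poly_ideal_mult[OF J(1) h(2) fP] poly_ideal_mult[OF J(1) fb qP]] .
    then have "x * (q * b - f * h) \<in> I" by (simp add: algebra_simps)
    then have "q * b - f * h \<in> I" by (rule regular_modD[OF xreg, rotated]) (use qP fP b h in auto)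
    then have "q * b \<in> adjoin V I f" by (rule adjoinI) (use qP b h in auto)
    then show ?thesis using q(1) by blast
  qed
  then have "b \<in> adjoin V I f" using leading_unit_divides[OF J pos reg f(1) b(1)] by blast
  then obtain h where h: "h \<in> polys V" "b - f * h \<in> I" by (rule adjoinE)
  have "f * Var u - x * b + x * (b - f * h) \<in> I"
    using poly_ideal_add[OF J(1) fb poly_ideal_mult[OF J(1) h(2) xP]] .
  then have "f * (Var u - x * h) \<in> I" by (simp add: algebra_simps)
  then have mem: "Var u - x * h \<in> I" by (rule regular_modD[OF freg, rotated]) (use h xP V in auto)
  \<comment> \<open>Vertices are faces, so elements of \<open>I\<close> have no linear terms. At
    \<open>u\<close> this gives \<open>h\<close> the constant coefficient 1, at \<open>m u\<close>
    the constant coefficient 0.\<close>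
  have zero: "lookup (Var u - x * h) (Poly_Mapping.single z 1) = 0" if z: "z \<in> V" for z
  proof -
    have "{z} \<notin> E" using edgeD(3)[of z z] by auto
    then have "{z} \<in> Ind V E" using z by (auto simp: Ind_iff)
    moreover have "keys (Poly_Mapping.single z (1::nat)) = {z}" by simp
    ultimately have "Poly_Mapping.single z 1 \<notin> keys (Var u - x * h)"
      using mem unfolding stanley_reisner_def by fastforce
    then show ?thesis by (simp add: in_keys_iff)
  qed
  have "lookup (x * h) (Poly_Mapping.single u 1) = lookup h 0"
    "lookup (x * h) (Poly_Mapping.single (m u) 1) = - lookup h 0"
    using matching_neq[OF V(1)] by (simp_all add: x_def left_diff_distrib lookup_minus lookup_Var_mult lookup_single when_def)
  moreover have "lookup (Poly_Mapping.single u (1::nat)) u \<noteq> lookup (Poly_Mapping.single (m u) 1) u"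
    using matching_neq[OF V(1)] by (simp add: lookup_single)
  then have "Poly_Mapping.single u (1::nat) \<noteq> Poly_Mapping.single (m u) 1" by metis
  ultimately have "1 - lookup h 0 = 0" "lookup h 0 = 0"
    using zero[OF V(1)] zero[OF V(3)] matching_neq[OF V(1)] by (simp_all add: lookup_minus Var_def lookup_single when_def inj_eq)
  then show False by simp
qed

section \<open>Comparison of depth and dimension\<close>

lemma cohen_macaulay_iff:
  "cohen_macaulay_ideal V (edge_ideal V E :: ('v, 'k::field) mpoly set) \<longleftrightarrow> no_parallel_edges"
proof -
  let ?R = "{ts :: ('v, 'k) mpoly list. reg_seq V I ts \<and> 1 \<notin> adjoins V I ts \<and> (\<forall>t\<in>set ts. pos_hom V t)}"
  have depth: "graded_depth V (I :: ('v, 'k) mpoly set) = (SUP ts\<in>?R. enat (length ts))"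
    by (rule graded_depth_eq[OF poly_ideal_I])
  have le: "length ts \<le> d" if "ts \<in> ?R" for ts using that reg_seq_length_le by blast
  have "(SUP ts\<in>?R. enat (length ts)) = enat d" if good: no_parallel_edges
  proof (rule antisym)
    show "(SUP ts\<in>?R. enat (length ts)) \<le> enat d" using le by (intro SUP_least) simp
    from good obtain ts :: "('v, 'k) mpoly list" where ts: "reg_seq V I ts" "1 \<notin> adjoins V I ts"
        "\<forall>t\<in>set ts. pos_hom V t" "length ts = d"
      by (rule exists_regular_sequence)
    then have "ts \<in> ?R" by simp
    then have "enat (length ts) \<le> (SUP ts\<in>?R. enat (length ts))" by (rule SUP_upper)
    then show "enat d \<le> (SUP ts\<in>?R. enat (length ts))" by (simp only: ts(4))
  qed
  moreover have "(SUP ts\<in>?R. enat (length ts)) \<noteq> enat d" if bad: "\<not> no_parallel_edges"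
  proof -
    obtain u v where uv: "{u, v} \<in> E" "{m u, m v} \<in> E" "v \<noteq> m u" using bad unfolding no_parallel_edges_def by blast
    have lt: "length ts < d" if "ts \<in> ?R" for ts
      using le[OF that] parallel_edges_length_neq[OF uv, of ts] that by (auto simp: le_less)
    \<comment> \<open>The empty sequence has length below \<open>d\<close>, so \<open>d\<close> is
      positive and \<open>d - 1\<close> is a strict drop.\<close>
    have "[] \<in> ?R" using one_notin_I by simp
    then have "0 < d" using lt by fastforce
    have "(SUP ts\<in>?R. enat (length ts)) \<le> enat (d - 1)" using lt by (intro SUP_least) fastforce
    also have "\<dots> < enat d" using \<open>0 < d\<close> by simp
    finally show ?thesis by simp
  qed
  ultimately show ?thesis
    unfolding cohen_macaulay_ideal_def edge_ideal_eq krull_dim_eq depth by blast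
qed

end

theorem theorem5p5:
  fixes V :: "'v set" and E :: "'v set set" and d :: nat
  assumes "simple_graph V E"
    and "very_well_covered V E"
    and "card V = 2 * d"
    and "d \<ge> 1"
    and "no_isolated_vertices V E"
  shows "(pseudomanifold (Ind V E) \<longleftrightarrow>
            cohen_macaulay_ideal V (edge_ideal V E :: ('v, 'k::field) mpoly set)) \<and>
         (pseudomanifold (Ind V E) \<longrightarrow>
            (has_boundary (Ind V E) \<longleftrightarrow> \<not> is_dK2 d V E))"
proof -
  obtain m where "\<And>v. v \<in> V \<Longrightarrow> {v, m v} \<in> E" "\<And>v. v \<in> V \<Longrightarrow> m (m v) = v"
    using very_well_covered_perfect_matching[OF assms(1,2,5)] by blast
  then interpret matched_graph V E m d
    using assms by unfold_locales auto
  show ?thesis using pseudomanifold_iff cohen_macaulay_iff has_boundary_iff by blast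
qed

end
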